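(* Let $\epsilon\in\{-1,0,1\}$ and let $M$ be a Hamiltonian stationary Lagrangian surface in the complex space form $\tilde M^2(4\epsilon)$, with second fundamental form $h$ and mean curvature vector field $H$. If the mean curvature $|H|$ is a non-zero constant, then $\bar\nabla h=0$, i.e. the second fundamental form is parallel.
   Context: $\tilde M^2(4\epsilon)$ denotes the complete simply connected Kähler manifold of complex dimension $2$ and constant holomorphic sectional curvature $4\epsilon$, with complex structure $J$ and Kähler metric $\langle\cdot,\cdot\rangle$: it is $\mathbb{C}^2$ if $\epsilon=0$, the complex projective plane $\mathbb{C}P^2(4)$ if $\epsilon=1$, and the complex hyperbolic plane $\mathbb{C}H^2(-4)$ if $\epsilon=-1$. A Lagrangian surface $M$ in $\tilde M^2(4\epsilon)$ is a submanifold of real dimension $2$, with the induced Riemannian metric, such that $\langle X,JY\rangle=0$ for all tangent vector fields $X,Y$ on $M$. Let $\nabla$ and $\tilde\nabla$ be the Levi-Civita connections of $M$ and $\tilde M^2(4\epsilon)$. The second fundamental form $h$, shape operator $S$ and normal connection $D$ are given by $\tilde\nabla_XY=\nabla_XY+h(X,Y)$ and $\tilde\nabla_X\xi=-S_\xi X+D_X\xi$ for tangent vector fields $X,Y$ and normal vector fields $\xi$. The mean curvature vector field is $H=\frac12\,\mathrm{trace}\,h$, and the function $|H|$ is called the mean curvature. The covariant derivative of $h$ is $$(\bar\nabla_Xh)(Y,Z)=D_Xh(Y,Z)-h(\nabla_XY,Z)-h(Y,\nabla_XZ).$$ A normal vector field on $M$ of the form $J\nabla f$, with $f$ a compactly supported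 smooth function on $M$ and $\nabla f$ its gradient, is called a Hamiltonian variation. $M$ is Hamiltonian stationary if it is a critical point of the volume functional with respect to all Hamiltonian variations; equivalently (Oh), $\mathrm{div}(JH)=0$ on $M$, where $JH$ is regarded as a tangent vector field on $M$. *)

theory Defs
  imports "HOL-Analysis.Analysis"
begin

section \<open>Smooth maps between Euclidean spaces\<close>

fun Ck_on :: "nat \<Rightarrow> 'a::euclidean_space set \<Rightarrow> ('a \<Rightarrow> 'b::real_normed_vector) \<Rightarrow> bool" where
  "Ck_on 0 S f \<longleftrightarrow> continuous_on S f"
| "Ck_on (Suc k) S f \<longleftrightarrow>
     (\<forall>x\<in>S. f differentiable (at x)) \<and>
     (\<forall>v. Ck_on k S (\<lambda>x. frechet_derivative f (at x) v))"

text \<open>Only meant for open sets.\<close>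
definition smooth_on :: "'a::euclidean_space set \<Rightarrow> ('a \<Rightarrow> 'b::real_normed_vector) \<Rightarrow> bool" where
  "smooth_on S f \<longleftrightarrow> (\<forall>k. Ck_on k S f)"

abbreviation fderiv :: "('a::euclidean_space \<Rightarrow> 'b::real_normed_vector) \<Rightarrow> 'a \<Rightarrow> 'a \<Rightarrow> 'b" where
  "fderiv f x \<equiv> frechet_derivative f (at x)"


section \<open>Manifolds\<close>

text \<open>A manifold is a whole type (Hausdorff and second countable by its type class) with an atlas
  of local parametrizations; a parametrization maps an open subset of the model space
  homeomorphically onto an open subset of the manifold. The model space is \<open>real^2\<close> for surfaces
  and \<open>complex^2\<close> for complex surfaces.\<close>

record ('e, 'p) chart =
  chart_dom :: "'e set"
  chart_map :: "'e \<Rightarrow> 'p"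

abbreviation chart_img :: "('e, 'p) chart \<Rightarrow> 'p set" where
  "chart_img a \<equiv> chart_map a ` chart_dom a"

abbreviation chart_inv :: "('e, 'p) chart \<Rightarrow> 'p \<Rightarrow> 'e" where
  "chart_inv a \<equiv> inv_into (chart_dom a) (chart_map a)"

definition is_chart :: "('e::euclidean_space, 'p::topological_space) chart \<Rightarrow> bool" where
  "is_chart a \<longleftrightarrow> open (chart_dom a) \<and> open (chart_img a) \<and>
     inj_on (chart_map a) (chart_dom a) \<and>
     homeomorphism (chart_dom a) (chart_img a) (chart_map a) (chart_inv a)"

text \<open>Local representation of a map between manifolds, and the set on which it makes sense.\<close>

definition loc_dom :: "('e, 'p) chart \<Rightarrow> ('f, 'q) chart \<Rightarrow> ('p \<Rightarrow> 'q) \<Rightarrow> 'e set" where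
  "loc_dom a b \<psi> = {p \<in> chart_dom a. \<psi> (chart_map a p) \<in> chart_img b}"

definition loc_rep :: "('e, 'p) chart \<Rightarrow> ('f, 'q) chart \<Rightarrow> ('p \<Rightarrow> 'q) \<Rightarrow> 'e \<Rightarrow> 'f" where
  "loc_rep a b \<psi> p = chart_inv b (\<psi> (chart_map a p))"

definition smooth_atlas ::
    "('e::euclidean_space, 'p::{t2_space,second_countable_topology}) chart set \<Rightarrow> bool" where
  "smooth_atlas A \<longleftrightarrow> (\<forall>a\<in>A. is_chart a) \<and> (\<Union>a\<in>A. chart_img a) = UNIV \<and>
     (\<forall>a\<in>A. \<forall>b\<in>A. smooth_on (loc_dom a b id) (loc_rep a b id))"

definition smooth_map ::
    "('e::euclidean_space, 'p::topological_space) chart set \<Rightarrow>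
     ('f::euclidean_space, 'q::topological_space) chart set \<Rightarrow> ('p \<Rightarrow> 'q) \<Rightarrow> bool" where
  "smooth_map A B \<psi> \<longleftrightarrow> continuous_on UNIV \<psi> \<and>
     (\<forall>a\<in>A. \<forall>b\<in>B. smooth_on (loc_dom a b \<psi>) (loc_rep a b \<psi>))"

definition smooth_fun ::
    "('e::euclidean_space, 'p::topological_space) chart set \<Rightarrow> ('p \<Rightarrow> real) \<Rightarrow> bool" where
  "smooth_fun A f \<longleftrightarrow> (\<forall>a\<in>A. smooth_on (chart_dom a) (f \<circ> chart_map a))"


section \<open>Riemannian geometry in a chart\<close>

text \<open>\<open>g p v w\<close> is the inner product of \<open>v\<close> and \<open>w\<close>, tangent vectors at \<open>p\<close>. Vector fields on a
  chart domain are functions from the model space to itself.\<close>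

type_synonym 'e metric = "'e \<Rightarrow> 'e \<Rightarrow> 'e \<Rightarrow> real"

definition riemannian_metric_on :: "'e::euclidean_space set \<Rightarrow> 'e metric \<Rightarrow> bool" where
  "riemannian_metric_on U g \<longleftrightarrow>
     (\<forall>p\<in>U. bilinear (g p) \<and> (\<forall>v w. g p v w = g p w v) \<and> (\<forall>v. v \<noteq> 0 \<longrightarrow> g p v v > 0)) \<and>
     (\<forall>v w. smooth_on U (\<lambda>p. g p v w))"

text \<open>Christoffel map of the Levi-Civita connection: the Koszul formula for constant fields
  \<open>v\<close>, \<open>w\<close>, \<open>z\<close>, whose Lie brackets vanish.\<close>

definition christoffel :: "'e::euclidean_space metric \<Rightarrow> 'e \<Rightarrow> 'e \<Rightarrow> 'e \<Rightarrow> 'e" where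
  "christoffel g p v w = (THE c. \<forall>z. 2 * g p c z =
      fderiv (\<lambda>q. g q w z) p v + fderiv (\<lambda>q. g q v z) p w - fderiv (\<lambda>q. g q v w) p z)"

definition levi_civita ::
    "'e::euclidean_space metric \<Rightarrow> ('e \<Rightarrow> 'e) \<Rightarrow> ('e \<Rightarrow> 'e) \<Rightarrow> 'e \<Rightarrow> 'e" where
  "levi_civita g X Y p = fderiv Y p (X p) + christoffel g p (X p) (Y p)"

text \<open>\<open>R(u,v)w\<close>, computed with constant fields; the term with the Lie bracket vanishes.\<close>

definition curvature :: "'e::euclidean_space metric \<Rightarrow> 'e \<Rightarrow> 'e \<Rightarrow> 'e \<Rightarrow> 'e \<Rightarrow> 'e" where
  "curvature g p u v w =
     levi_civita g (\<lambda>_. u) (levi_civita g (\<lambda>_. v) (\<lambda>_. w)) p -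
     levi_civita g (\<lambda>_. v) (levi_civita g (\<lambda>_. u) (\<lambda>_. w)) p"

definition sectional_curvature :: "'e::euclidean_space metric \<Rightarrow> 'e \<Rightarrow> 'e \<Rightarrow> 'e \<Rightarrow> real" where
  "sectional_curvature g p v w =
     g p (curvature g p v w w) v / (g p v v * g p w w - (g p v w)\<^sup>2)"

definition gradient :: "'e::euclidean_space metric \<Rightarrow> ('e \<Rightarrow> real) \<Rightarrow> 'e \<Rightarrow> 'e" where
  "gradient g f p = (THE w. \<forall>v. g p w v = fderiv f p v)"

definition gram :: "(real^2) metric \<Rightarrow> real^2 \<Rightarrow> real^2^2" where
  "gram g p = (\<chi> i j. g p (axis i 1) (axis j 1))"


section \<open>Complex space forms\<close>

definition Jc :: "complex^2 \<Rightarrow> complex^2" where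
  "Jc v = \<i> *s v"

definition complex_atlas ::
    "(complex^2, 'n::{t2_space,second_countable_topology}) chart set \<Rightarrow> bool" where
  "complex_atlas B \<longleftrightarrow> smooth_atlas B \<and>
     (\<forall>b\<in>B. \<forall>c\<in>B. \<forall>z\<in>loc_dom b c id. \<forall>v.
        fderiv (loc_rep b c id) z (Jc v) = Jc (fderiv (loc_rep b c id) z v))"

text \<open>A metric on a manifold is given by its expression in each chart of the atlas.\<close>

definition riemannian_manifold ::
    "('e::euclidean_space, 'p::{t2_space,second_countable_topology}) chart set \<Rightarrow>
     (('e, 'p) chart \<Rightarrow> 'e metric) \<Rightarrow> bool" where
  "riemannian_manifold B G \<longleftrightarrow> smooth_atlas B \<and>
     (\<forall>b\<in>B. riemannian_metric_on (chart_dom b) (G b)) \<and>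
     (\<forall>b\<in>B. \<forall>c\<in>B. \<forall>z\<in>loc_dom b c id. \<forall>v w.
        G c (loc_rep b c id z) (fderiv (loc_rep b c id) z v) (fderiv (loc_rep b c id) z w)
          = G b z v w)"

text \<open>Hermitian metric whose complex structure is parallel; \<open>Jc\<close> is constant in holomorphic
  charts, so that \<open>\<nabla>J = 0\<close> is a condition on the Christoffel map.\<close>

definition kaehler_manifold ::
    "(complex^2, 'n::{t2_space,second_countable_topology}) chart set \<Rightarrow>
     ((complex^2, 'n) chart \<Rightarrow> (complex^2) metric) \<Rightarrow> bool" where
  "kaehler_manifold B G \<longleftrightarrow> complex_atlas B \<and> riemannian_manifold B G \<and>
     (\<forall>b\<in>B. \<forall>z\<in>chart_dom b. \<forall>v w.
        G b z (Jc v) (Jc w) = G b z v w \<and>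
        christoffel (G b) z v (Jc w) = Jc (christoffel (G b) z v w))"

definition is_geodesic ::
    "('e::euclidean_space, 'p::topological_space) chart set \<Rightarrow>
     (('e, 'p) chart \<Rightarrow> 'e metric) \<Rightarrow> (real \<Rightarrow> 'p) \<Rightarrow> bool" where
  "is_geodesic B G \<gamma> \<longleftrightarrow> continuous_on UNIV \<gamma> \<and>
     (\<forall>b\<in>B. \<exists>c'. \<forall>t. \<gamma> t \<in> chart_img b \<longrightarrow>
        ((\<lambda>s. chart_inv b (\<gamma> s)) has_vector_derivative c' t) (at t) \<and>
        (c' has_vector_derivative
           - christoffel (G b) (chart_inv b (\<gamma> t)) (c' t) (c' t)) (at t))"

definition geodesically_complete ::
    "('e::euclidean_space, 'p::topological_space) chart set \<Rightarrow>
     (('e, 'p) chart \<Rightarrow> 'e metric) \<Rightarrow> bool" where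
  "geodesically_complete B G \<longleftrightarrow>
     (\<forall>b\<in>B. \<forall>z\<in>chart_dom b. \<forall>v. \<exists>\<gamma>. is_geodesic B G \<gamma> \<and> \<gamma> 0 = chart_map b z \<and>
        ((\<lambda>s. chart_inv b (\<gamma> s)) has_vector_derivative v) (at 0))"

text \<open>Complete simply connected Kaehler manifold of complex dimension 2 and constant holomorphic
  sectional curvature \<open>\<kappa>\<close>.\<close>

definition complex_space_form ::
    "real \<Rightarrow> (complex^2, 'n::{t2_space,second_countable_topology}) chart set \<Rightarrow>
     ((complex^2, 'n) chart \<Rightarrow> (complex^2) metric) \<Rightarrow> bool" where
  "complex_space_form \<kappa> B G \<longleftrightarrow> kaehler_manifold B G \<and>
     geodesically_complete B G \<and> simply_connected (UNIV :: 'n set) \<and>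
     (\<forall>b\<in>B. \<forall>z\<in>chart_dom b. \<forall>v. v \<noteq> 0 \<longrightarrow> sectional_curvature (G b) z v (Jc v) = \<kappa>)"


section \<open>Submanifold geometry in charts\<close>

text \<open>Here \<open>u\<close> is the local representation of an immersion of a surface, \<open>G\<close> the ambient metric
  in the chart concerned, and fields along \<open>u\<close> are functions \<open>real^2 \<Rightarrow> complex^2\<close>.\<close>

definition pullback :: "(complex^2) metric \<Rightarrow> (real^2 \<Rightarrow> complex^2) \<Rightarrow> (real^2) metric" where
  "pullback G u p v w = G (u p) (fderiv u p v) (fderiv u p w)"

definition ambient_nabla ::
    "(complex^2) metric \<Rightarrow> (real^2 \<Rightarrow> complex^2) \<Rightarrow> (real^2 \<Rightarrow> real^2) \<Rightarrow>
     (real^2 \<Rightarrow> complex^2) \<Rightarrow> real^2 \<Rightarrow> complex^2" where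
  "ambient_nabla G u X \<xi> p =
     fderiv \<xi> p (X p) + christoffel G (u p) (fderiv u p (X p)) (\<xi> p)"

definition induced_nabla ::
    "(complex^2) metric \<Rightarrow> (real^2 \<Rightarrow> complex^2) \<Rightarrow> (real^2 \<Rightarrow> real^2) \<Rightarrow>
     (real^2 \<Rightarrow> real^2) \<Rightarrow> real^2 \<Rightarrow> real^2" where
  "induced_nabla G u = levi_civita (pullback G u)"

definition second_ff ::
    "(complex^2) metric \<Rightarrow> (real^2 \<Rightarrow> complex^2) \<Rightarrow> (real^2 \<Rightarrow> real^2) \<Rightarrow>
     (real^2 \<Rightarrow> real^2) \<Rightarrow> real^2 \<Rightarrow> complex^2" where
  "second_ff G u X Y p =
     ambient_nabla G u X (\<lambda>q. fderiv u q (Y q)) p - fderiv u p (induced_nabla G u X Y p)"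

definition normal_part ::
    "(complex^2) metric \<Rightarrow> (real^2 \<Rightarrow> complex^2) \<Rightarrow> real^2 \<Rightarrow> complex^2 \<Rightarrow> complex^2" where
  "normal_part G u p \<eta> =
     (THE \<xi>. (\<forall>v. G (u p) \<xi> (fderiv u p v) = 0) \<and> \<eta> - \<xi> \<in> range (fderiv u p))"

definition normal_nabla ::
    "(complex^2) metric \<Rightarrow> (real^2 \<Rightarrow> complex^2) \<Rightarrow> (real^2 \<Rightarrow> real^2) \<Rightarrow>
     (real^2 \<Rightarrow> complex^2) \<Rightarrow> real^2 \<Rightarrow> complex^2" where
  "normal_nabla G u X \<xi> p = normal_part G u p (ambient_nabla G u X \<xi> p)"

definition nabla_second_ff ::
    "(complex^2) metric \<Rightarrow> (real^2 \<Rightarrow> complex^2) \<Rightarrow> (real^2 \<Rightarrow> real^2) \<Rightarrow>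
     (real^2 \<Rightarrow> real^2) \<Rightarrow> (real^2 \<Rightarrow> real^2) \<Rightarrow> real^2 \<Rightarrow> complex^2" where
  "nabla_second_ff G u X Y Z p =
     normal_nabla G u X (second_ff G u Y Z) p
     - second_ff G u (induced_nabla G u X Y) Z p - second_ff G u Y (induced_nabla G u X Z) p"

text \<open>The trace in \<open>H = (1/2) trace h\<close> is \<open>g\<^sup>i\<^sup>j h(\<partial>\<^sub>i, \<partial>\<^sub>j)\<close>, with \<open>g\<close> the induced metric.\<close>

definition mean_curvature_vector ::
    "(complex^2) metric \<Rightarrow> (real^2 \<Rightarrow> complex^2) \<Rightarrow> real^2 \<Rightarrow> complex^2" where
  "mean_curvature_vector G u p = (1/2) *\<^sub>R (\<Sum>i\<in>UNIV. \<Sum>j\<in>UNIV.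
     (matrix_inv (gram (pullback G u) p) $ i $ j) *\<^sub>R
       second_ff G u (\<lambda>_. axis i 1) (\<lambda>_. axis j 1) p)"

definition mean_curvature ::
    "(complex^2) metric \<Rightarrow> (real^2 \<Rightarrow> complex^2) \<Rightarrow> real^2 \<Rightarrow> real" where
  "mean_curvature G u p =
     sqrt (G (u p) (mean_curvature_vector G u p) (mean_curvature_vector G u p))"


section \<open>Hamiltonian stationary Lagrangian surfaces\<close>

text \<open>Surfaces are immersed; \<open>A\<close> is the atlas of the surface, \<open>B\<close> and \<open>G\<close> are the atlas and the
  metric of the ambient manifold.\<close>

definition lagrangian_immersion ::
    "(real^2, 'm::{t2_space,second_countable_topology}) chart set \<Rightarrow>
     (complex^2, 'n::{t2_space,second_countable_topology}) chart set \<Rightarrow>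
     ((complex^2, 'n) chart \<Rightarrow> (complex^2) metric) \<Rightarrow> ('m \<Rightarrow> 'n) \<Rightarrow> bool" where
  "lagrangian_immersion A B G \<phi> \<longleftrightarrow> smooth_map A B \<phi> \<and>
     (\<forall>a\<in>A. \<forall>b\<in>B. \<forall>p\<in>loc_dom a b \<phi>.
        inj (fderiv (loc_rep a b \<phi>) p) \<and>
        (\<forall>v w. G b (loc_rep a b \<phi> p)
           (fderiv (loc_rep a b \<phi>) p v) (Jc (fderiv (loc_rep a b \<phi>) p w)) = 0))"

text \<open>\<open>has_area A B G \<psi> K v\<close>: the set \<open>K\<close> has area \<open>v\<close> for the (possibly degenerate) metric
  induced by \<open>\<psi>\<close>. The set is cut into finitely many disjoint pieces, each lying in one chart of the
  surface and mapped into one chart of the ambient manifold; by the change of variables formula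
  the value does not depend on the choice of the pieces.\<close>

definition has_area ::
    "(real^2, 'm::topological_space) chart set \<Rightarrow>
     (complex^2, 'n::topological_space) chart set \<Rightarrow>
     ((complex^2, 'n) chart \<Rightarrow> (complex^2) metric) \<Rightarrow> ('m \<Rightarrow> 'n) \<Rightarrow> 'm set \<Rightarrow> real \<Rightarrow> bool" where
  "has_area A B G \<psi> K v \<longleftrightarrow>
     (\<exists>(k::nat) a b S I.
        (\<forall>i<k. a i \<in> A \<and> b i \<in> B \<and> S i \<in> sets borel \<and> S i \<subseteq> loc_dom (a i) (b i) \<psi> \<and>
           ((\<lambda>p. sqrt (det (gram (pullback (G (b i)) (loc_rep (a i) (b i) \<psi>)) p)))
              has_integral I i) (S i)) \<and>
        disjoint_family_on (\<lambda>i. chart_map (a i) ` S i) {..<k} \<and>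
        (\<Union>i<k. chart_map (a i) ` S i) = K \<and>
        v = (\<Sum>i<k. I i))"

text \<open>\<open>F\<close> is a smooth variation of \<open>\<phi>\<close> with parameter \<open>\<bar>t\<bar> < \<delta>\<close>, fixed outside the compact
  set \<open>K\<close>, whose variation field is \<open>J\<nabla>f\<close>.\<close>

definition hamiltonian_variation ::
    "(real^2, 'm::{t2_space,second_countable_topology}) chart set \<Rightarrow>
     (complex^2, 'n::{t2_space,second_countable_topology}) chart set \<Rightarrow>
     ((complex^2, 'n) chart \<Rightarrow> (complex^2) metric) \<Rightarrow> ('m \<Rightarrow> 'n) \<Rightarrow>
     ('m \<Rightarrow> real) \<Rightarrow> real \<Rightarrow> 'm set \<Rightarrow> (real \<Rightarrow> 'm \<Rightarrow> 'n) \<Rightarrow> bool" where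
  "hamiltonian_variation A B G \<phi> f \<delta> K F \<longleftrightarrow>
     \<delta> > 0 \<and> compact K \<and> F 0 = \<phi> \<and> (\<forall>t q. \<bar>t\<bar> < \<delta> \<longrightarrow> q \<notin> K \<longrightarrow> F t q = \<phi> q) \<and>
     continuous_on ({-\<delta><..<\<delta>} \<times> UNIV) (\<lambda>(t, q). F t q) \<and>
     (\<forall>a\<in>A. \<forall>b\<in>B.
        smooth_on {(t, p). \<bar>t\<bar> < \<delta> \<and> p \<in> loc_dom a b (F t)} (\<lambda>(t, p). loc_rep a b (F t) p) \<and>
        (\<forall>p\<in>loc_dom a b \<phi>.
           ((\<lambda>t. loc_rep a b (F t) p) has_vector_derivative
              Jc (fderiv (loc_rep a b \<phi>) p
                (gradient (pullback (G b) (loc_rep a b \<phi>)) (f \<circ> chart_map a) p))) (at 0)))"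

definition hamiltonian_stationary ::
    "(real^2, 'm::{t2_space,second_countable_topology}) chart set \<Rightarrow>
     (complex^2, 'n::{t2_space,second_countable_topology}) chart set \<Rightarrow>
     ((complex^2, 'n) chart \<Rightarrow> (complex^2) metric) \<Rightarrow> ('m \<Rightarrow> 'n) \<Rightarrow> bool" where
  "hamiltonian_stationary A B G \<phi> \<longleftrightarrow>
     (\<forall>f \<delta> K F area.
        smooth_fun A f \<and> compact (closure {q. f q \<noteq> 0}) \<and>
        hamiltonian_variation A B G \<phi> f \<delta> K F \<and>
        (\<forall>t. \<bar>t\<bar> < \<delta> \<longrightarrow> has_area A B G (F t) K (area t)) \<longrightarrow>
        (area has_real_derivative 0) (at 0))"

definition constant_mean_curvature ::
    "(real^2, 'm::topological_space) chart set \<Rightarrow> (complex^2, 'n::topological_space) chart set \<Rightarrow>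
     ((complex^2, 'n) chart \<Rightarrow> (complex^2) metric) \<Rightarrow> ('m \<Rightarrow> 'n) \<Rightarrow> real \<Rightarrow> bool" where
  "constant_mean_curvature A B G \<phi> c \<longleftrightarrow>
     (\<forall>a\<in>A. \<forall>b\<in>B. \<forall>p\<in>loc_dom a b \<phi>. mean_curvature (G b) (loc_rep a b \<phi>) p = c)"

definition parallel_second_ff ::
    "(real^2, 'm::topological_space) chart set \<Rightarrow> (complex^2, 'n::topological_space) chart set \<Rightarrow>
     ((complex^2, 'n) chart \<Rightarrow> (complex^2) metric) \<Rightarrow> ('m \<Rightarrow> 'n) \<Rightarrow> bool" where
  "parallel_second_ff A B G \<phi> \<longleftrightarrow>
     (\<forall>a\<in>A. \<forall>b\<in>B. \<forall>X Y Z.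
        smooth_on (loc_dom a b \<phi>) X \<and> smooth_on (loc_dom a b \<phi>) Y \<and> smooth_on (loc_dom a b \<phi>) Z \<longrightarrow>
        (\<forall>p\<in>loc_dom a b \<phi>. nabla_second_ff (G b) (loc_rep a b \<phi>) X Y Z p = 0))"

end

theory Submission
  imports Defs
begin

text \<open>
  Let \<open>M\<close> be the surface, \<open>C(v, w, z) = \<langle>h(v, w), Jz\<rangle>\<close> its cubic form, which is symmetric because \<open>M\<close>
  is Lagrangian and \<open>J\<close> is parallel, and \<open>T = - JH\<close>. Since \<open>\<bar>H\<bar> = c \<noteq> 0\<close>, the field
  \<open>E\<^sub>1 = T/c\<close> and its rotation \<open>E\<^sub>2\<close> by a right angle form an orthonormal frame; let \<open>\<theta>\<^sub>1, \<theta>\<^sub>2\<close> be the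
  dual forms and \<open>\<omega>\<close> the connection form, so that \<open>d\<theta>\<^sub>1 = \<omega> \<and> \<theta>\<^sub>2\<close> and \<open>d\<theta>\<^sub>2 = - \<omega> \<and> \<theta>\<^sub>1\<close>.

  The frame is parallel. A Kaehler metric of constant holomorphic sectional curvature has an
  explicit curvature tensor (\<open>curvature_constant_holomorphic\<close>), and for it \<open>R(X, Y)Z\<close> is tangent
  to \<open>M\<close> when \<open>X, Y, Z\<close> are. So the Codazzi equation has no curvature term, and its trace says that
  \<open>tr C = 2c\<theta>\<^sub>1\<close> is closed (\<open>JH_closed\<close>). Stationarity says that \<open>\<theta>\<^sub>1\<close> is coclosed, which in
  dimension two means \<open>d\<theta>\<^sub>2 = 0\<close>. The two structure equations then give \<open>\<omega> = 0\<close> (\<open>\<omega>_zero\<close>).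

  In a parallel frame only two components of \<open>C\<close> are free, since the trace fixes the others:
  \<open>C\<^sub>1\<^sub>1\<^sub>2\<close> and \<open>C\<^sub>1\<^sub>2\<^sub>2\<close>. For them the Codazzi equation consists of the Cauchy-Riemann equations
  (\<open>codazzi\<close>), and the Gauss equation of the flat surface \<open>M\<close> confines them to a circle whose
  centre and radius depend only on \<open>c\<close> and \<open>\<epsilon>\<close> (\<open>gauss\<close>). A holomorphic function with values in a
  circle is locally constant, and a tensor with constant components in a parallel frame is parallel
  (\<open>second_ff_parallel\<close>).

  Stationarity concerns the area of variations of the whole surface. To localize it, take a bump
  function \<open>f\<close> supported in the domain of one pair of charts and move the surface along straight
  lines \<open>u + tJ\<nabla>f\<close> of the ambient chart; this is a Hamiltonian variation of the whole surface
  (\<open>F_variation\<close>). The first variation formula gives \<open>\<integral> df(T) dA = 0\<close>, and integration by parts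
  makes \<open>T\<close> divergence free (\<open>stationary_divergence\<close>).

  The Levi-Civita connection, the curvature tensor and the gradient are given in the charts as unique
  solutions of linear systems or by derivatives of such solutions. Their smoothness rests on the
  smooth dependence of the solution of a positive definite system on parameters
  (\<open>pos_def_solution_smooth\<close>).
\<close>

section \<open>Calculus of smooth maps\<close>

lemma fderiv_eqI: "(f has_derivative f') (at x) \<Longrightarrow> fderiv f x = f'"
  by (rule frechet_derivative_at[symmetric])

lemma fderiv_works: "f differentiable (at x) \<Longrightarrow> (f has_derivative fderiv f x) (at x)"
  by (simp add: frechet_derivative_works)

lemma fderiv_cong_open:
  assumes "open S" "x \<in> S" "\<And>y. y \<in> S \<Longrightarrow> f y = g y"
  shows "fderiv f x = fderiv g x" "f differentiable (at x) \<longleftrightarrow> g differentiable (at x)"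
proof -
  have "(f has_derivative f') (at x) = (g has_derivative f') (at x)" for f'
    using assms has_derivative_transform_within_open[of f f' x UNIV S g]
      has_derivative_transform_within_open[of g f' x UNIV S f] by auto
  then show "fderiv f x = fderiv g x" "f differentiable (at x) \<longleftrightarrow> g differentiable (at x)"
    by (auto simp: frechet_derivative_def differentiable_def)
qed

lemma Ck_on_cong:
  assumes "open S" "\<And>y. y \<in> S \<Longrightarrow> f y = g y"
  shows "Ck_on k S f \<longleftrightarrow> Ck_on k S g"
  using assms(2)
proof (induction k arbitrary: f g)
  case 0
  then show ?case by (auto intro: continuous_on_cong)
next
  case (Suc k)
  have "Ck_on k S (\<lambda>x. fderiv f x v) = Ck_on k S (\<lambda>x. fderiv g x v)" for v
    by (rule Suc.IH) (use fderiv_cong_open(1)[OF assms(1) _ Suc.prems] in auto)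
  then show ?case
    using fderiv_cong_open(2)[OF assms(1) _ Suc.prems] by auto
qed

lemma Ck_on_Suc_D: "Ck_on (Suc k) S f \<Longrightarrow> Ck_on k S f"
proof (induction k arbitrary: f)
  case 0
  then show ?case
    by (auto intro!: continuous_at_imp_continuous_on differentiable_imp_continuous_within)
next
  case (Suc k)
  from Suc.prems have "\<And>v. Ck_on k S (\<lambda>x. fderiv f x v)"
    by (intro Suc.IH) (auto simp only: Ck_on.simps)
  with Suc.prems show ?case by (auto simp only: Ck_on.simps)
qed

lemma Ck_on_subset: "Ck_on k S f \<Longrightarrow> T \<subseteq> S \<Longrightarrow> Ck_on k T f"
  by (induction k arbitrary: f) (auto intro: continuous_on_subset)

lemma Ck_on_local:
  assumes "\<And>x. x \<in> S \<Longrightarrow> \<exists>T. open T \<and> x \<in> T \<and> Ck_on k T f"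
  shows "Ck_on k S f"
  using assms
proof (induction k arbitrary: f)
  case 0
  show ?case unfolding Ck_on.simps
    by (rule continuous_at_imp_continuous_on)
       (metis "0" Ck_on.simps(1) continuous_on_eq_continuous_at)
next
  case (Suc k)
  then show ?case
    by (metis Ck_on.simps(2))
qed

lemma Ck_on_const: "Ck_on k S (\<lambda>x. c)"
proof (induction k arbitrary: c)
  case (Suc k)
  show ?case using Suc[of 0] by (auto)
qed auto

lemma Ck_on_linear:
  assumes "bounded_linear f" shows "Ck_on k S f"
proof (cases k)
  case 0
  then show ?thesis using assms by (simp add: linear_continuous_on)
next
  case (Suc m)
  have "fderiv f x = f" for x
    by (rule fderiv_eqI) (rule bounded_linear_imp_has_derivative[OF assms])
  moreover have "f differentiable (at x)" for x
    using assms bounded_linear_imp_differentiable by blast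
  ultimately show ?thesis by (auto simp: Suc Ck_on_const)
qed

lemma Ck_on_add:
  assumes "open S" "Ck_on k S f" "Ck_on k S g"
  shows "Ck_on k S (\<lambda>x. f x + g x)"
  using assms(2,3)
proof (induction k arbitrary: f g)
  case 0
  then show ?case by (auto intro: continuous_on_add)
next
  case (Suc k)
  have D: "((\<lambda>x. f x + g x) has_derivative (\<lambda>v. fderiv f x v + fderiv g x v)) (at x)" if "x \<in> S" for x
    using Suc.prems that by (auto intro!: has_derivative_add fderiv_works)
  have "Ck_on k S (\<lambda>x. fderiv (\<lambda>x. f x + g x) x v)" for v
    apply (subst Ck_on_cong[OF assms(1), of _ "\<lambda>x. fderiv f x v + fderiv g x v"])
    using fderiv_eqI[OF D] Suc by auto
  then show ?case using D by (auto simp: differentiable_def)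
qed

lemma Ck_on_bilinear:
  assumes "open S" "bounded_bilinear P" "Ck_on k S f" "Ck_on k S g"
  shows "Ck_on k S (\<lambda>x. P (f x) (g x))"
  using assms(3,4)
proof (induction k arbitrary: f g)
  case 0
  then show ?case using bounded_bilinear.continuous_on[OF assms(2)] by auto
next
  case (Suc k)
  have D: "((\<lambda>x. P (f x) (g x)) has_derivative
      (\<lambda>v. P (f x) (fderiv g x v) + P (fderiv f x v) (g x))) (at x)" if "x \<in> S" for x
    using Suc.prems that by (auto intro!: bounded_bilinear.FDERIV[OF assms(2)] fderiv_works)
  have "Ck_on k S (\<lambda>x. fderiv (\<lambda>x. P (f x) (g x)) x v)" for v
    apply (subst Ck_on_cong[OF assms(1), of _ "\<lambda>x. P (f x) (fderiv g x v) + P (fderiv f x v) (g x)"])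
    subgoal using fderiv_eqI[OF D] by auto
    by (intro Ck_on_add assms Suc.IH; use Suc.prems Ck_on_Suc_D in auto)
  then show ?case using D by (auto simp: differentiable_def)
qed

lemma Ck_on_compose_linear:
  assumes "open S" "bounded_linear L" "Ck_on k S f"
  shows "Ck_on k S (\<lambda>x. L (f x))"
  using assms(3)
proof (induction k arbitrary: f)
  case 0
  then show ?case
    by (simp add: assms(2) bounded_linear.continuous_on)
next
  case (Suc k)
  have D: "((\<lambda>x. L (f x)) has_derivative (\<lambda>v. L (fderiv f x v))) (at x)" if "x \<in> S" for x
    using Suc.prems that by (auto intro!: bounded_linear.has_derivative[OF assms(2)] fderiv_works)
  have "Ck_on k S (\<lambda>x. fderiv (\<lambda>x. L (f x)) x v)" for v
    apply (subst Ck_on_cong[OF assms(1), of _ "\<lambda>x. L (fderiv f x v)"])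
    using fderiv_eqI[OF D] Suc by auto
  then show ?case using D by (auto simp: differentiable_def)
qed

lemma Ck_on_sum:
  assumes "open S" "\<And>i. i \<in> I \<Longrightarrow> Ck_on k S (f i)"
  shows "Ck_on k S (\<lambda>x. \<Sum>i\<in>I. f i x)"
  using assms(2)
proof (induction I rule: infinite_finite_induct)
  case (insert i I)
  then show ?case using Ck_on_add[OF assms(1), of k "f i" "\<lambda>x. \<Sum>i\<in>I. f i x"] by auto
qed (auto simp: Ck_on_const)

text \<open>Expanding the inner derivative in the standard basis turns the chain rule into a sum of products, to
  which the induction hypothesis applies.\<close>

lemma Ck_on_compose:
  fixes g :: "'a::euclidean_space \<Rightarrow> 'b::euclidean_space" and f :: "'b \<Rightarrow> 'c::real_normed_vector"
  assumes "open S" "open T" "g ` S \<subseteq> T" "Ck_on k T f" "Ck_on k S g"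
  shows "Ck_on k S (\<lambda>x. f (g x))"
  using assms(4,5)
proof (induction k arbitrary: f)
  case 0
  then show ?case
    using continuous_on_compose2[of T f S g] assms(3) by auto
next
  case (Suc k)
  have D: "((\<lambda>x. f (g x)) has_derivative (\<lambda>v. fderiv f (g x) (fderiv g x v))) (at x)" if "x \<in> S" for x
    using Suc.prems that assms(3)
    by (intro has_derivative_compose[of g "fderiv g x" x UNIV f] fderiv_works) auto
  have E: "fderiv (\<lambda>x. f (g x)) x v = (\<Sum>b\<in>Basis. (fderiv g x v \<bullet> b) *\<^sub>R fderiv f (g x) b)" if "x \<in> S" for x v
  proof -
    have "g x \<in> T" using that assms(3) by auto
    then have "linear (fderiv f (g x))"
      using Suc.prems that by (intro linear_frechet_derivative) auto
    then have "fderiv f (g x) (\<Sum>b\<in>Basis. (fderiv g x v \<bullet> b) *\<^sub>R b) =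
       (\<Sum>b\<in>Basis. (fderiv g x v \<bullet> b) *\<^sub>R fderiv f (g x) b)"
      by (simp add: linear_sum linear_scale)
    then show ?thesis
      unfolding fderiv_eqI[OF D[OF that]] euclidean_representation .
  qed
  have "Ck_on k S (\<lambda>x. fderiv (\<lambda>x. f (g x)) x v)" for v
    apply (subst Ck_on_cong[OF assms(1) E])
     apply assumption
    apply (intro Ck_on_sum Ck_on_bilinear[OF _ bounded_bilinear_scaleR] assms Suc.IH
       Ck_on_compose_linear[OF _ bounded_linear_inner_left])
    using Suc.prems Ck_on_Suc_D by auto
  then show ?case using D by (auto simp: differentiable_def)
qed

lemma Ck_on_inverse:
  fixes f :: "'a::euclidean_space \<Rightarrow> real"
  assumes "open S" "Ck_on k S f" "\<And>x. x \<in> S \<Longrightarrow> f x \<noteq> 0"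
  shows "Ck_on k S (\<lambda>x. inverse (f x))"
  using assms(2)
proof (induction k)
  case 0
  then show ?case using assms by (auto intro!: continuous_on_inverse)
next
  case (Suc k)
  have D: "((\<lambda>x. inverse (f x)) has_derivative (\<lambda>v. - (inverse (f x) * fderiv f x v * inverse (f x)))) (at x)"
    if "x \<in> S" for x
    using Suc.prems that assms by (auto intro!: Deriv.has_derivative_inverse fderiv_works)
  have "Ck_on k S (\<lambda>x. fderiv (\<lambda>x. inverse (f x)) x v)" for v
    apply (subst Ck_on_cong[OF assms(1), of _ "\<lambda>x. - (inverse (f x) * fderiv f x v * inverse (f x))"])
    subgoal using fderiv_eqI[OF D] by auto
    apply (rule Ck_on_compose_linear[OF assms(1) bounded_linear_minus[OF bounded_linear_ident]])
    by (intro Ck_on_bilinear[OF assms(1) bounded_bilinear_mult] Suc.IH; use Suc.prems Ck_on_Suc_D in auto)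
  then show ?case using D by (auto simp: differentiable_def)
qed

lemma Ck_on_sqrt:
  fixes f :: "'a::euclidean_space \<Rightarrow> real"
  assumes "open S" "Ck_on k S f" "\<And>x. x \<in> S \<Longrightarrow> f x > 0"
  shows "Ck_on k S (\<lambda>x. sqrt (f x))"
  using assms(2)
proof (induction k)
  case 0
  then show ?case using assms by (auto intro!: continuous_on_real_sqrt)
next
  case (Suc k)
  have D: "((\<lambda>x. sqrt (f x)) has_derivative (\<lambda>v. inverse (2 * sqrt (f x)) * fderiv f x v)) (at x)"
    if "x \<in> S" for x
    using Suc.prems that assms
    by (auto intro!: derivative_eq_intros fderiv_works simp: field_simps)
  have sq: "Ck_on k S (\<lambda>x. inverse (2 * sqrt (f x)))"
    apply (rule Ck_on_inverse[OF assms(1)])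
     apply (rule Ck_on_compose_linear[OF assms(1) bounded_linear_mult_right])
    using Suc Ck_on_Suc_D assms(3) by (auto simp: less_imp_neq[symmetric] dest!: assms(3))
  have "Ck_on k S (\<lambda>x. fderiv (\<lambda>x. sqrt (f x)) x v)" for v
    apply (subst Ck_on_cong[OF assms(1), of _ "\<lambda>x. inverse (2 * sqrt (f x)) * fderiv f x v"])
    subgoal using fderiv_eqI[OF D] by auto
    by (intro Ck_on_bilinear[OF assms(1) bounded_bilinear_mult] sq; use Suc.prems in auto)
  then show ?case using D by (auto simp: differentiable_def)
qed

named_theorems smooth_intros

lemma smooth_on_cong:
  "open S \<Longrightarrow> (\<And>y. y \<in> S \<Longrightarrow> f y = g y) \<Longrightarrow> smooth_on S f \<longleftrightarrow> smooth_on S g"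
  unfolding smooth_on_def using Ck_on_cong by blast

lemma smooth_on_subset: "smooth_on S f \<Longrightarrow> T \<subseteq> S \<Longrightarrow> smooth_on T f"
  unfolding smooth_on_def using Ck_on_subset by blast

lemma smooth_on_local:
  "(\<And>x. x \<in> S \<Longrightarrow> \<exists>T. open T \<and> x \<in> T \<and> smooth_on T f) \<Longrightarrow> smooth_on S f"
  unfolding smooth_on_def by (meson Ck_on_local)

lemma smooth_on_differentiable: "smooth_on S f \<Longrightarrow> x \<in> S \<Longrightarrow> f differentiable (at x)"
  unfolding smooth_on_def by (metis Ck_on.simps(2))

lemma smooth_on_has_derivative: "smooth_on S f \<Longrightarrow> x \<in> S \<Longrightarrow> (f has_derivative fderiv f x) (at x)"
  by (intro fderiv_works smooth_on_differentiable)

lemma smooth_on_continuous: "smooth_on S f \<Longrightarrow> continuous_on S f"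
  unfolding smooth_on_def by (metis Ck_on.simps(1))

lemma smooth_on_fderiv [smooth_intros]: "smooth_on S f \<Longrightarrow> smooth_on S (\<lambda>x. fderiv f x v)"
  unfolding smooth_on_def by (metis Ck_on.simps(2))

lemma smooth_on_const [smooth_intros]: "smooth_on S (\<lambda>x. c)"
  by (simp add: smooth_on_def Ck_on_const)

lemma smooth_on_linear: "bounded_linear f \<Longrightarrow> smooth_on S f"
  by (simp add: smooth_on_def Ck_on_linear)

lemma smooth_on_ident [smooth_intros]: "smooth_on S (\<lambda>x. x)"
  by (rule smooth_on_linear) (rule bounded_linear_ident)

lemma smooth_on_compose_linear:
  "bounded_linear L \<Longrightarrow> open S \<Longrightarrow> smooth_on S f \<Longrightarrow> smooth_on S (\<lambda>x. L (f x))"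
  by (simp add: smooth_on_def Ck_on_compose_linear)

lemma smooth_on_bilinear:
  "bounded_bilinear P \<Longrightarrow> open S \<Longrightarrow> smooth_on S f \<Longrightarrow> smooth_on S g \<Longrightarrow> smooth_on S (\<lambda>x. P (f x) (g x))"
  by (simp add: smooth_on_def Ck_on_bilinear)

lemma smooth_on_add [smooth_intros]:
  "open S \<Longrightarrow> smooth_on S f \<Longrightarrow> smooth_on S g \<Longrightarrow> smooth_on S (\<lambda>x. f x + g x)"
  by (simp add: smooth_on_def Ck_on_add)

lemma smooth_on_sum [smooth_intros]:
  "open S \<Longrightarrow> (\<And>i. i \<in> I \<Longrightarrow> smooth_on S (f i)) \<Longrightarrow> smooth_on S (\<lambda>x. \<Sum>i\<in>I. f i x)"
  by (simp add: smooth_on_def Ck_on_sum)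

lemma smooth_on_compose:
  fixes g :: "'a::euclidean_space \<Rightarrow> 'b::euclidean_space" and f :: "'b \<Rightarrow> 'c::real_normed_vector"
  shows "open S \<Longrightarrow> open T \<Longrightarrow> g ` S \<subseteq> T \<Longrightarrow> smooth_on T f \<Longrightarrow> smooth_on S g \<Longrightarrow> smooth_on S (\<lambda>x. f (g x))"
  unfolding smooth_on_def using Ck_on_compose by blast

lemmas smooth_on_scaleR [smooth_intros] = smooth_on_bilinear[OF bounded_bilinear_scaleR]
lemmas smooth_on_mult [smooth_intros] = smooth_on_bilinear[OF bounded_bilinear_mult]
lemmas smooth_on_inner [smooth_intros] = smooth_on_bilinear[OF bounded_bilinear_inner]
lemmas smooth_on_nth [smooth_intros] = smooth_on_compose_linear[OF bounded_linear_vec_nth]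
lemmas smooth_on_minus [smooth_intros] = smooth_on_compose_linear[OF bounded_linear_minus[OF bounded_linear_ident]]
lemmas smooth_on_fst [smooth_intros] = smooth_on_compose_linear[OF bounded_linear_fst]
lemmas smooth_on_snd [smooth_intros] = smooth_on_compose_linear[OF bounded_linear_snd]

lemma smooth_on_diff [smooth_intros]:
  "open S \<Longrightarrow> smooth_on S f \<Longrightarrow> smooth_on S g \<Longrightarrow> smooth_on S (\<lambda>x. f x - g x)"
  using smooth_on_add[of S f "\<lambda>x. - g x"] smooth_on_minus[of S g] by auto

lemma smooth_on_inverse [smooth_intros]:
  fixes f :: "'a::euclidean_space \<Rightarrow> real"
  shows "open S \<Longrightarrow> smooth_on S f \<Longrightarrow> (\<And>x. x \<in> S \<Longrightarrow> f x \<noteq> 0) \<Longrightarrow> smooth_on S (\<lambda>x. inverse (f x))"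
  by (simp add: smooth_on_def Ck_on_inverse)

lemma smooth_on_divide [smooth_intros]:
  fixes f :: "'a::euclidean_space \<Rightarrow> real"
  shows "open S \<Longrightarrow> smooth_on S f \<Longrightarrow> smooth_on S g \<Longrightarrow> (\<And>x. x \<in> S \<Longrightarrow> g x \<noteq> 0) \<Longrightarrow>
     smooth_on S (\<lambda>x. f x / g x)"
  unfolding divide_inverse by (intro smooth_intros)

lemma smooth_on_sqrt [smooth_intros]:
  fixes f :: "'a::euclidean_space \<Rightarrow> real"
  shows "open S \<Longrightarrow> smooth_on S f \<Longrightarrow> (\<And>x. x \<in> S \<Longrightarrow> f x > 0) \<Longrightarrow> smooth_on S (\<lambda>x. sqrt (f x))"
  by (simp add: smooth_on_def Ck_on_sqrt)

lemma continuous_at_dist_char: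
  "continuous (at x) f \<longleftrightarrow> (\<forall>e>0. \<exists>d>0. \<forall>y. dist y x < d \<longrightarrow> dist (f y) (f x) < e)"
  for f :: "'a::metric_space \<Rightarrow> 'b::metric_space"
  unfolding continuous_at_eps_delta by auto

text \<open>The second difference of \<open>f\<close> over the parallelogram spanned by \<open>hv\<close> and \<open>hw\<close> is symmetric in \<open>v\<close> and
  \<open>w\<close>; two applications of the mean value theorem express it by an iterated derivative. Exchanging
  the roles of \<open>v\<close> and \<open>w\<close> and letting \<open>h\<close> tend to 0 gives the symmetry of second derivatives.\<close>

lemma second_difference_mvt:
  fixes f :: "'a::euclidean_space \<Rightarrow> real"
  assumes S: "\<And>s t. 0 \<le> s \<Longrightarrow> s \<le> h \<Longrightarrow> 0 \<le> t \<Longrightarrow> t \<le> h \<Longrightarrow> x + s *\<^sub>R v + t *\<^sub>R w \<in> S"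
    and f: "\<And>y. y \<in> S \<Longrightarrow> f differentiable (at y)"
    and f': "\<And>y. y \<in> S \<Longrightarrow> (\<lambda>z. fderiv f z v) differentiable (at y)"
    and h: "h > 0"
  obtains s t where "0 \<le> s" "s \<le> h" "0 \<le> t" "t \<le> h"
    "f (x + h *\<^sub>R v + h *\<^sub>R w) - f (x + h *\<^sub>R v) - f (x + h *\<^sub>R w) + f x =
      h * h * fderiv (\<lambda>z. fderiv f z v) (x + s *\<^sub>R v + t *\<^sub>R w) w"
proof -
  have chain: "((\<lambda>r. k (y + r *\<^sub>R d)) has_real_derivative fderiv k (y + r *\<^sub>R d) d) (at r)"
    if "k differentiable (at (y + r *\<^sub>R d))" for k :: "'a \<Rightarrow> real" and y d r
  proof -
    have "((\<lambda>r. k (y + r *\<^sub>R d)) has_derivative (\<lambda>a. fderiv k (y + r *\<^sub>R d) (a *\<^sub>R d))) (at r)"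
      by (rule has_derivative_compose[of "\<lambda>r. y + r *\<^sub>R d" "\<lambda>a. a *\<^sub>R d" r UNIV k, OF _ fderiv_works[OF that]])
        (auto intro!: derivative_eq_intros)
    moreover have "(\<lambda>a. fderiv k (y + r *\<^sub>R d) (a *\<^sub>R d)) = (*) (fderiv k (y + r *\<^sub>R d) d)"
      using linear_frechet_derivative[OF that] by (auto simp: linear_scale mult.commute)
    ultimately show ?thesis
      unfolding has_field_derivative_def by simp
  qed
  define P where "P s = f (x + h *\<^sub>R w + s *\<^sub>R v) - f (x + s *\<^sub>R v)" for s
  have "(P has_real_derivative (fderiv f (x + h *\<^sub>R w + s *\<^sub>R v) v - fderiv f (x + s *\<^sub>R v) v)) (at s)"
    if "0 \<le> s" "s \<le> h" for s
    unfolding P_def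
    using S[OF that, of h] S[OF that, of 0] h
    by (intro DERIV_diff chain f) (auto simp: algebra_simps)
  from MVT2[OF h this] obtain s where s: "0 < s" "s < h"
    and 1: "P h - P 0 = (h - 0) * (fderiv f (x + h *\<^sub>R w + s *\<^sub>R v) v - fderiv f (x + s *\<^sub>R v) v)" by blast
  define Q where "Q t = fderiv f (x + s *\<^sub>R v + t *\<^sub>R w) v" for t
  have "(Q has_real_derivative (fderiv (\<lambda>z. fderiv f z v) (x + s *\<^sub>R v + t *\<^sub>R w) w)) (at t)"
    if "0 \<le> t" "t \<le> h" for t
    unfolding Q_def using S[OF _ _ that, of s] s by (intro chain f') auto
  from MVT2[OF h this] obtain t where t: "0 < t" "t < h"
    and 2: "Q h - Q 0 = (h - 0) * fderiv (\<lambda>z. fderiv f z v) (x + s *\<^sub>R v + t *\<^sub>R w) w" by blast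
  show thesis
    by (rule that[of s t]) (use s t 1 2 in \<open>auto simp: P_def Q_def algebra_simps\<close>)
qed

lemma second_fderiv_symmetric_real:
  fixes f :: "'a::euclidean_space \<Rightarrow> real"
  assumes "open S" "x \<in> S" "smooth_on S f"
  shows "fderiv (\<lambda>y. fderiv f y v) x w = fderiv (\<lambda>y. fderiv f y w) x v"
proof (rule ccontr)
  let ?A = "\<lambda>y. fderiv (\<lambda>y. fderiv f y v) y w" and ?B = "\<lambda>y. fderiv (\<lambda>y. fderiv f y w) y v"
  assume ne: "?A x \<noteq> ?B x"
  have "smooth_on S ?A" "smooth_on S ?B" using assms(3) by (auto intro!: smooth_intros)
  then have "continuous (at x) ?A" "continuous (at x) ?B"
    using assms continuous_on_eq_continuous_at smooth_on_continuous by blast+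
  moreover define e where "e = dist (?A x) (?B x) / 2"
  moreover have "e > 0" using ne by (simp add: e_def)
  ultimately obtain d1 d2 where d: "d1 > 0" "d2 > 0"
     "\<And>y. dist y x < d1 \<Longrightarrow> dist (?A y) (?A x) < e"
     "\<And>y. dist y x < d2 \<Longrightarrow> dist (?B y) (?B x) < e"
    unfolding continuous_at_dist_char by blast
  obtain d3 where d3: "d3 > 0" "ball x d3 \<subseteq> S" using assms open_contains_ball by blast
  define d where "d = min d1 (min d2 d3)"
  define h where "h = d / (2 * (norm v + norm w + 1))"
  have h: "h > 0" unfolding h_def d_def using d d3
    by (intro divide_pos_pos) (auto intro: add_nonneg_pos)
  have near: "dist (x + s *\<^sub>R v + t *\<^sub>R w) x < d" if "0 \<le> s" "s \<le> h" "0 \<le> t" "t \<le> h" for s t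
  proof -
    have "dist (x + s *\<^sub>R v + t *\<^sub>R w) x = norm (s *\<^sub>R v + t *\<^sub>R w)" by (simp add: dist_norm)
    also have "\<dots> \<le> s * norm v + t * norm w"
      using norm_triangle_ineq[of "s *\<^sub>R v" "t *\<^sub>R w"] that by simp
    also have "\<dots> \<le> h * norm v + h * norm w" using that by (intro add_mono mult_right_mono) auto
    also have "\<dots> = h * (norm v + norm w)" by (simp add: distrib_left)
    also have "\<dots> < h * (2 * (norm v + norm w + 1))"
    proof (rule mult_strict_left_mono)
      show "norm v + norm w < 2 * (norm v + norm w + 1)"
        using norm_ge_zero[of v] norm_ge_zero[of w] by argo
    qed (rule h)
    also have "\<dots> = d"
    proof -
      have "2 * (norm v + norm w + 1) \<noteq> 0" using norm_ge_zero[of v] norm_ge_zero[of w] by argo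
      then show ?thesis unfolding h_def by simp
    qed
    finally show ?thesis .
  qed
  have nearS: "x + s *\<^sub>R v + t *\<^sub>R w \<in> S" "x + t *\<^sub>R w + s *\<^sub>R v \<in> S"
    if "0 \<le> s" "s \<le> h" "0 \<le> t" "t \<le> h" for s t
  proof -
    have "x + s *\<^sub>R v + t *\<^sub>R w \<in> ball x d3"
      using near[OF that] unfolding d_def by (simp add: dist_commute)
    then show "x + s *\<^sub>R v + t *\<^sub>R w \<in> S" using d3 by blast
    then show "x + t *\<^sub>R w + s *\<^sub>R v \<in> S" by (simp add: add.commute add.left_commute)
  qed
  have diff: "\<And>y. y \<in> S \<Longrightarrow> f differentiable (at y)"
     "\<And>y u. y \<in> S \<Longrightarrow> (\<lambda>z. fderiv f z u) differentiable (at y)"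
    using assms(3) smooth_on_differentiable smooth_on_fderiv by blast+
  obtain s t where 1: "0 \<le> s" "s \<le> h" "0 \<le> t" "t \<le> h"
    "f (x + h *\<^sub>R v + h *\<^sub>R w) - f (x + h *\<^sub>R v) - f (x + h *\<^sub>R w) + f x = h * h * ?A (x + s *\<^sub>R v + t *\<^sub>R w)"
    by (rule second_difference_mvt[of h x v w S f]) (use nearS diff h in auto)
  obtain s' t' where 2: "0 \<le> s'" "s' \<le> h" "0 \<le> t'" "t' \<le> h"
    "f (x + h *\<^sub>R w + h *\<^sub>R v) - f (x + h *\<^sub>R w) - f (x + h *\<^sub>R v) + f x = h * h * ?B (x + s' *\<^sub>R w + t' *\<^sub>R v)"
    by (rule second_difference_mvt[of h x w v S f]) (use nearS diff h in auto)
  have "h * h * ?A (x + s *\<^sub>R v + t *\<^sub>R w) = h * h * ?B (x + s' *\<^sub>R w + t' *\<^sub>R v)"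
    using 1(5) 2(5) by (simp add: algebra_simps)
  then have eq: "?A (x + s *\<^sub>R v + t *\<^sub>R w) = ?B (x + t' *\<^sub>R v + s' *\<^sub>R w)" using h by (simp add: algebra_simps)
  have "dist (?A (x + s *\<^sub>R v + t *\<^sub>R w)) (?A x) < e"
    using near[OF 1(1-4)] d(3) unfolding d_def by auto
  moreover have "dist (?B (x + t' *\<^sub>R v + s' *\<^sub>R w)) (?B x) < e"
    using near[OF 2(3,4,1,2)] d(4) unfolding d_def by auto
  ultimately show False unfolding eq
    using dist_triangle2[of "?A x" "?B x" "?B (x + t' *\<^sub>R v + s' *\<^sub>R w)"]
    by (simp add: e_def dist_commute)
qed

lemma second_fderiv_symmetric:
  fixes f :: "'a::euclidean_space \<Rightarrow> 'b::euclidean_space"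
  assumes "open S" "x \<in> S" "smooth_on S f"
  shows "fderiv (\<lambda>y. fderiv f y v) x w = fderiv (\<lambda>y. fderiv f y w) x v"
proof (rule euclidean_eqI)
  fix b :: 'b assume b: "b \<in> Basis"
  have 1: "fderiv (\<lambda>y. k y \<bullet> b) y u = fderiv k y u \<bullet> b" if "k differentiable (at y)" for k :: "'a \<Rightarrow> 'b" and y u
    by (subst fderiv_eqI[of _ "\<lambda>u. fderiv k y u \<bullet> b"])
       (use fderiv_works[OF that] in \<open>auto intro!: derivative_eq_intros\<close>)
  have "fderiv (\<lambda>y. fderiv f y a) x c \<bullet> b = fderiv (\<lambda>y. fderiv (\<lambda>y. f y \<bullet> b) y a) x c" for a c
  proof -
    have "fderiv (\<lambda>y. fderiv f y a) x c \<bullet> b = fderiv (\<lambda>y. fderiv f y a \<bullet> b) x c"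
      by (subst 1) (use assms smooth_on_differentiable smooth_on_fderiv in blast)+
    also have "\<dots> = fderiv (\<lambda>y. fderiv (\<lambda>y. f y \<bullet> b) y a) x c"
      using fderiv_cong_open(1)[OF assms(1,2), of "\<lambda>y. fderiv f y a \<bullet> b" "\<lambda>y. fderiv (\<lambda>y. f y \<bullet> b) y a"]
        1 smooth_on_differentiable[OF assms(3)] by auto
    finally show ?thesis .
  qed
  then show "fderiv (\<lambda>y. fderiv f y v) x w \<bullet> b = fderiv (\<lambda>y. fderiv f y w) x v \<bullet> b"
    using second_fderiv_symmetric_real[OF assms(1,2), of "\<lambda>y. f y \<bullet> b" v w]
      smooth_on_inner[OF assms(1,3) smooth_on_const] by simp
qed

section \<open>Fields of bilinear maps and their inverses\<close>

lemma bilinear_expand: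
  fixes B :: "'x::euclidean_space \<Rightarrow> 'y::euclidean_space \<Rightarrow> 'c::real_vector"
  assumes "bilinear B"
  shows "B x y = (\<Sum>i\<in>Basis. \<Sum>j\<in>Basis. ((x \<bullet> i) * (y \<bullet> j)) *\<^sub>R B i j)"
proof -
  have l: "linear (\<lambda>x. B x y)" for y using assms by (simp add: bilinear_def)
  have r: "linear (B x)" for x using assms by (simp add: bilinear_def)
  have "B x y = B (\<Sum>i\<in>Basis. (x \<bullet> i) *\<^sub>R i) y" by (simp add: euclidean_representation)
  also have "\<dots> = (\<Sum>i\<in>Basis. (x \<bullet> i) *\<^sub>R B i y)"
    by (simp add: linear_sum[OF l] linear_scale[OF l])
  also have "\<dots> = (\<Sum>i\<in>Basis. (x \<bullet> i) *\<^sub>R B i (\<Sum>j\<in>Basis. (y \<bullet> j) *\<^sub>R j))" 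
    by (simp add: euclidean_representation)
  also have "\<dots> = (\<Sum>i\<in>Basis. \<Sum>j\<in>Basis. ((x \<bullet> i) * (y \<bullet> j)) *\<^sub>R B i j)"
    by (simp only: linear_sum[OF r] linear_scale[OF r] scaleR_sum_right scaleR_scaleR)
  finally show ?thesis .
qed

lemma smooth_on_bilinear_field:
  fixes B :: "'e::euclidean_space \<Rightarrow> 'x::euclidean_space \<Rightarrow> 'y::euclidean_space \<Rightarrow> 'c::real_normed_vector"
  assumes "open U" "\<And>q. q \<in> U \<Longrightarrow> bilinear (B q)" "\<And>x y. smooth_on U (\<lambda>q. B q x y)"
    and "smooth_on U \<xi>" "smooth_on U \<eta>"
  shows "smooth_on U (\<lambda>q. B q (\<xi> q) (\<eta> q))"
proof -
  have "smooth_on U (\<lambda>q. \<Sum>i\<in>Basis. \<Sum>j\<in>Basis. ((\<xi> q \<bullet> i) * (\<eta> q \<bullet> j)) *\<^sub>R B q i j)"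
    by (intro smooth_on_sum smooth_on_scaleR smooth_on_mult smooth_on_inner smooth_on_const assms)
  then show ?thesis
    by (subst smooth_on_cong[OF assms(1) bilinear_expand[OF assms(2)]])
qed

text \<open>Metrics and Christoffel maps are bilinear maps that depend on the point; this is the product rule
  for evaluating such a map on two fields.\<close>

lemma has_derivative_bilinear_field:
  fixes B :: "'e::euclidean_space \<Rightarrow> 'x::euclidean_space \<Rightarrow> 'y::euclidean_space \<Rightarrow> 'c::real_normed_vector"
  assumes U: "open U" "p \<in> U" and B: "\<And>q. q \<in> U \<Longrightarrow> bilinear (B q)"
    and dB: "\<And>x y. (\<lambda>q. B q x y) differentiable (at p)"
    and d: "(\<xi> has_derivative \<xi>') (at p)" "(\<eta> has_derivative \<eta>') (at p)"
  shows "((\<lambda>q. B q (\<xi> q) (\<eta> q)) has_derivative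
     (\<lambda>v. fderiv (\<lambda>q. B q (\<xi> p) (\<eta> p)) p v + B p (\<xi>' v) (\<eta> p) + B p (\<xi> p) (\<eta>' v))) (at p)"
proof -
  define D where "D \<xi> \<eta> v = (\<Sum>i\<in>Basis. \<Sum>j\<in>Basis. ((\<xi> p \<bullet> i) * (\<eta> p \<bullet> j)) *\<^sub>R fderiv (\<lambda>q. B q i j) p v)"
    for \<xi> :: "'e \<Rightarrow> 'x" and \<eta> :: "'e \<Rightarrow> 'y" and v
  have *: "((\<lambda>q. B q (\<xi> q) (\<eta> q)) has_derivative
     (\<lambda>v. D \<xi> \<eta> v + B p (\<xi>' v) (\<eta> p) + B p (\<xi> p) (\<eta>' v))) (at p)"
    if "(\<xi> has_derivative \<xi>') (at p)" "(\<eta> has_derivative \<eta>') (at p)" for \<xi> \<xi>' \<eta> \<eta>'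
  proof -
    have "((\<lambda>q. \<Sum>i\<in>Basis. \<Sum>j\<in>Basis. ((\<xi> q \<bullet> i) * (\<eta> q \<bullet> j)) *\<^sub>R B q i j) has_derivative
       (\<lambda>v. \<Sum>i\<in>Basis. \<Sum>j\<in>Basis. ((\<xi> p \<bullet> i) * (\<eta> p \<bullet> j)) *\<^sub>R fderiv (\<lambda>q. B q i j) p v +
            ((\<xi> p \<bullet> i) * (\<eta>' v \<bullet> j) + (\<xi>' v \<bullet> i) * (\<eta> p \<bullet> j)) *\<^sub>R B p i j)) (at p)"
      by (intro has_derivative_sum has_derivative_scaleR has_derivative_mult has_derivative_inner_left that
          fderiv_works dB)
    moreover have "(\<Sum>i\<in>Basis. \<Sum>j\<in>Basis. ((\<xi> p \<bullet> i) * (\<eta> p \<bullet> j)) *\<^sub>R fderiv (\<lambda>q. B q i j) p v +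
            ((\<xi> p \<bullet> i) * (\<eta>' v \<bullet> j) + (\<xi>' v \<bullet> i) * (\<eta> p \<bullet> j)) *\<^sub>R B p i j)
         = D \<xi> \<eta> v + B p (\<xi>' v) (\<eta> p) + B p (\<xi> p) (\<eta>' v)" for v
      unfolding D_def bilinear_expand[OF B[OF U(2)], of "\<xi>' v" "\<eta> p"] bilinear_expand[OF B[OF U(2)], of "\<xi> p" "\<eta>' v"]
      by (simp add: sum.distrib scaleR_add_left algebra_simps)
    ultimately have "((\<lambda>q. \<Sum>i\<in>Basis. \<Sum>j\<in>Basis. ((\<xi> q \<bullet> i) * (\<eta> q \<bullet> j)) *\<^sub>R B q i j) has_derivative
       (\<lambda>v. D \<xi> \<eta> v + B p (\<xi>' v) (\<eta> p) + B p (\<xi> p) (\<eta>' v))) (at p)" by simp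
    then show ?thesis
      by (rule has_derivative_transform_within_open[OF _ U]) (simp add: bilinear_expand[OF B, symmetric])
  qed
  have b0: "B p 0 y = 0" "B p x 0 = 0" for x y
    using B[OF U(2)] by (auto simp: bilinear_lzero bilinear_rzero)
  have "((\<lambda>q. B q (\<xi> p) (\<eta> p)) has_derivative (\<lambda>v. D \<xi> \<eta> v)) (at p)"
    using *[of "\<lambda>q. \<xi> p" "\<lambda>v. 0" "\<lambda>q. \<eta> p" "\<lambda>v. 0"] by (simp add: b0 D_def)
  from fderiv_eqI[OF this] show ?thesis using *[OF d] by simp
qed

lemma fderiv_bilinear_field:
  fixes B :: "'e::euclidean_space \<Rightarrow> 'x::euclidean_space \<Rightarrow> 'y::euclidean_space \<Rightarrow> 'c::real_normed_vector"
  assumes "open U" "p \<in> U" "\<And>q. q \<in> U \<Longrightarrow> bilinear (B q)" "\<And>x y. smooth_on U (\<lambda>q. B q x y)"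
    and "smooth_on U \<xi>" "smooth_on U \<eta>"
  shows "fderiv (\<lambda>q. B q (\<xi> q) (\<eta> q)) p v =
     fderiv (\<lambda>q. B q (\<xi> p) (\<eta> p)) p v + B p (fderiv \<xi> p v) (\<eta> p) + B p (\<xi> p) (fderiv \<eta> p v)"
  using fderiv_eqI[OF has_derivative_bilinear_field[of U p B \<xi> "fderiv \<xi> p" \<eta> "fderiv \<eta> p"]] assms
    smooth_on_differentiable smooth_on_has_derivative by (metis (no_types, lifting))

lemma bilinear_scaleR_linear: "linear L \<Longrightarrow> bilinear (\<lambda>x (r::real). r *\<^sub>R L x)"
  by (auto simp: bilinear_def linear_iff algebra_simps)

text \<open>A field of linear maps is the field of bilinear maps \<open>(x, r) \<mapsto> r L(x)\<close> with second argument 1.\<close>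

lemma smooth_on_linear_field:
  fixes L :: "'e::euclidean_space \<Rightarrow> 'x::euclidean_space \<Rightarrow> 'c::real_normed_vector"
  assumes "open U" "\<And>q. q \<in> U \<Longrightarrow> linear (L q)" "\<And>x. smooth_on U (\<lambda>q. L q x)" "smooth_on U \<xi>"
  shows "smooth_on U (\<lambda>q. L q (\<xi> q))"
  using smooth_on_bilinear_field[of U "\<lambda>q x r. (r::real) *\<^sub>R L q x" \<xi> "\<lambda>_. 1"] assms
  by (simp add: bilinear_scaleR_linear smooth_intros)

lemma fderiv_linear_field:
  fixes L :: "'e::euclidean_space \<Rightarrow> 'x::euclidean_space \<Rightarrow> 'c::real_normed_vector"
  assumes "open U" "p \<in> U" "\<And>q. q \<in> U \<Longrightarrow> linear (L q)" "\<And>x. smooth_on U (\<lambda>q. L q x)" "smooth_on U \<xi>"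
  shows "fderiv (\<lambda>q. L q (\<xi> q)) p v = fderiv (\<lambda>q. L q (\<xi> p)) p v + L p (fderiv \<xi> p v)"
  using fderiv_bilinear_field[of U p "\<lambda>q x r. (r::real) *\<^sub>R L q x" \<xi> "\<lambda>_. 1" v] assms
  by (simp add: bilinear_scaleR_linear smooth_intros)

lemma smooth_on_linear_fderiv: "smooth_on S f \<Longrightarrow> x \<in> S \<Longrightarrow> linear (fderiv f x)"
  by (intro linear_frechet_derivative smooth_on_differentiable)

lemma smooth_on_fderiv_field [smooth_intros]:
  fixes f :: "'e::euclidean_space \<Rightarrow> 'c::real_normed_vector"
  assumes "open U" "smooth_on U f" "smooth_on U \<xi>"
  shows "smooth_on U (\<lambda>q. fderiv f q (\<xi> q))"
  by (rule smooth_on_linear_field[OF assms(1) smooth_on_linear_fderiv[OF assms(2)]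
      smooth_on_fderiv[OF assms(2)] assms(3)])

lemma fderiv_compose:
  assumes "g differentiable (at x)" "f differentiable (at (g x))"
  shows "fderiv (\<lambda>x. f (g x)) x v = fderiv f (g x) (fderiv g x v)"
  by (subst fderiv_eqI[OF has_derivative_compose[OF fderiv_works fderiv_works]]) (use assms in auto)

definition pos_def :: "('x::real_vector \<Rightarrow> 'x \<Rightarrow> real) \<Rightarrow> bool" where
  "pos_def b \<longleftrightarrow> bilinear b \<and> (\<forall>v. v \<noteq> 0 \<longrightarrow> b v v > 0)"

lemma linear_eq_on_Basis:
  fixes f g :: "'x::euclidean_space \<Rightarrow> 'b::real_vector"
  assumes "linear f" "linear g" "\<And>i. i \<in> Basis \<Longrightarrow> f i = g i"
  shows "f x = g x"
proof -
  have "f (\<Sum>i\<in>Basis. (x \<bullet> i) *\<^sub>R i) = g (\<Sum>i\<in>Basis. (x \<bullet> i) *\<^sub>R i)"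
    using assms by (simp add: linear_sum linear_scale)
  then show ?thesis by (simp add: euclidean_representation)
qed

lemma pos_def_ex1:
  fixes b :: "'x::euclidean_space \<Rightarrow> 'x \<Rightarrow> real"
  assumes "pos_def b"
  shows "\<exists>!c. \<forall>i\<in>Basis. b c i = r i"
proof -
  have bl: "bilinear b" using assms by (simp add: pos_def_def)
  have l: "linear (\<lambda>x. b x y)" for y using bl by (simp add: bilinear_def)
  define T where "T c = (\<Sum>i\<in>Basis. b c i *\<^sub>R i)" for c
  have Ti: "T c \<bullet> i = b c i" if "i \<in> Basis" for c i
    using that by (simp add: T_def)
  have lT: "linear T"
    by (rule linearI)
      (simp_all add: T_def linear_add[OF l] linear_scale[OF l] scaleR_add_left sum.distrib scaleR_sum_right)
  have "inj T"
  proof (rule linear_injective_0[OF lT, THEN iffD2], intro allI impI)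
    fix c assume "T c = 0"
    then have "b c i = 0" if "i \<in> Basis" for i using Ti[OF that, of c] by simp
    then have "b c c = 0"
      using linear_eq_on_Basis[of "b c" "\<lambda>_. 0" c] bl by (auto simp: bilinear_def intro: linear_zero)
    then show "c = 0" using assms unfolding pos_def_def by (metis less_irrefl)
  qed
  then have "bij T" using lT linear_injective_imp_surjective by (auto simp: bij_def)
  then have "\<exists>!c. T c = (\<Sum>i\<in>Basis. r i *\<^sub>R i)" by (simp add: bij_iff)
  moreover have "(\<forall>i\<in>Basis. b c i = r i) \<longleftrightarrow> T c = (\<Sum>i\<in>Basis. r i *\<^sub>R i)" for c
    by (subst euclidean_eq_iff) (auto simp: Ti)
  ultimately show ?thesis by simp
qed

lemma pos_def_linear:
  assumes "pos_def b" shows "linear (b x)" "linear (\<lambda>x. b x y)"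
  using assms by (auto simp: pos_def_def bilinear_def)

lemma pos_def_riesz:
  fixes b :: "'x::euclidean_space \<Rightarrow> 'x \<Rightarrow> real"
  assumes "pos_def b" "linear l"
  shows "\<exists>!c. \<forall>z. b c z = l z"
proof -
  have "(\<forall>z. b c z = l z) \<longleftrightarrow> (\<forall>i\<in>Basis. b c i = l i)" for c
    using linear_eq_on_Basis[of "b c" l] pos_def_linear(1)[OF assms(1)] assms(2) by auto
  then show ?thesis using pos_def_ex1[OF assms(1), of l] by simp
qed

lemma pos_def_eqI:
  fixes b :: "'x::euclidean_space \<Rightarrow> 'x \<Rightarrow> real"
  assumes "pos_def b" "\<And>z. b x z = b y z"
  shows "x = y"
  using pos_def_riesz[OF assms(1) pos_def_linear(1)[OF assms(1), of y]] assms(2) by auto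

lemma pos_def_bound:
  fixes b :: "'x::euclidean_space \<Rightarrow> 'x \<Rightarrow> real"
  assumes "bilinear b" "m > 0" "m * (norm w)\<^sup>2 \<le> b w w"
  shows "norm w \<le> (\<Sum>i\<in>Basis. \<bar>b w i\<bar>) / m"
proof (cases "w = 0")
  case False
  have l: "linear (b w)" using assms by (simp add: bilinear_def)
  have "b w w = b w (\<Sum>i\<in>Basis. (w \<bullet> i) *\<^sub>R i)" by (simp add: euclidean_representation)
  also have "\<dots> = (\<Sum>i\<in>Basis. (w \<bullet> i) * b w i)" by (simp add: linear_sum[OF l] linear_scale[OF l])
  also have "\<dots> \<le> (\<Sum>i\<in>Basis. norm w * \<bar>b w i\<bar>)"
  proof (rule sum_mono)
    fix i :: 'x assume "i \<in> Basis"
    have "(w \<bullet> i) * b w i \<le> \<bar>w \<bullet> i\<bar> * \<bar>b w i\<bar>" by (metis abs_ge_self abs_mult)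
    also have "\<dots> \<le> norm w * \<bar>b w i\<bar>" by (intro mult_right_mono Basis_le_norm) (use \<open>i \<in> Basis\<close> in auto)
    finally show "(w \<bullet> i) * b w i \<le> norm w * \<bar>b w i\<bar>" .
  qed
  finally have "m * (norm w)\<^sup>2 \<le> norm w * (\<Sum>i\<in>Basis. \<bar>b w i\<bar>)" using assms by (simp add: sum_distrib_left)
  then have "norm w * (norm w * m) \<le> norm w * (\<Sum>i\<in>Basis. \<bar>b w i\<bar>)"
    by (simp add: power2_eq_square mult.commute mult.left_commute)
  then have "norm w * m \<le> (\<Sum>i\<in>Basis. \<bar>b w i\<bar>)" using False by simp
  then show ?thesis using assms by (simp add: pos_le_divide_eq)
qed (use assms in \<open>simp add: sum_nonneg\<close>)

text \<open>The quadratic forms attain a positive minimum on the unit sphere, uniformly for base points in a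
  compact ball.\<close>

lemma pos_def_locally_coercive:
  fixes g :: "'e::euclidean_space \<Rightarrow> 'x::euclidean_space \<Rightarrow> 'x \<Rightarrow> real"
  assumes "open U" "\<And>q. q \<in> U \<Longrightarrow> pos_def (g q)" "\<And>x y. continuous_on U (\<lambda>q. g q x y)" "p \<in> U"
  obtains r m where "r > 0" "m > 0" "ball p r \<subseteq> U" "\<And>q w. q \<in> ball p r \<Longrightarrow> m * (norm w)\<^sup>2 \<le> g q w w"
proof -
  obtain r where r: "r > 0" "cball p r \<subseteq> U" using assms open_contains_cball by blast
  let ?K = "cball p r \<times> sphere (0::'x) 1"
  have bl: "bilinear (g q)" if "q \<in> U" for q using assms(2)[OF that] by (simp add: pos_def_def)
  have "continuous_on ?K (\<lambda>z. \<Sum>i\<in>Basis. \<Sum>j\<in>Basis. ((snd z \<bullet> i) * (snd z \<bullet> j)) *\<^sub>R g (fst z) i j)"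
    by (intro continuous_intros continuous_on_compose2[OF assms(3)]) (use r in auto)
  moreover have "(\<Sum>i\<in>Basis. \<Sum>j\<in>Basis. ((snd z \<bullet> i) * (snd z \<bullet> j)) *\<^sub>R g (fst z) i j) = g (fst z) (snd z) (snd z)"
    if "z \<in> ?K" for z
    by (rule bilinear_expand[symmetric], rule bl) (use r that in auto)
  ultimately have "continuous_on ?K (\<lambda>z. g (fst z) (snd z) (snd z))"
    by (simp cong: continuous_on_cong)
  moreover have "compact ?K" by (intro compact_Times compact_cball compact_sphere)
  moreover have "?K \<noteq> {}"
  proof -
    obtain i :: 'x where "i \<in> Basis" using nonempty_Basis by blast
    then have "(p, i) \<in> ?K" using r(1) by simp
    then show ?thesis by blast
  qed
  ultimately obtain z where z: "z \<in> ?K"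
    "\<And>y. y \<in> ?K \<Longrightarrow> g (fst z) (snd z) (snd z) \<le> g (fst y) (snd y) (snd y)"
    using continuous_attains_inf[of ?K "\<lambda>z. g (fst z) (snd z) (snd z)"] by blast
  define m where "m = g (fst z) (snd z) (snd z)"
  have "fst z \<in> U" "snd z \<noteq> 0" using z(1) r by auto
  then have "m > 0" unfolding m_def using assms(2) by (auto simp: pos_def_def)
  moreover have "m * (norm w)\<^sup>2 \<le> g q w w" if "q \<in> ball p r" for q w
  proof (cases "w = 0")
    case True
    moreover have "q \<in> U" using that r by auto
    ultimately show ?thesis by (simp add: bilinear_lzero[OF bl])
  next
    case False
    have "m \<le> g q (w /\<^sub>R norm w) (w /\<^sub>R norm w)"
      using z(2)[of "(q, w /\<^sub>R norm w)"] that False unfolding m_def by auto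
    also have "\<dots> = g q w w / (norm w)\<^sup>2"
    proof -
      have "q \<in> U" using that r by auto
      then show ?thesis
        by (simp add: bilinear_lmul[OF bl] bilinear_rmul[OF bl] power2_eq_square field_simps)
    qed
    finally show ?thesis using False by (simp add: pos_le_divide_eq)
  qed
  ultimately show thesis using r that[of r m] by (meson ball_subset_cball order_trans)
qed

lemma pos_def_solution_continuous:
  fixes g :: "'e::euclidean_space \<Rightarrow> 'x::euclidean_space \<Rightarrow> 'x \<Rightarrow> real"
  assumes U: "open U" and g: "\<And>q. q \<in> U \<Longrightarrow> pos_def (g q)" "\<And>x y. continuous_on U (\<lambda>q. g q x y)"
    and l: "\<And>i. i \<in> Basis \<Longrightarrow> continuous_on U (\<lambda>q. l q i)"
    and c: "\<And>q i. q \<in> U \<Longrightarrow> i \<in> Basis \<Longrightarrow> g q (c q) i = l q i"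
  shows "continuous_on U c"
proof (rule continuous_at_imp_continuous_on, rule ballI)
  fix p assume p: "p \<in> U"
  obtain r m where rm: "r > 0" "m > 0" "ball p r \<subseteq> U" "\<And>q w. q \<in> ball p r \<Longrightarrow> m * (norm w)\<^sup>2 \<le> g q w w"
    using pos_def_locally_coercive[OF U g p] by blast
  let ?R = "\<lambda>q. (\<Sum>i\<in>Basis. \<bar>l q i - g q (c p) i\<bar>) / m"
  have "continuous_on U ?R" by (intro continuous_intros g l) (use rm in auto)
  then have "isCont ?R p" using U p by (simp add: continuous_on_eq_continuous_at)
  moreover have "?R p = 0" using c[OF p] by simp
  ultimately have lim: "(?R \<longlongrightarrow> 0) (at p)" by (simp add: isCont_def)
  have "norm (c q - c p) \<le> ?R q" if "q \<in> ball p r" for q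
  proof -
    have q: "q \<in> U" using that rm by auto
    have "g q (c q - c p) i = l q i - g q (c p) i" if "i \<in> Basis" for i
      using c[OF q that] linear_diff[OF pos_def_linear(2)[OF g(1)[OF q]]] by simp
    then show ?thesis
      using pos_def_bound[where b="g q" and w="c q - c p", OF _ rm(2) rm(4)[OF that]] g(1)[OF q]
      by (simp add: pos_def_def)
  qed
  moreover have "eventually (\<lambda>q. q \<in> ball p r) (at p)"
    using rm by (intro eventually_at_in_open') auto
  ultimately have "eventually (\<lambda>q. norm (c q - c p) \<le> ?R q) (at p)"
    by (auto elim: eventually_mono)
  then have "((\<lambda>q. c q - c p) \<longlongrightarrow> 0) (at p)" by (rule Lim_null_comparison[OF _ lim])
  then show "isCont c p" by (simp add: isCont_def LIM_zero_iff)
qed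

text \<open>Differentiating \<open>g(c, \<cdot>) = l\<close> leaves only one candidate for the derivative of \<open>c\<close>. The error of the
  linear approximation solves a system whose right-hand side \<open>R\<close> is \<open>o(\<bar>q - p\<bar>)\<close>, and coercivity
  bounds the error by \<open>R\<close>.\<close>

lemma pos_def_solution_derivative:
  fixes g :: "'e::euclidean_space \<Rightarrow> 'x::euclidean_space \<Rightarrow> 'x \<Rightarrow> real"
  assumes U: "open U" and g: "\<And>q. q \<in> U \<Longrightarrow> pos_def (g q)" "\<And>x y. smooth_on U (\<lambda>q. g q x y)"
    and l: "\<And>i q. i \<in> Basis \<Longrightarrow> q \<in> U \<Longrightarrow> (\<lambda>q. l q i) differentiable (at q)"
    and c: "\<And>q i. q \<in> U \<Longrightarrow> i \<in> Basis \<Longrightarrow> g q (c q) i = l q i"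
    and p: "p \<in> U"
  shows "c differentiable (at p)"
    and "i \<in> Basis \<Longrightarrow> g p (fderiv c p v) i = fderiv (\<lambda>q. l q i) p v - fderiv (\<lambda>q. g q (c p) i) p v"
proof -
  have cont: "continuous_on U (\<lambda>q. g q x y)" for x y using g smooth_on_continuous by blast
  have bl: "bilinear (g q)" if "q \<in> U" for q using g(1)[OF that] by (simp add: pos_def_def)
  obtain r m where rm: "r > 0" "m > 0" "ball p r \<subseteq> U" "\<And>q w. q \<in> ball p r \<Longrightarrow> m * (norm w)\<^sup>2 \<le> g q w w"
    using pos_def_locally_coercive[OF U g(1) cont p] by blast
  define \<rho> where "\<rho> h i = fderiv (\<lambda>q. l q i) p h - fderiv (\<lambda>q. g q (c p) i) p h" for h i
  define d where "d h = (THE x. \<forall>i\<in>Basis. g p x i = \<rho> h i)" for h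
  have d: "\<forall>i\<in>Basis. g p (d h) i = \<rho> h i" for h
    unfolding d_def by (rule theI'[OF pos_def_ex1[OF g(1)[OF p]]])
  have dg: "(\<lambda>q. g q x y) differentiable (at p)" for x y
    by (rule smooth_on_differentiable[OF g(2) p])
  have lin\<rho>: "linear (\<lambda>h. \<rho> h i)" if "i \<in> Basis" for i
    unfolding \<rho>_def using dg l[OF that p] by (intro linear_compose_sub linear_frechet_derivative)
  have eqI: "x = y" if "\<And>i. i \<in> Basis \<Longrightarrow> g p x i = g p y i" for x y
    using pos_def_ex1[OF g(1)[OF p], of "g p y"] that by blast
  have "linear d"
  proof (rule linearI)
    fix x y :: 'e and a :: real
    show "d (x + y) = d x + d y"
      by (rule eqI) (simp add: d linear_add[OF lin\<rho>] linear_add[OF pos_def_linear(2)[OF g(1)[OF p]]])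
    show "d (a *\<^sub>R x) = a *\<^sub>R d x"
      by (rule eqI) (simp add: d linear_scale[OF lin\<rho>] linear_scale[OF pos_def_linear(2)[OF g(1)[OF p]]])
  qed
  then have bd: "bounded_linear d" by (simp add: linear_conv_bounded_linear)
  define R where "R i q = l q i - g q (c p) i - g q (d (q - p)) i" for i q
  have R: "(R i has_derivative (\<lambda>h. 0)) (at p)" if i: "i \<in> Basis" for i
  proof -
    have dd: "((\<lambda>q. d (q - p)) has_derivative d) (at p)"
      by (rule bounded_linear.has_derivative[OF bd, of "\<lambda>q. q - p" "\<lambda>h. h", simplified])
        (auto intro!: derivative_eq_intros)
    have "((\<lambda>q. g q (d (q - p)) i) has_derivative (\<lambda>h. g p (d h) i)) (at p)"
    proof -
      have z: "fderiv (\<lambda>q. g q (d (p - p)) i) p h = 0" for h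
      proof -
        have "fderiv (\<lambda>q. g q (d (p - p)) i) p = fderiv (\<lambda>q. 0) p"
          by (rule fderiv_cong_open(1)[OF U p])
            (simp add: linear_0[OF \<open>linear d\<close>] bilinear_lzero[OF bl])
        then show ?thesis by simp
      qed
      show ?thesis
        using has_derivative_bilinear_field[OF U p bl dg dd has_derivative_const[of i]]
        by (simp only: z bilinear_rzero[OF bl[OF p]] add_0_left add_0_right)
    qed
    then have "(R i has_derivative (\<lambda>h. fderiv (\<lambda>q. l q i) p h - fderiv (\<lambda>q. g q (c p) i) p h - g p (d h) i)) (at p)"
      unfolding R_def by (intro has_derivative_diff fderiv_works l i p dg)
    then show ?thesis using d i by (simp add: \<rho>_def)
  qed
  have "(c has_derivative d) (at p)"
    unfolding has_derivative_at_alt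
  proof (intro conjI allI impI bd)
    fix e :: real assume e: "e > 0"
    define e' where "e' = e * m / real DIM('x)"
    have e': "e' > 0" using e rm by (simp add: e'_def)
    have "\<exists>\<delta>>0. \<forall>y. norm (y - p) < \<delta> \<longrightarrow> \<bar>R i y\<bar> \<le> e' * norm (y - p)" if "i \<in> Basis" for i
    proof -
      have "R i p = 0" using c[OF p that] linear_0[OF \<open>linear d\<close>] bilinear_lzero[OF bl[OF p]]
        by (simp add: R_def)
      then show ?thesis using R[OF that] e' unfolding has_derivative_at_alt by simp
    qed
    then obtain \<delta> where \<delta>: "\<And>i. i \<in> Basis \<Longrightarrow> \<delta> i > 0"
      "\<And>i y. i \<in> Basis \<Longrightarrow> norm (y - p) < \<delta> i \<Longrightarrow> \<bar>R i y\<bar> \<le> e' * norm (y - p)" by metis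
    define \<delta>' where "\<delta>' = min r (Min (\<delta> ` Basis))"
    have pos: "\<delta>' > 0" unfolding \<delta>'_def using rm \<delta>(1) by auto
    show "\<exists>\<delta>>0. \<forall>y. norm (y - p) < \<delta> \<longrightarrow> norm (c y - c p - d (y - p)) \<le> e * norm (y - p)"
    proof (intro exI[of _ \<delta>'] conjI allI impI pos)
      fix y assume y: "norm (y - p) < \<delta>'"
      then have yb: "y \<in> ball p r" by (simp add: \<delta>'_def dist_norm norm_minus_commute)
      then have yU: "y \<in> U" using rm by auto
      have yd: "norm (y - p) < \<delta> i" if "i \<in> Basis" for i
        using y that unfolding \<delta>'_def by (auto simp: Min_gr_iff)
      have "g y (c y - c p - d (y - p)) i = R i y" if "i \<in> Basis" for i
        using c[OF yU that] linear_diff[OF pos_def_linear(2)[OF g(1)[OF yU]]] by (simp add: R_def)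
      then have "norm (c y - c p - d (y - p)) \<le> (\<Sum>i\<in>Basis. \<bar>R i y\<bar>) / m"
        using pos_def_bound[where b="g y" and w="c y - c p - d (y - p)", OF bl[OF yU] rm(2) rm(4)[OF yb]] by simp
      also have "\<dots> \<le> (\<Sum>i\<in>(Basis::'x set). e' * norm (y - p)) / m"
        using rm \<delta>(2) yd by (intro divide_right_mono sum_mono) auto
      also have "\<dots> = e * norm (y - p)" using rm by (simp add: e'_def)
      finally show "norm (c y - c p - d (y - p)) \<le> e * norm (y - p)" .
    qed
  qed
  then show "c differentiable (at p)"
    "i \<in> Basis \<Longrightarrow> g p (fderiv c p v) i = fderiv (\<lambda>q. l q i) p v - fderiv (\<lambda>q. g q (c p) i) p v"
    using d by (auto simp: differentiable_def fderiv_eqI \<rho>_def)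
qed

text \<open>Each directional derivative of the solution \<open>c\<close> solves a system with the same left-hand side, whose
  right-hand side is as smooth as \<open>c\<close> is; so the order of smoothness can be raised step by step.\<close>

lemma pos_def_solution_smooth:
  fixes g :: "'e::euclidean_space \<Rightarrow> 'x::euclidean_space \<Rightarrow> 'x \<Rightarrow> real"
  assumes U: "open U" and g: "\<And>q. q \<in> U \<Longrightarrow> pos_def (g q)" "\<And>x y. smooth_on U (\<lambda>q. g q x y)"
    and l: "\<And>i. i \<in> Basis \<Longrightarrow> smooth_on U (\<lambda>q. l q i)"
    and c: "\<And>q i. q \<in> U \<Longrightarrow> i \<in> Basis \<Longrightarrow> g q (c q) i = l q i"
  shows "smooth_on U c"
proof -
  have Ck: "Ck_on k U c" if "\<And>i. i \<in> Basis \<Longrightarrow> Ck_on k U (\<lambda>q. l q i)"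
    "\<And>q i. q \<in> U \<Longrightarrow> i \<in> Basis \<Longrightarrow> g q (c q) i = l q i" for k l c
    using that
  proof (induction k arbitrary: l c)
    case 0
    then show ?case
      using pos_def_solution_continuous[OF U g(1) smooth_on_continuous[OF g(2)], of l c] by auto
  next
    case (Suc k)
    have ck: "Ck_on k U c" using Suc.IH[of l c] Suc.prems Ck_on_Suc_D by blast
    have dl: "\<And>i q. i \<in> Basis \<Longrightarrow> q \<in> U \<Longrightarrow> (\<lambda>q. l q i) differentiable (at q)"
      using Suc.prems(1) by auto
    note D = pos_def_solution_derivative[OF U g dl Suc.prems(2)]
    have "Ck_on k U (\<lambda>x. fderiv c x v)" for v
    proof (rule Suc.IH)
      fix q i assume "q \<in> U" "i \<in> (Basis::'x set)"
      then show "g q (fderiv c q v) i = fderiv (\<lambda>q. l q i) q v - fderiv (\<lambda>q'. g q' (c q) i) q v"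
        using D(2)[of q i v] by simp
    next
      fix i :: 'x assume i: "i \<in> Basis"
      have eq: "fderiv (\<lambda>q. l q i) p v - fderiv (\<lambda>q'. g q' (c p) i) p v =
         fderiv (\<lambda>q. l q i) p v + (- 1) *\<^sub>R (\<Sum>j\<in>Basis. (c p \<bullet> j) * fderiv (\<lambda>q. g q j i) p v)" if "p \<in> U" for p
      proof -
        have "fderiv (\<lambda>q. g q (c p) i) p = fderiv (\<lambda>q. \<Sum>j\<in>Basis. (c p \<bullet> j) * g q j i) p"
        proof (rule fderiv_cong_open(1)[OF U that])
          fix q assume "q \<in> U"
          note l = pos_def_linear(2)[OF g(1)[OF this], of i]
          have "g q (\<Sum>j\<in>Basis. (c p \<bullet> j) *\<^sub>R j) i = (\<Sum>j\<in>Basis. (c p \<bullet> j) * g q j i)"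
            by (simp add: linear_sum[OF l] linear_scale[OF l])
          then show "g q (c p) i = (\<Sum>j\<in>Basis. (c p \<bullet> j) * g q j i)" by (simp add: euclidean_representation)
        qed
        also have "fderiv (\<lambda>q. \<Sum>j\<in>Basis. (c p \<bullet> j) * g q j i) p = (\<lambda>v. \<Sum>j\<in>Basis. (c p \<bullet> j) * fderiv (\<lambda>q. g q j i) p v)"
          by (intro fderiv_eqI has_derivative_sum has_derivative_mult_right smooth_on_has_derivative[OF g(2) that])
        finally show ?thesis by simp
      qed
      show "Ck_on k U (\<lambda>p. fderiv (\<lambda>q. l q i) p v - fderiv (\<lambda>q'. g q' (c p) i) p v)"
        apply (subst Ck_on_cong[OF U eq], assumption)
        apply (intro Ck_on_add U Ck_on_compose_linear[OF U bounded_linear_scaleR_right] Ck_on_sum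
           Ck_on_bilinear[OF U bounded_bilinear_mult] Ck_on_compose_linear[OF U bounded_linear_inner_left] ck)
        using Suc.prems(1)[OF i] smooth_on_fderiv[OF g(2)] by (auto simp: smooth_on_def)
    qed
    then show ?case using D(1) by simp
  qed
  then show ?thesis using l c unfolding smooth_on_def by blast
qed

section \<open>A smooth bump function\<close>

text \<open>The powers of \<open>1/x\<close> make the family closed under differentiation.\<close>

definition flat :: "nat \<Rightarrow> real \<Rightarrow> real" where
  "flat n x = (if x > 0 then inverse x ^ n * exp (- inverse x) else 0)"

lemma flat_DERIV_0: "(flat n has_real_derivative 0) (at 0)"
proof -
  have "((\<lambda>y::real. y ^ Suc n / exp y) \<longlongrightarrow> 0) at_top" by (rule tendsto_power_div_exp_0)
  then have "((\<lambda>x. (inverse x) ^ Suc n / exp (inverse x)) \<longlongrightarrow> 0) (at_right (0::real))"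
    by (rule filterlim_compose[OF _ filterlim_inverse_at_top_right])
  moreover have "\<forall>\<^sub>F x::real in at_right 0. (inverse x) ^ Suc n / exp (inverse x) = flat n (0 + x) / x"
    by (rule eventually_at_right_less[THEN eventually_mono])
      (auto simp: flat_def exp_minus field_simps)
  ultimately have r: "((\<lambda>x. flat n (0 + x) / x) \<longlongrightarrow> 0) (at_right 0)"
    by (rule Lim_transform_eventually)
  have l: "((\<lambda>x. flat n (0 + x) / x) \<longlongrightarrow> 0) (at_left 0)"
    by (rule tendsto_eventually) (auto simp: eventually_at_filter flat_def)
  show ?thesis
    unfolding DERIV_def using filterlim_split_at[OF l r] by (simp add: flat_def)
qed

lemma flat_DERIV: "(flat n has_real_derivative flat (n + 2) x - real n * flat (n + 1) x) (at x)"
proof (cases x "0 :: real" rule: linorder_cases)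
  case less
  have "((\<lambda>_. 0) has_real_derivative 0) (at x)" by simp
  then show ?thesis
    using less
    by (subst DERIV_cong_ev[OF refl _ refl, of _ "\<lambda>_. 0"])
      (auto simp: flat_def eventually_nhds intro!: exI[of _ "{..<0}"])
next
  case equal
  then show ?thesis using flat_DERIV_0[of n] by (simp add: flat_def)
next
  case greater
  have "((\<lambda>x. inverse x ^ n * exp (- inverse x)) has_real_derivative flat (n + 2) x - real n * flat (n + 1) x) (at x)"
  proof -
    have "((\<lambda>x. inverse x) has_real_derivative - (inverse x)\<^sup>2) (at x)"
      using greater by (auto intro!: derivative_eq_intros simp: power2_eq_square)
    then have "((\<lambda>x. inverse x ^ n * exp (- inverse x)) has_real_derivative
       (real n * (- (inverse x)\<^sup>2 * inverse x ^ (n - 1))) * exp (- inverse x) +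
       (exp (- inverse x) * (inverse x)\<^sup>2) * inverse x ^ n) (at x)"
      using greater by (auto intro!: derivative_eq_intros simp: power2_eq_square)
    moreover have "real n * (- (inverse x)\<^sup>2 * inverse x ^ (n - 1)) * exp (- inverse x) +
       (exp (- inverse x) * (inverse x)\<^sup>2) * inverse x ^ n = flat (n + 2) x - real n * flat (n + 1) x"
      using greater by (cases n) (simp_all add: flat_def power2_eq_square algebra_simps)
    ultimately show ?thesis by simp
  qed
  then show ?thesis
    using greater
    by (subst DERIV_cong_ev[OF refl _ refl, of _ "\<lambda>x. inverse x ^ n * exp (- inverse x)"])
      (auto simp: flat_def eventually_nhds intro!: exI[of _ "{0<..}"])
qed

lemma flat_smooth: "smooth_on UNIV (flat n)"
  unfolding smooth_on_def
proof
  fix k show "Ck_on k UNIV (flat n)"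
  proof (induction k arbitrary: n)
    case 0
    show ?case using flat_DERIV
      by (auto intro!: continuous_at_imp_continuous_on DERIV_isCont)
  next
    case (Suc k)
    have D: "(flat n has_derivative (\<lambda>v. v * (flat (n + 2) x - real n * flat (n + 1) x))) (at x)" for x
      using flat_DERIV[of n x] unfolding has_field_derivative_def
      by (rule has_derivative_eq_rhs) (simp add: fun_eq_iff mult.commute)
    have "Ck_on k UNIV (\<lambda>x. v * (flat (n + 2) x + - (real n * flat (n + 1) x)))" for v
      by (intro Ck_on_compose_linear[OF open_UNIV bounded_linear_mult_right] Ck_on_add open_UNIV Suc.IH
         Ck_on_compose_linear[OF open_UNIV bounded_linear_minus[OF bounded_linear_ident]])
    then show ?case using D fderiv_eqI[OF D] by (auto simp: differentiable_def)
  qed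
qed

lemma smooth_bump:
  fixes p :: "'a::euclidean_space"
  assumes "r > 0"
  obtains \<psi> :: "'a \<Rightarrow> real" where "smooth_on UNIV \<psi>" "\<And>x. \<psi> x \<ge> 0" "\<psi> p > 0" "\<And>x. x \<notin> ball p r \<Longrightarrow> \<psi> x = 0"
proof
  let ?\<psi> = "\<lambda>x. flat 0 (r\<^sup>2 - (x - p) \<bullet> (x - p))"
  show "smooth_on UNIV ?\<psi>"
    by (rule smooth_on_compose[OF open_UNIV open_UNIV _ flat_smooth]) (auto intro!: smooth_intros)
  show "?\<psi> x \<ge> 0" for x by (simp add: flat_def)
  show "?\<psi> p > 0" using assms by (simp add: flat_def)
  show "?\<psi> x = 0" if "x \<notin> ball p r" for x
  proof -
    have "r \<le> norm (x - p)" using that by (simp add: dist_norm norm_minus_commute)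
    then have "r\<^sup>2 \<le> (norm (x - p))\<^sup>2" using assms by (intro power_mono) auto
    then show ?thesis by (simp add: flat_def power2_norm_eq_inner)
  qed
qed

section \<open>The Levi-Civita connection and its curvature\<close>

lemma bilinear_fderiv_field:
  fixes B :: "'e::euclidean_space \<Rightarrow> 'x::euclidean_space \<Rightarrow> 'y::euclidean_space \<Rightarrow> 'c::real_normed_vector"
  assumes U: "open U" "p \<in> U" and B: "\<And>q. q \<in> U \<Longrightarrow> bilinear (B q)" "\<And>x y. smooth_on U (\<lambda>q. B q x y)"
  shows "bilinear (\<lambda>x y. fderiv (\<lambda>q. B q x y) p v)"
proof -
  have d: "((\<lambda>q. B q x y) has_derivative fderiv (\<lambda>q. B q x y) p) (at p)" for x y
    by (rule smooth_on_has_derivative[OF B(2) U(2)])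
  have eq: "fderiv (\<lambda>q. B q x y) p = f'"
    if "((\<lambda>q. f q) has_derivative f') (at p)" "\<And>q. q \<in> U \<Longrightarrow> B q x y = f q" for x y f f'
    using fderiv_cong_open(1)[OF U, of "\<lambda>q. B q x y" f] fderiv_eqI[OF that(1)] that(2) by simp
  show ?thesis
    unfolding bilinear_def
  proof (intro allI conjI linearI)
    fix x x' y y' and r :: real
    show "fderiv (\<lambda>q. B q x (y + y')) p v = fderiv (\<lambda>q. B q x y) p v + fderiv (\<lambda>q. B q x y') p v"
      by (subst eq[OF has_derivative_add[OF d d]]) (auto simp: bilinear_radd[OF B(1)])
    show "fderiv (\<lambda>q. B q (x + x') y) p v = fderiv (\<lambda>q. B q x y) p v + fderiv (\<lambda>q. B q x' y) p v"
      by (subst eq[OF has_derivative_add[OF d d]]) (auto simp: bilinear_ladd[OF B(1)])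
    show "fderiv (\<lambda>q. B q x (r *\<^sub>R y)) p v = r *\<^sub>R fderiv (\<lambda>q. B q x y) p v"
      by (subst eq[OF has_derivative_scaleR_right[OF d]]) (auto simp: bilinear_rmul[OF B(1)])
    show "fderiv (\<lambda>q. B q (r *\<^sub>R x) y) p v = r *\<^sub>R fderiv (\<lambda>q. B q x y) p v"
      by (subst eq[OF has_derivative_scaleR_right[OF d]]) (auto simp: bilinear_lmul[OF B(1)])
  qed
qed

locale riemannian_chart =
  fixes \<Omega> :: "'e::euclidean_space set" and g :: "'e metric"
  assumes open_dom: "open \<Omega>" and metric: "riemannian_metric_on \<Omega> g"
begin

abbreviation "\<Gamma> \<equiv> christoffel g"

lemma g_bilinear: "p \<in> \<Omega> \<Longrightarrow> bilinear (g p)"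
  and g_sym: "p \<in> \<Omega> \<Longrightarrow> g p v w = g p w v"
  and g_smooth: "smooth_on \<Omega> (\<lambda>p. g p v w)"
  using metric unfolding riemannian_metric_on_def by blast+

lemma g_pos_def: "p \<in> \<Omega> \<Longrightarrow> pos_def (g p)"
  using metric unfolding riemannian_metric_on_def pos_def_def by blast

lemmas g_lin = bilinear_ladd[OF g_bilinear] bilinear_radd[OF g_bilinear] bilinear_lsub[OF g_bilinear]
  bilinear_rsub[OF g_bilinear] bilinear_lmul[OF g_bilinear] bilinear_rmul[OF g_bilinear]
  bilinear_lneg[OF g_bilinear] bilinear_rneg[OF g_bilinear] bilinear_lzero[OF g_bilinear] bilinear_rzero[OF g_bilinear]

lemma dg_bilinear: "p \<in> \<Omega> \<Longrightarrow> bilinear (\<lambda>x y. fderiv (\<lambda>q. g q x y) p v)"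
  by (rule bilinear_fderiv_field[OF open_dom _ g_bilinear g_smooth])

lemma dg_linear: "p \<in> \<Omega> \<Longrightarrow> linear (fderiv (\<lambda>q. g q x y) p)"
  by (rule smooth_on_linear_fderiv[OF g_smooth])

lemmas dg_lin = bilinear_ladd[OF dg_bilinear] bilinear_radd[OF dg_bilinear]
  bilinear_lmul[OF dg_bilinear] bilinear_rmul[OF dg_bilinear] linear_add[OF dg_linear] linear_scale[OF dg_linear]

lemma dg_sym: "p \<in> \<Omega> \<Longrightarrow> fderiv (\<lambda>q. g q x y) p = fderiv (\<lambda>q. g q y x) p"
  by (rule fderiv_cong_open(1)[OF open_dom]) (auto simp: g_sym)

text \<open>Half of the right-hand side of the Koszul formula for constant fields, as a form in \<open>z\<close>.\<close>

definition koszul :: "'e \<Rightarrow> 'e \<Rightarrow> 'e \<Rightarrow> 'e \<Rightarrow> real" where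
  "koszul p v w z = (fderiv (\<lambda>q. g q w z) p v + fderiv (\<lambda>q. g q v z) p w - fderiv (\<lambda>q. g q v w) p z) / 2"

lemma koszul_linear: "p \<in> \<Omega> \<Longrightarrow> linear (koszul p v w)"
  by (rule linearI; simp add: koszul_def dg_lin field_simps)

lemma koszul_iff: "(2 * g p c z = fderiv (\<lambda>q. g q w z) p v + fderiv (\<lambda>q. g q v z) p w - fderiv (\<lambda>q. g q v w) p z)
   \<longleftrightarrow> g p c z = koszul p v w z"
  by (auto simp: koszul_def)

lemma christoffel_koszul: "p \<in> \<Omega> \<Longrightarrow> g p (\<Gamma> p v w) z = koszul p v w z"
  unfolding christoffel_def koszul_iff
  using theI'[OF pos_def_riesz[OF g_pos_def koszul_linear]] by blast

lemma christoffel_eqI: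
  assumes "p \<in> \<Omega>" "\<And>z. g p c z = koszul p v w z"
  shows "\<Gamma> p v w = c"
  by (rule pos_def_eqI[OF g_pos_def[OF assms(1)]]) (simp add: assms christoffel_koszul)

lemma christoffel_sym: "p \<in> \<Omega> \<Longrightarrow> \<Gamma> p v w = \<Gamma> p w v"
  by (rule christoffel_eqI) (auto simp: christoffel_koszul koszul_def dg_sym)

lemma christoffel_bilinear: "p \<in> \<Omega> \<Longrightarrow> bilinear (\<Gamma> p)"
proof -
  assume p: "p \<in> \<Omega>"
  have k: "koszul p (v + v') w z = koszul p v w z + koszul p v' w z"
    "koszul p (r *\<^sub>R v) w z = r * koszul p v w z" for v v' w z r
    by (simp_all add: koszul_def dg_lin[OF p] field_simps)
  have 1: "linear (\<lambda>v. \<Gamma> p v w)" for w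
  proof (rule linearI)
    fix v v' and r :: real
    show "\<Gamma> p (v + v') w = \<Gamma> p v w + \<Gamma> p v' w"
      by (rule christoffel_eqI[OF p]) (simp only: g_lin[OF p] christoffel_koszul[OF p] k)
    show "\<Gamma> p (r *\<^sub>R v) w = r *\<^sub>R \<Gamma> p v w"
      by (rule christoffel_eqI[OF p]) (simp only: g_lin[OF p] christoffel_koszul[OF p] k real_scaleR_def)
  qed
  have "linear (\<Gamma> p v)" for v
  proof -
    have "\<Gamma> p v = (\<lambda>w. \<Gamma> p w v)" by (rule ext) (rule christoffel_sym[OF p])
    then show ?thesis by (rule ssubst) (rule 1)
  qed
  with 1 show ?thesis by (simp add: bilinear_def)
qed

lemmas \<Gamma>_lin = bilinear_ladd[OF christoffel_bilinear] bilinear_radd[OF christoffel_bilinear] bilinear_lsub[OF christoffel_bilinear]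
  bilinear_rsub[OF christoffel_bilinear] bilinear_lmul[OF christoffel_bilinear] bilinear_rmul[OF christoffel_bilinear]
  bilinear_lneg[OF christoffel_bilinear] bilinear_rneg[OF christoffel_bilinear] bilinear_lzero[OF christoffel_bilinear]
  bilinear_rzero[OF christoffel_bilinear]

lemma christoffel_metric:
  "p \<in> \<Omega> \<Longrightarrow> fderiv (\<lambda>q. g q v w) p z = g p (\<Gamma> p z v) w + g p v (\<Gamma> p z w)"
  using christoffel_koszul[of p z v w] christoffel_koszul[of p z w v] g_sym[of p v "\<Gamma> p z w"]
    dg_sym[of p w v] dg_sym[of p z v] dg_sym[of p z w]
  by (simp add: koszul_def)

lemma christoffel_smooth: "smooth_on \<Omega> (\<lambda>p. \<Gamma> p v w)"
proof (rule pos_def_solution_smooth[OF open_dom g_pos_def g_smooth])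
  show "g q (\<Gamma> q v w) i = koszul q v w i" if "q \<in> \<Omega>" for q i by (rule christoffel_koszul[OF that])
  show "smooth_on \<Omega> (\<lambda>q. koszul q v w i)" for i
    unfolding koszul_def by (intro smooth_intros open_dom g_smooth) auto
qed

lemma curvature_eq:
  assumes p: "p \<in> \<Omega>"
  shows "curvature g p u v w = fderiv (\<lambda>q. \<Gamma> q v w) p u + \<Gamma> p u (\<Gamma> p v w)
     - (fderiv (\<lambda>q. \<Gamma> q u w) p v + \<Gamma> p v (\<Gamma> p u w))"
proof -
  have "levi_civita g (\<lambda>_. v) (\<lambda>_. w) = (\<lambda>q. \<Gamma> q v w)" for v w
    by (rule ext) (simp add: levi_civita_def)
  then show ?thesis by (simp add: curvature_def levi_civita_def)
qed

lemma d\<Gamma>_bilinear: "p \<in> \<Omega> \<Longrightarrow> bilinear (\<lambda>x y. fderiv (\<lambda>q. \<Gamma> q x y) p v)"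
  by (rule bilinear_fderiv_field[OF open_dom _ christoffel_bilinear christoffel_smooth])

lemma d\<Gamma>_linear: "p \<in> \<Omega> \<Longrightarrow> linear (fderiv (\<lambda>q. \<Gamma> q x y) p)"
  by (rule smooth_on_linear_fderiv[OF christoffel_smooth])

lemmas d\<Gamma>_lin = bilinear_ladd[OF d\<Gamma>_bilinear] bilinear_radd[OF d\<Gamma>_bilinear]
  bilinear_lmul[OF d\<Gamma>_bilinear] bilinear_rmul[OF d\<Gamma>_bilinear] linear_add[OF d\<Gamma>_linear] linear_scale[OF d\<Gamma>_linear]

lemma curvature_linear:
  assumes p: "p \<in> \<Omega>"
  shows "linear (\<lambda>u. curvature g p u v w)" "linear (\<lambda>v. curvature g p u v w)" "linear (curvature g p u v)"
  by (rule linearI; simp add: curvature_eq p d\<Gamma>_lin \<Gamma>_lin algebra_simps)+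

lemma curvature_antisym: "p \<in> \<Omega> \<Longrightarrow> curvature g p u v w = - curvature g p v u w"
  by (simp add: curvature_eq)

lemma d\<Gamma>_sym: "p \<in> \<Omega> \<Longrightarrow> fderiv (\<lambda>q. \<Gamma> q x y) p = fderiv (\<lambda>q. \<Gamma> q y x) p"
  by (rule fderiv_cong_open(1)[OF open_dom]) (auto simp: christoffel_sym)

lemma curvature_bianchi:
  assumes "p \<in> \<Omega>"
  shows "curvature g p u v w + curvature g p v w u + curvature g p w u v = 0"
  using assms d\<Gamma>_sym[of p u v] d\<Gamma>_sym[of p u w] d\<Gamma>_sym[of p v w]
    christoffel_sym[of p u v] christoffel_sym[of p u w] christoffel_sym[of p v w]
  by (simp add: curvature_eq)

text \<open>Both second derivatives of \<open>\<langle>w, z\<rangle>\<close> along constant fields are computed from metric compatibility; that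
  they agree is the claim.\<close>

lemma curvature_skew:
  assumes p: "p \<in> \<Omega>"
  shows "g p (curvature g p u v w) z = - g p (curvature g p u v z) w"
proof -
  have DD: "fderiv (\<lambda>q. fderiv (\<lambda>q. g q w z) q v) p u =
      g p (\<Gamma> p u (\<Gamma> p v w) + fderiv (\<lambda>q. \<Gamma> q v w) p u) z + g p (\<Gamma> p v w) (\<Gamma> p u z)
      + g p (\<Gamma> p u w) (\<Gamma> p v z) + g p w (\<Gamma> p u (\<Gamma> p v z) + fderiv (\<lambda>q. \<Gamma> q v z) p u)" for u v
  proof -
    have s: "smooth_on \<Omega> (\<lambda>q. g q (\<Gamma> q v w) z)" "smooth_on \<Omega> (\<lambda>q. g q w (\<Gamma> q v z))"
      by (rule smooth_on_bilinear_field[where B=g, OF open_dom g_bilinear g_smooth christoffel_smooth smooth_on_const]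
          smooth_on_bilinear_field[where B=g, OF open_dom g_bilinear g_smooth smooth_on_const christoffel_smooth]; assumption)+
    have "fderiv (\<lambda>q. fderiv (\<lambda>q. g q w z) q v) p u =
      fderiv (\<lambda>q. g q (\<Gamma> q v w) z + g q w (\<Gamma> q v z)) p u"
      using fderiv_cong_open(1)[OF open_dom p, of "\<lambda>q. fderiv (\<lambda>q. g q w z) q v"] christoffel_metric by simp
    also have "\<dots> = fderiv (\<lambda>q. g q (\<Gamma> q v w) z) p u + fderiv (\<lambda>q. g q w (\<Gamma> q v z)) p u"
      by (subst fderiv_eqI[OF has_derivative_add[OF smooth_on_has_derivative[OF s(1) p] smooth_on_has_derivative[OF s(2) p]]]) simp
    also have "\<dots> = g p (\<Gamma> p u (\<Gamma> p v w) + fderiv (\<lambda>q. \<Gamma> q v w) p u) z + g p (\<Gamma> p v w) (\<Gamma> p u z)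
      + g p (\<Gamma> p u w) (\<Gamma> p v z) + g p w (\<Gamma> p u (\<Gamma> p v z) + fderiv (\<lambda>q. \<Gamma> q v z) p u)"
      using fderiv_bilinear_field[OF open_dom p g_bilinear g_smooth christoffel_smooth[of v w] smooth_on_const[of _ z], of u]
        fderiv_bilinear_field[OF open_dom p g_bilinear g_smooth smooth_on_const[of _ w] christoffel_smooth[of v z], of u]
      by (simp add: christoffel_metric[OF p] g_lin[OF p])
    finally show ?thesis .
  qed
  have "fderiv (\<lambda>q. fderiv (\<lambda>q. g q w z) q v) p u = fderiv (\<lambda>q. fderiv (\<lambda>q. g q w z) q u) p v"
    by (rule second_fderiv_symmetric[OF open_dom p g_smooth])
  then have "g p (curvature g p u v w) z + g p w (curvature g p u v z) = 0"
    unfolding DD by (simp add: curvature_eq p g_lin)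
  then show ?thesis using g_sym[OF p, of w "curvature g p u v z"] by simp
qed

end

section \<open>Curvature tensors of Kaehler type\<close>

text \<open>A Kaehler curvature tensor is determined by its holomorphic sectional curvature. By linearity it
  is enough to treat a tensor \<open>S\<close> for which the latter vanishes.\<close>

locale kaehler_tensor =
  fixes J :: "'v::real_vector \<Rightarrow> 'v" and S :: "'v \<Rightarrow> 'v \<Rightarrow> 'v \<Rightarrow> 'v \<Rightarrow> real"
  assumes J: "J (J x) = - x" "linear J"
    and lin: "linear (\<lambda>x. S x y z w)" "linear (\<lambda>y. S x y z w)" "linear (\<lambda>z. S x y z w)" "linear (\<lambda>w. S x y z w)"
    and anti12: "S x y z w = - S y x z w"
    and anti34: "S x y z w = - S x y w z"
    and bianchi: "S x y z w + S y z x w + S z x y w = 0"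
    and J34: "S x y (J z) (J w) = S x y z w"
    and hol: "S x (J x) (J x) x = 0"
begin

lemma pair_sym: "S x y z w = S z w x y"
  using bianchi[of x y z w] bianchi[of y z w x] bianchi[of z w x y] bianchi[of w x y z]
    anti34[of y z w x] anti34[of z w y x] anti12[of x z w y] anti34[of z x w y]
    anti34[of w x z y] anti34[of x y w z] anti12[of y w x z] anti34[of w y x z]
  by linarith

lemma J12: "S (J x) (J y) z w = S x y z w"
  using pair_sym J34 by metis

text \<open>On the diagonal \<open>T\<close> is the holomorphic sectional curvature. It is symmetric in each of the pairs
  \<open>(x, y)\<close> and \<open>(z, w)\<close> and under their exchange, so that polarization applies to it.\<close>

definition T where "T x y z w = S x (J y) (J z) w"

lemma T_lin: "linear (\<lambda>x. T x y z w)" "linear (\<lambda>y. T x y z w)" "linear (\<lambda>z. T x y z w)" "linear (\<lambda>w. T x y z w)"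
  unfolding T_def using lin J(2)
  by (auto intro: linear_compose[OF J(2), of "\<lambda>y. S x y (J z) w", unfolded o_def]
      linear_compose[OF J(2), of "\<lambda>z. S x (J y) z w", unfolded o_def])

lemma S_neg: "S (- x) y z w = - S x y z w" "S x (- y) z w = - S x y z w"
  "S x y (- z) w = - S x y z w" "S x y z (- w) = - S x y z w"
  using linear_neg[OF lin(1)] linear_neg[OF lin(2)] linear_neg[OF lin(3)] linear_neg[OF lin(4)] by auto

lemma T_sym12: "T x y z w = T y x z w"
proof -
  have "S x (J y) (J z) w = S (J x) (J (J y)) (J z) w" by (simp only: J12)
  also have "\<dots> = S y (J x) (J z) w" using anti12[of "J x" y "J z" w] by (simp add: J S_neg)
  finally show ?thesis by (simp add: T_def)
qed

lemma T_sym34: "T x y z w = T x y w z"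
proof -
  have "S x (J y) (J z) w = S x (J y) (J (J z)) (J w)" by (simp only: J34)
  also have "\<dots> = S x (J y) (J w) z" using anti34[of x "J y" z "J w"] by (simp add: J S_neg)
  finally show ?thesis by (simp add: T_def)
qed

lemma T_pair: "T x y z w = T z w x y"
proof -
  have "T x y z w = T w z y x"
    unfolding T_def using pair_sym[of x "J y" "J z" w] anti12[of "J z" w x "J y"] anti34[of w "J z" x "J y"] by simp
  then show ?thesis using T_sym12 T_sym34 by metis
qed

lemma T_simps: "T (x + x') y z w = T x y z w + T x' y z w" "T x (y + y') z w = T x y z w + T x y' z w"
  "T x y (z + z') w = T x y z w + T x y z' w" "T x y z (w + w') = T x y z w + T x y z w'"
  "T (- x) y z w = - T x y z w" "T x (- y) z w = - T x y z w" "T x y (- z) w = - T x y z w" "T x y z (- w) = - T x y z w"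
  "T (x - x') y z w = T x y z w - T x' y z w" "T x (y - y') z w = T x y z w - T x y' z w"
  "T x y (z - z') w = T x y z w - T x y z' w" "T x y z (w - w') = T x y z w - T x y z w'"
  by (simp_all add: linear_add[OF T_lin(1)] linear_add[OF T_lin(2)] linear_add[OF T_lin(3)] linear_add[OF T_lin(4)]
     linear_neg[OF T_lin(1)] linear_neg[OF T_lin(2)] linear_neg[OF T_lin(3)] linear_neg[OF T_lin(4)]
     linear_diff[OF T_lin(1)] linear_diff[OF T_lin(2)] linear_diff[OF T_lin(3)] linear_diff[OF T_lin(4)])

text \<open>Complete polarization of \<open>T(x, x, x, x) = 0\<close>, one pair of arguments at a time.\<close>

lemma T_polar: "T x y z w + T x z y w + T x w y z = 0"
proof -
  have h: "T x x x x = 0" for x using hol by (simp add: T_def)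
  have 1: "T x x y y + 2 * T x y x y = 0" for x y
    using h[of "x + y"] h[of "x - y"] h[of x] h[of y]
      T_sym12[of x y x y] T_sym34[of x y x y] T_sym34[of y x x y] T_pair[of x x y y]
      T_sym12[of y x y y] T_sym12[of y x x x] T_sym34[of y y x y] T_sym34[of x x x y]
    by (simp add: T_simps)
  have 2: "T x w y y + 2 * T x y w y = 0" for x y w
    using 1[of "x + w" y] 1[of x y] 1[of w y] T_sym12[of w x y y] T_pair[of w y x y]
    by (simp add: T_simps)
  have 3: "T x w y z + T x y w z + T x z w y = 0" for x y z w
    using 2[of x w "y + z"] 2[of x w y] 2[of x w z] T_sym34[of x w z y]
    by (simp add: T_simps)
  show ?thesis using 3[of x y z w] by simp
qed

text \<open>The Bianchi identity turns the differences of the three terms in \<open>T_polar\<close> into values of \<open>S\<close>, and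
  replacing \<open>z, w\<close> by \<open>Jz, Jw\<close> there expresses \<open>T\<close> by the same values; together these relations give
  \<open>3T = - T\<close>.\<close>

theorem zero: "S x y z w = 0"
proof -
  have T0: "T x y z w = 0" for x y z w
  proof -
    have b: "T x y z w - T x z y w = - S y z x w" for x y z w
      using bianchi[of x "J y" "J z" w] J12[of y z x w] anti12[of "J z" x "J y" w] by (simp add: T_def)
    have c: "T x y z w = S x z y w + S x w y z" for x y z w
    proof -
      have "T x y (J z) (J w) = T x y z w"
        using J34[of x "J y" "J z" w] by (simp add: T_def J S_neg)
      moreover have "T x (J z) y (J w) = - S x z y w" "T x (J w) y (J z) = - S x w y z"
        by (simp_all add: T_def J J34 S_neg)
      ultimately show ?thesis using T_polar[of x y "J z" "J w"] by simp
    qed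
    show ?thesis
      using b[of x y z w] b[of x y w z] c[of y x z w] T_sym12[of y x z w] T_sym34[of x y w z] T_polar[of x y z w]
      by simp
  qed
  have "S x y z w = T x (- J y) (- J z) w" using linear_neg[OF J(2)] by (simp add: T_def J S_neg)
  then show ?thesis using T0 by simp
qed

end

lemma Jc_Jc: "Jc (Jc v) = - v"
  by (simp add: Jc_def vec_eq_iff)

lemma Jc_bounded_linear: "bounded_linear Jc"
proof -
  have "linear Jc" by (rule linearI) (simp_all add: Jc_def vec_eq_iff algebra_simps)
  then show ?thesis by (simp add: linear_conv_bounded_linear)
qed

lemma Jc_linear: "linear Jc"
  using Jc_bounded_linear by (simp add: linear_conv_bounded_linear)

lemmas Jc_simps = linear_add[OF Jc_linear] linear_diff[OF Jc_linear] linear_scale[OF Jc_linear]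
  linear_neg[OF Jc_linear] linear_0[OF Jc_linear] linear_sum[OF Jc_linear] Jc_Jc

lemmas smooth_on_Jc [smooth_intros] = smooth_on_compose_linear[OF Jc_bounded_linear]

locale kaehler_chart = riemannian_chart \<Omega> g for \<Omega> :: "(complex^2) set" and g +
  fixes \<epsilon> :: real
  assumes g_J: "z \<in> \<Omega> \<Longrightarrow> g z (Jc v) (Jc w) = g z v w"
    and \<Gamma>_J: "z \<in> \<Omega> \<Longrightarrow> christoffel g z v (Jc w) = Jc (christoffel g z v w)"
    and hol_curv: "z \<in> \<Omega> \<Longrightarrow> v \<noteq> 0 \<Longrightarrow> sectional_curvature g z v (Jc v) = 4 * \<epsilon>"
begin

lemma g_J_skew: "z \<in> \<Omega> \<Longrightarrow> g z (Jc v) w = - g z v (Jc w)"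
  using g_J[of z v "Jc w"] by (simp add: Jc_simps g_lin)

lemma g_J_self: "z \<in> \<Omega> \<Longrightarrow> g z v (Jc v) = 0"
  using g_J_skew[of z v v] g_sym[of z v "Jc v"] by simp

lemma curvature_J:
  assumes z: "z \<in> \<Omega>"
  shows "curvature g z u v (Jc w) = Jc (curvature g z u v w)"
proof -
  have "fderiv (\<lambda>q. \<Gamma> q v (Jc w)) z u = Jc (fderiv (\<lambda>q. \<Gamma> q v w) z u)" for u v
  proof -
    have "fderiv (\<lambda>q. \<Gamma> q v (Jc w)) z = fderiv (\<lambda>q. Jc (\<Gamma> q v w)) z"
      by (rule fderiv_cong_open(1)[OF open_dom z]) (simp add: \<Gamma>_J)
    also have "\<dots> = (\<lambda>u. Jc (fderiv (\<lambda>q. \<Gamma> q v w) z u))"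
      by (intro fderiv_eqI bounded_linear.has_derivative[OF Jc_bounded_linear] smooth_on_has_derivative[OF christoffel_smooth z])
    finally show ?thesis by simp
  qed
  then show ?thesis by (simp add: curvature_eq z \<Gamma>_J Jc_simps)
qed

text \<open>The curvature tensor of a complex space form of holomorphic sectional curvature \<open>4\<epsilon>\<close>.\<close>

definition curvature_model :: "complex^2 \<Rightarrow> complex^2 \<Rightarrow> complex^2 \<Rightarrow> complex^2 \<Rightarrow> complex^2 \<Rightarrow> real" where
  "curvature_model p x y z w = \<epsilon> * (g p y z * g p x w - g p x z * g p y w
     + g p (Jc y) z * g p (Jc x) w - g p (Jc x) z * g p (Jc y) w - 2 * g p (Jc x) y * g p (Jc z) w)"

text \<open>The difference of the two tensors has the symmetries of a Kaehler curvature tensor and vanishing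
  holomorphic sectional curvature.\<close>

theorem curvature_constant_holomorphic:
  assumes p: "p \<in> \<Omega>"
  shows "g p (curvature g p x y z) w = curvature_model p x y z w"
proof -
  define S where "S x y z w = g p (curvature g p x y z) w - curvature_model p x y z w" for x y z w
  note cl = curvature_linear[OF p]
  note [simp] = linear_add[OF cl(1)] linear_add[OF cl(2)] linear_add[OF cl(3)]
    linear_scale[OF cl(1)] linear_scale[OF cl(2)] linear_scale[OF cl(3)] g_lin[OF p] Jc_simps
  have l1: "linear (\<lambda>x. S x y z w)" for y z w
    by (rule linearI; simp add: S_def curvature_model_def algebra_simps)
  have l2: "linear (\<lambda>y. S x y z w)" for x z w
    by (rule linearI; simp add: S_def curvature_model_def algebra_simps)
  have l3: "linear (\<lambda>z. S x y z w)" for x y w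
    by (rule linearI; simp add: S_def curvature_model_def algebra_simps)
  have l4: "linear (\<lambda>w. S x y z w)" for x y z
    by (rule linearI; simp add: S_def curvature_model_def algebra_simps)
  have sk: "g p (Jc x) y = - g p (Jc y) x" for x y
    using g_J_skew[OF p, of x y] g_sym[OF p, of x "Jc y"] by simp
  have a12: "S x y z w = - S y x z w" for x y z w
    using curvature_antisym[OF p, of x y z] sk[of x y] by (simp add: S_def curvature_model_def algebra_simps)
  have a34: "S x y z w = - S x y w z" for x y z w
    using curvature_skew[OF p, of x y z w] sk[of z w] by (simp add: S_def curvature_model_def algebra_simps)
  have bi: "S x y z w + S y z x w + S z x y w = 0" for x y z w
  proof -
    have "g p (curvature g p x y z + curvature g p y z x + curvature g p z x y) w = 0"
      unfolding curvature_bianchi[OF p] by simp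
    moreover have "curvature_model p x y z w + curvature_model p y z x w + curvature_model p z x y w = 0"
      using sk[of x y] sk[of y z] sk[of z x] g_sym[OF p, of x y] g_sym[OF p, of y z] g_sym[OF p, of z x]
      by (simp add: S_def curvature_model_def algebra_simps)
    ultimately show ?thesis by (simp add: S_def)
  qed
  have j34: "S x y (Jc z) (Jc w) = S x y z w" for x y z w
    using g_J_skew[OF p, of z w] g_J_skew[OF p, of x "z"] g_J_skew[OF p, of y "z"] g_J_skew[OF p, of x "w"] g_J_skew[OF p, of y "w"]
    by (simp add: S_def curvature_model_def curvature_J[OF p] g_J[OF p] algebra_simps)
  have h: "S x (Jc x) (Jc x) x = 0" for x
  proof (cases "x = 0")
    case True
    then show ?thesis by (simp add: S_def curvature_model_def)
  next
    case False
    have m: "curvature_model p x (Jc x) (Jc x) x = 4 * \<epsilon> * (g p x x)\<^sup>2"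
      using g_J_self[OF p, of x] sk[of x x]
      by (simp add: S_def curvature_model_def g_J[OF p] power2_eq_square)
    have "g p x x \<noteq> 0" using g_pos_def[OF p] False unfolding pos_def_def by (metis less_irrefl)
    then show ?thesis
      using hol_curv[OF p False] unfolding S_def m sectional_curvature_def
      by (simp add: g_J[OF p] g_J_self[OF p] power2_eq_square field_simps)
  qed
  interpret kaehler_tensor Jc S
    by (rule kaehler_tensor.intro) (fact Jc_Jc Jc_linear l1 l2 l3 l4 a12 a34 bi j34 h)+
  show ?thesis using zero[of x y z w] by (simp add: S_def)
qed

end

section \<open>Lagrangian surfaces in a chart\<close>

lemma matrix_inv_eqI:
  assumes "A ** B = mat 1" "B ** A = mat 1"
  shows "matrix_inv A = B"
proof -
  have "A ** matrix_inv A = mat 1 \<and> matrix_inv A ** A = mat 1"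
    unfolding matrix_inv_def by (rule someI) (use assms in blast)
  then have "matrix_inv A = (B ** A) ** matrix_inv A" using assms by simp
  also have "\<dots> = B" using \<open>A ** matrix_inv A = mat 1 \<and> _\<close> by (simp add: matrix_mul_assoc[symmetric])
  finally show ?thesis .
qed

lemma matrix_inv_2:
  fixes A :: "real^2^2"
  assumes "det A \<noteq> 0"
  shows "matrix_inv A $ 1 $ 1 = A $ 2 $ 2 / det A" "matrix_inv A $ 1 $ 2 = - A $ 1 $ 2 / det A"
    "matrix_inv A $ 2 $ 1 = - A $ 2 $ 1 / det A" "matrix_inv A $ 2 $ 2 = A $ 1 $ 1 / det A"
proof -
  define B :: "real^2^2" where "B = (\<chi> i j. if i = 1 then (if j = 1 then A $ 2 $ 2 else - A $ 1 $ 2) / det A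
      else (if j = 1 then - A $ 2 $ 1 else A $ 1 $ 1) / det A)"
  have d: "A $ 1 $ 1 * A $ 2 $ 2 = det A + A $ 1 $ 2 * A $ 2 $ 1" by (simp add: det_2)
  have "A ** B = mat 1" "B ** A = mat 1"
    using assms d
    by (simp_all add: vec_eq_iff forall_2 B_def matrix_matrix_mult_def mat_def sum_2)
      (simp_all add: divide_simps mult.commute)
  then have "matrix_inv A = B" by (rule matrix_inv_eqI)
  then show "matrix_inv A $ 1 $ 1 = A $ 2 $ 2 / det A" "matrix_inv A $ 1 $ 2 = - A $ 1 $ 2 / det A"
    "matrix_inv A $ 2 $ 1 = - A $ 2 $ 1 / det A" "matrix_inv A $ 2 $ 2 = A $ 1 $ 1 / det A"
    by (auto simp: B_def)
qed

abbreviation e1 :: "real^2" where "e1 \<equiv> axis 1 1"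
abbreviation e2 :: "real^2" where "e2 \<equiv> axis 2 1"

lemma vec2_expand: "v = (v $ 1) *\<^sub>R e1 + (v $ 2) *\<^sub>R e2" for v :: "real^2"
  by (simp add: vec_eq_iff forall_2 axis_def)

locale lagrangian_chart = kaehler_chart \<Omega> G \<epsilon> for \<Omega> G \<epsilon> +
  fixes U :: "(real^2) set" and u :: "real^2 \<Rightarrow> complex^2"
  assumes open_U: "open U" and u_smooth: "smooth_on U u" and u_dom: "p \<in> U \<Longrightarrow> u p \<in> \<Omega>"
    and u_inj: "p \<in> U \<Longrightarrow> inj (fderiv u p)"
    and u_lagrangian: "p \<in> U \<Longrightarrow> G (u p) (fderiv u p v) (Jc (fderiv u p w)) = 0"
begin

abbreviation du :: "real^2 \<Rightarrow> real^2 \<Rightarrow> complex^2" where "du \<equiv> fderiv u"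
abbreviation Gu :: "real^2 \<Rightarrow> complex^2 \<Rightarrow> complex^2 \<Rightarrow> real" where "Gu p \<equiv> G (u p)"

text \<open>The ambient connection pulled back along \<open>u\<close>, in a constant direction \<open>v\<close>.\<close>

definition nab :: "real^2 \<Rightarrow> (real^2 \<Rightarrow> complex^2) \<Rightarrow> real^2 \<Rightarrow> complex^2" where
  "nab v \<xi> p = fderiv \<xi> p v + \<Gamma> (u p) (du p v) (\<xi> p)"

lemma du_linear: "p \<in> U \<Longrightarrow> linear (du p)"
  by (rule smooth_on_linear_fderiv[OF u_smooth])

lemmas du_lin = linear_add[OF du_linear] linear_diff[OF du_linear] linear_scale[OF du_linear]
  linear_neg[OF du_linear] linear_0[OF du_linear]

lemma u_image: "u ` U \<subseteq> \<Omega>"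
  using u_dom by blast

lemma Gu_bilinear: "p \<in> U \<Longrightarrow> bilinear (Gu p)"
  by (rule g_bilinear[OF u_dom])

lemmas Gu_lin = g_lin[OF u_dom]
lemmas Gu_sym = g_sym[OF u_dom]
lemmas Gu_J = g_J[OF u_dom]
lemmas Gu_J_skew = g_J_skew[OF u_dom]

lemma Gu_smooth0: "smooth_on U (\<lambda>p. Gu p x y)"
  by (rule smooth_on_compose[OF open_U open_dom u_image g_smooth u_smooth])

lemma Gu_smooth: "smooth_on U \<xi> \<Longrightarrow> smooth_on U \<eta> \<Longrightarrow> smooth_on U (\<lambda>p. Gu p (\<xi> p) (\<eta> p))"
  by (rule smooth_on_bilinear_field[where B=Gu, OF open_U Gu_bilinear Gu_smooth0])

lemma \<Gamma>u_bilinear: "p \<in> U \<Longrightarrow> bilinear (\<Gamma> (u p))"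
  by (rule christoffel_bilinear[OF u_dom])

lemma \<Gamma>u_smooth0: "smooth_on U (\<lambda>p. \<Gamma> (u p) x y)"
  by (rule smooth_on_compose[OF open_U open_dom u_image christoffel_smooth u_smooth])

lemma \<Gamma>u_smooth: "smooth_on U \<xi> \<Longrightarrow> smooth_on U \<eta> \<Longrightarrow> smooth_on U (\<lambda>p. \<Gamma> (u p) (\<xi> p) (\<eta> p))"
  by (rule smooth_on_bilinear_field[where B="\<lambda>p. \<Gamma> (u p)", OF open_U \<Gamma>u_bilinear \<Gamma>u_smooth0])

lemma du_smooth: "smooth_on U X \<Longrightarrow> smooth_on U (\<lambda>p. du p (X p))"
  by (rule smooth_on_fderiv_field[OF open_U u_smooth])

lemma du_smooth0: "smooth_on U (\<lambda>p. du p v)"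
  by (rule smooth_on_fderiv[OF u_smooth])

lemma nab_smooth: "smooth_on U \<xi> \<Longrightarrow> smooth_on U (nab v \<xi>)"
  unfolding nab_def[abs_def]
  by (intro smooth_on_add open_U smooth_on_fderiv \<Gamma>u_smooth u_smooth)

lemma nab_linear: "p \<in> U \<Longrightarrow> smooth_on U \<xi> \<Longrightarrow> linear (\<lambda>v. nab v \<xi> p)"
  unfolding nab_def
  using smooth_on_linear_fderiv[of U \<xi> p]
  by (intro linearI) (simp_all add: du_lin \<Gamma>_lin u_dom linear_add linear_scale algebra_simps)

lemma nab_cong: "p \<in> U \<Longrightarrow> (\<And>q. q \<in> U \<Longrightarrow> \<xi> q = \<eta> q) \<Longrightarrow> nab v \<xi> p = nab v \<eta> p"
  unfolding nab_def using fderiv_cong_open(1)[OF open_U, of p \<xi> \<eta>] by simp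

lemma nab_add:
  assumes "p \<in> U" "smooth_on U \<xi>" "smooth_on U \<eta>"
  shows "nab v (\<lambda>p. \<xi> p + \<eta> p) p = nab v \<xi> p + nab v \<eta> p"
proof -
  have "fderiv (\<lambda>p. \<xi> p + \<eta> p) p = (\<lambda>v. fderiv \<xi> p v + fderiv \<eta> p v)"
    by (rule fderiv_eqI) (intro has_derivative_add smooth_on_has_derivative[of U] assms)
  then show ?thesis using assms by (simp add: nab_def \<Gamma>_lin u_dom)
qed

lemma nab_scale:
  assumes "p \<in> U" "smooth_on U f" "smooth_on U \<xi>"
  shows "nab v (\<lambda>p. f p *\<^sub>R \<xi> p) p = fderiv f p v *\<^sub>R \<xi> p + f p *\<^sub>R nab v \<xi> p"
proof -
  have "fderiv (\<lambda>p. f p *\<^sub>R \<xi> p) p = (\<lambda>v. f p *\<^sub>R fderiv \<xi> p v + fderiv f p v *\<^sub>R \<xi> p)"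
    by (rule fderiv_eqI) (intro has_derivative_scaleR smooth_on_has_derivative[of U] assms)
  then show ?thesis using assms by (simp add: nab_def \<Gamma>_lin u_dom algebra_simps)
qed

lemma nab_J:
  assumes "p \<in> U" "smooth_on U \<xi>"
  shows "nab v (\<lambda>p. Jc (\<xi> p)) p = Jc (nab v \<xi> p)"
proof -
  have "fderiv (\<lambda>p. Jc (\<xi> p)) p = (\<lambda>v. Jc (fderiv \<xi> p v))"
    by (rule fderiv_eqI) (intro bounded_linear.has_derivative[OF Jc_bounded_linear] smooth_on_has_derivative[of U] assms)
  then show ?thesis using assms by (simp add: nab_def Jc_simps \<Gamma>_J u_dom)
qed

lemma nab_metric:
  assumes p: "p \<in> U" and s: "smooth_on U \<xi>" "smooth_on U \<eta>"
  shows "fderiv (\<lambda>p. Gu p (\<xi> p) (\<eta> p)) p v = Gu p (nab v \<xi> p) (\<eta> p) + Gu p (\<xi> p) (nab v \<eta> p)"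
proof -
  have "fderiv (\<lambda>q. Gu q (\<xi> p) (\<eta> p)) p v = fderiv (\<lambda>z. G z (\<xi> p) (\<eta> p)) (u p) (du p v)"
    by (rule fderiv_compose)
      (use p smooth_on_differentiable[OF u_smooth] smooth_on_differentiable[OF g_smooth u_dom] in auto)
  then show ?thesis
    using fderiv_bilinear_field[where B=Gu, OF open_U p Gu_bilinear Gu_smooth0 s, of v]
    by (simp add: christoffel_metric u_dom p nab_def Gu_lin)
qed

lemma nab_torsion: "p \<in> U \<Longrightarrow> nab v (\<lambda>q. du q w) p = nab w (\<lambda>q. du q v) p"
  unfolding nab_def using second_fderiv_symmetric[OF open_U _ u_smooth, of p w v]
  by (simp add: christoffel_sym[OF u_dom, of p "du p v"])

lemma nab_curvature:
  assumes p: "p \<in> U" and s: "smooth_on U \<xi>"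
  shows "nab v (nab w \<xi>) p - nab w (nab v \<xi>) p = curvature G (u p) (du p v) (du p w) (\<xi> p)"
proof -
  have "nab v (nab w \<xi>) p = fderiv (\<lambda>q. fderiv \<xi> q w) p v
     + fderiv (\<lambda>z. \<Gamma> z (du p w) (\<xi> p)) (u p) (du p v) + \<Gamma> (u p) (fderiv (\<lambda>q. du q w) p v) (\<xi> p)
     + \<Gamma> (u p) (du p w) (fderiv \<xi> p v) + \<Gamma> (u p) (du p v) (fderiv \<xi> p w)
     + \<Gamma> (u p) (du p v) (\<Gamma> (u p) (du p w) (\<xi> p))" for v w
  proof -
    have "fderiv (nab w \<xi>) p = (\<lambda>v. fderiv (\<lambda>q. fderiv \<xi> q w) p v + fderiv (\<lambda>q. \<Gamma> (u q) (du q w) (\<xi> q)) p v)"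
      unfolding nab_def[abs_def]
      by (rule fderiv_eqI) (intro has_derivative_add smooth_on_has_derivative[of U] smooth_on_fderiv \<Gamma>u_smooth u_smooth s p)
    moreover have "fderiv (\<lambda>q. \<Gamma> (u q) (du q w) (\<xi> q)) p v = fderiv (\<lambda>q. \<Gamma> (u q) (du p w) (\<xi> p)) p v
        + \<Gamma> (u p) (fderiv (\<lambda>q. du q w) p v) (\<xi> p) + \<Gamma> (u p) (du p w) (fderiv \<xi> p v)"
      by (rule fderiv_bilinear_field[where B="\<lambda>p. \<Gamma> (u p)", OF open_U p \<Gamma>u_bilinear \<Gamma>u_smooth0 du_smooth0 s])
    moreover have "fderiv (\<lambda>q. \<Gamma> (u q) (du p w) (\<xi> p)) p v = fderiv (\<lambda>z. \<Gamma> z (du p w) (\<xi> p)) (u p) (du p v)"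
      by (rule fderiv_compose)
        (use p smooth_on_differentiable[OF u_smooth] smooth_on_differentiable[OF christoffel_smooth u_dom] in auto)
    ultimately show ?thesis by (simp add: nab_def[of v] nab_def[of w _ p] \<Gamma>_lin[OF u_dom[OF p]])
  qed
  from this[of v w] this[of w v] show ?thesis
    using second_fderiv_symmetric[OF open_U p u_smooth, of w v] second_fderiv_symmetric[OF open_U p s, of w v]
    by (simp add: curvature_eq[OF u_dom[OF p]])
qed

text \<open>Both the Gauss and the Codazzi equation are components of this consequence of the curvature identity:
  for a tangent field \<open>\<xi>\<close>, with a normal \<open>\<eta>\<close> it is the Codazzi equation, with a tangent \<open>\<eta>\<close> the Gauss equation.\<close>

lemma structure_equation:
  assumes p: "p \<in> U" and s: "smooth_on U \<xi>" "smooth_on U \<eta>"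
  shows "fderiv (\<lambda>q. Gu q (nab w \<xi> q) (\<eta> q)) p v - fderiv (\<lambda>q. Gu q (nab v \<xi> q) (\<eta> q)) p w =
     Gu p (curvature G (u p) (du p v) (du p w) (\<xi> p)) (\<eta> p)
     + Gu p (nab w \<xi> p) (nab v \<eta> p) - Gu p (nab v \<xi> p) (nab w \<eta> p)"
  unfolding nab_metric[OF p nab_smooth[OF s(1)] s(2)] nab_curvature[OF p s(1), symmetric]
  by (simp add: Gu_lin p)

lemma du_normal: "p \<in> U \<Longrightarrow> Gu p (Jc (du p v)) (du p w) = 0"
  using u_lagrangian[of p w v] Gu_sym[of p] by simp

text \<open>The cubic form \<open>\<langle>h(v, w), Jz\<rangle>\<close>; the tangential part of the derivative of \<open>du w\<close> is orthogonal to \<open>Jz\<close>,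
  so the whole derivative can stand for \<open>h(v, w)\<close>.\<close>

definition C :: "real^2 \<Rightarrow> real^2 \<Rightarrow> real^2 \<Rightarrow> real^2 \<Rightarrow> real" where
  "C p v w z = Gu p (nab v (\<lambda>q. du q w) p) (Jc (du p z))"

lemma C_sym12: "p \<in> U \<Longrightarrow> C p v w z = C p w v z"
  unfolding C_def by (simp add: nab_torsion[of p v])

lemma C_sym23:
  assumes p: "p \<in> U" shows "C p v w z = C p v z w"
proof -
  have "fderiv (\<lambda>q. Gu q (du q w) (Jc (du q z))) p v = fderiv (\<lambda>q. 0) p v"
    using fderiv_cong_open(1)[OF open_U p, of "\<lambda>q. Gu q (du q w) (Jc (du q z))" "\<lambda>_. 0"] u_lagrangian by simp
  then have "Gu p (nab v (\<lambda>q. du q w) p) (Jc (du p z)) + Gu p (du p w) (Jc (nab v (\<lambda>q. du q z) p)) = 0"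
    by (simp add: nab_metric[OF p du_smooth0 smooth_on_Jc[OF open_U du_smooth0]] nab_J[OF p du_smooth0])
  then show ?thesis
    using Gu_J_skew[OF p, of "du p w" "nab v (\<lambda>q. du q z) p"] Gu_sym[OF p, of "Jc (du p w)"]
    by (simp add: C_def)
qed

lemma C_linear: "p \<in> U \<Longrightarrow> linear (\<lambda>v. C p v w z)" "p \<in> U \<Longrightarrow> linear (\<lambda>w. C p v w z)" "p \<in> U \<Longrightarrow> linear (C p v w)"
proof -
  assume p: "p \<in> U"
  show 3: "linear (C p v w)" for v w
    unfolding C_def by (rule linearI) (simp_all add: p du_lin Jc_simps Gu_lin)
  show 2: "linear (\<lambda>w. C p v w z)"
    using 3[of v z] C_sym23[OF p, of v _ z] by (simp add: linear_iff)
  show "linear (\<lambda>v. C p v w z)"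
    using 3[of w z] C_sym12[OF p, of _ w z] C_sym23[OF p, of w _ z] by (simp add: linear_iff)
qed

lemmas C_lin = linear_add[OF C_linear(1)] linear_add[OF C_linear(2)] linear_add[OF C_linear(3)]
  linear_scale[OF C_linear(1)] linear_scale[OF C_linear(2)] linear_scale[OF C_linear(3)]

lemma C_smooth0: "smooth_on U (\<lambda>p. C p v w z)"
  unfolding C_def by (intro Gu_smooth nab_smooth smooth_on_Jc open_U du_smooth0)

subsection \<open>The induced metric and the second fundamental form\<close>

lemma pullback_eq: "pullback G u p v w = Gu p (du p v) (du p w)"
  by (simp add: pullback_def)

sublocale I: riemannian_chart U "pullback G u"
proof
  have "du p v \<noteq> 0" if "p \<in> U" "v \<noteq> 0" for p v
    using linear_injective_0[OF du_linear[OF that(1)]] u_inj[OF that(1)] that(2) by blast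
  then have "pullback G u p v v > 0" if "p \<in> U" "v \<noteq> 0" for p v
    using g_pos_def[OF u_dom[OF that(1)]] that unfolding pullback_eq pos_def_def by blast
  moreover have "bilinear (pullback G u p)" if "p \<in> U" for p
    unfolding bilinear_def pullback_eq using that
    by (auto intro!: linearI simp: du_lin Gu_lin)
  moreover have "smooth_on U (\<lambda>p. pullback G u p v w)" for v w
    unfolding pullback_eq by (intro Gu_smooth du_smooth0)
  ultimately show "riemannian_metric_on U (pullback G u)"
    unfolding riemannian_metric_on_def by (auto simp: pullback_eq Gu_sym)
qed (rule open_U)

abbreviation gg where "gg \<equiv> pullback G u"

lemma gg_smooth: "smooth_on U X \<Longrightarrow> smooth_on U Y \<Longrightarrow> smooth_on U (\<lambda>p. gg p (X p) (Y p))"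
  by (rule smooth_on_bilinear_field[where B=gg, OF open_U I.g_bilinear I.g_smooth])

text \<open>The Gauss formula: the tangential part of the ambient connection satisfies the Koszul formula of the
  induced metric.\<close>

lemma induced_christoffel:
  assumes p: "p \<in> U"
  shows "Gu p (du p (I.\<Gamma> p v w)) (du p z) = Gu p (nab v (\<lambda>q. du q w) p) (du p z)"
proof -
  have d: "fderiv (\<lambda>q. gg q a b) p x = Gu p (nab x (\<lambda>q. du q a) p) (du p b) + Gu p (nab x (\<lambda>q. du q b) p) (du p a)"
    for a b x
    using nab_metric[OF p du_smooth0 du_smooth0, of a b x] Gu_sym[OF p, of "du p a"] by (simp add: pullback_def)
  have "I.koszul p v w z = Gu p (nab v (\<lambda>q. du q w) p) (du p z)"
    unfolding I.koszul_def d nab_torsion[OF p, of w v] nab_torsion[OF p, of z v] nab_torsion[OF p, of z w] by simp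
  then show ?thesis using I.christoffel_koszul[OF p, of v w z] by (simp add: pullback_eq)
qed

definition II :: "real^2 \<Rightarrow> real^2 \<Rightarrow> real^2 \<Rightarrow> complex^2" where
  "II p v w = nab v (\<lambda>q. du q w) p - du p (I.\<Gamma> p v w)"

lemma II_normal: "p \<in> U \<Longrightarrow> Gu p (II p v w) (du p z) = 0"
  unfolding II_def by (simp add: Gu_lin induced_christoffel)

lemma II_C: "p \<in> U \<Longrightarrow> Gu p (II p v w) (Jc (du p z)) = C p v w z"
  unfolding II_def C_def by (simp add: Gu_lin u_lagrangian)

lemma nab_du_field:
  assumes p: "p \<in> U" and s: "smooth_on U Z"
  shows "nab v (\<lambda>q. du q (Z q)) p = du p (fderiv Z p v) + nab v (\<lambda>q. du q (Z p)) p"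
  using fderiv_linear_field[where L=du, OF open_U p du_linear du_smooth0 s, of v] by (simp add: nab_def)

lemma second_ff_eq:
  assumes p: "p \<in> U" and s: "smooth_on U Z"
  shows "second_ff G u Y Z p = II p (Y p) (Z p)"
  using nab_du_field[OF p s, of "Y p"] p
  by (simp add: second_ff_def ambient_nabla_def induced_nabla_def levi_civita_def II_def nab_def du_lin)

text \<open>A dimension count: \<open>(v, w) \<mapsto> du v + J du w\<close> is injective between spaces of real dimension 4.\<close>

lemma tangent_normal_decomposition:
  assumes p: "p \<in> U"
  obtains v w where "x = du p v + Jc (du p w)"
proof -
  define \<Psi> where "\<Psi> vw = du p (fst vw) + Jc (du p (snd vw))" for vw :: "(real^2) \<times> (real^2)"
  have l: "linear \<Psi>"
    by (rule linearI) (simp_all add: \<Psi>_def du_lin p Jc_simps algebra_simps)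
  have "inj \<Psi>"
  proof (rule linear_injective_0[OF l, THEN iffD2], intro allI impI)
    fix vw assume 0: "\<Psi> vw = 0"
    have "Gu p (\<Psi> vw) (du p (fst vw)) = gg p (fst vw) (fst vw)"
      by (simp add: \<Psi>_def Gu_lin p du_normal pullback_eq)
    moreover have "Gu p (\<Psi> vw) (Jc (du p (snd vw))) = gg p (snd vw) (snd vw)"
      by (simp add: \<Psi>_def Gu_lin p u_lagrangian pullback_eq Gu_J)
    ultimately have "gg p (fst vw) (fst vw) = 0" "gg p (snd vw) (snd vw) = 0"
      using 0 by (simp_all add: Gu_lin p)
    then show "vw = 0"
      using I.g_pos_def[OF p] unfolding pos_def_def by (metis less_irrefl prod_eqI fst_zero snd_zero)
  qed
  then have "dim (range \<Psi>) = DIM(complex^2)"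
    using dim_image_eq[OF l, of UNIV] by (simp add: dim_UNIV)
  then have "span (range \<Psi>) = UNIV" by (simp only: dim_eq_full)
  moreover have "subspace (range \<Psi>)" using l by (simp add: linear_subspace_image)
  ultimately have "range \<Psi> = UNIV" by (metis span_eq_iff)
  then have "x \<in> range \<Psi>" by simp
  then show thesis using that by (auto simp: \<Psi>_def)
qed

lemma zero_if_orthogonal:
  assumes p: "p \<in> U" and "\<And>z. Gu p x (du p z) = 0" "\<And>z. Gu p x (Jc (du p z)) = 0"
  shows "x = 0"
proof -
  obtain v w where vw: "x = du p v + Jc (du p w)" by (rule tangent_normal_decomposition[OF p])
  have "Gu p x x = 0" using assms by (subst (2) vw) (simp add: Gu_lin p)
  then show ?thesis using g_pos_def[OF u_dom[OF p]] unfolding pos_def_def by (metis less_irrefl)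
qed

lemma normal_part:
  assumes p: "p \<in> U"
  shows "Gu p (normal_part G u p \<eta>) (du p z) = 0"
    and "Gu p (normal_part G u p \<eta>) (Jc (du p z)) = Gu p \<eta> (Jc (du p z))"
proof -
  let ?P = "\<lambda>\<xi>. (\<forall>v. G (u p) \<xi> (fderiv u p v) = 0) \<and> \<eta> - \<xi> \<in> range (fderiv u p)"
  obtain v w where vw: "\<eta> = du p v + Jc (du p w)" by (rule tangent_normal_decomposition[OF p])
  have "?P (Jc (du p w))" using vw by (simp add: du_normal p)
  moreover have "\<xi> = Jc (du p w)" if \<xi>: "?P \<xi>" for \<xi>
  proof -
    obtain z where "\<eta> - \<xi> = du p z" using \<xi> by blast
    then have "\<xi> = du p (v - z) + Jc (du p w)" using vw p by (simp add: du_lin algebra_simps)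
    moreover then have "gg p (v - z) (v - z) = 0"
      using \<xi> by (simp add: Gu_lin p pullback_eq du_normal)
    then have "v - z = 0" using I.g_pos_def[OF p] unfolding pos_def_def by (metis less_irrefl)
    ultimately show ?thesis by (simp add: du_lin p)
  qed
  ultimately have "normal_part G u p \<eta> = Jc (du p w)" unfolding normal_part_def by (rule the_equality)
  then show "Gu p (normal_part G u p \<eta>) (du p z) = 0"
    "Gu p (normal_part G u p \<eta>) (Jc (du p z)) = Gu p \<eta> (Jc (du p z))"
    using vw by (simp_all add: du_normal p Gu_lin u_lagrangian)
qed

subsection \<open>The mean curvature form\<close>

text \<open>The Gram determinant of the induced metric; its square root is the density of the area form.\<close>

definition gdet :: "real^2 \<Rightarrow> real" where
  "gdet p = gg p e1 e1 * gg p e2 e2 - gg p e1 e2 * gg p e1 e2"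

lemma det_gram: "p \<in> U \<Longrightarrow> det (gram gg p) = gdet p"
  by (simp add: det_2 gram_def gdet_def I.g_sym[of p e2 e1])

lemma gdet_pos: assumes p: "p \<in> U" shows "gdet p > 0"
proof -
  let ?a = "gg p e1 e1" and ?b = "gg p e1 e2" and ?c = "gg p e2 e2"
  have pd: "v \<noteq> 0 \<Longrightarrow> gg p v v > 0" for v using I.g_pos_def[OF p] by (simp add: pos_def_def)
  have a: "?a > 0" by (rule pd) (simp add: axis_eq_0_iff)
  have "?a *\<^sub>R e2 - ?b *\<^sub>R e1 \<noteq> 0"
    using a by (auto simp: vec_eq_iff axis_def forall_2)
  from pd[OF this] have "?a * gdet p > 0"
    by (simp add: I.g_lin p gdet_def I.g_sym[OF p, of e2 e1] algebra_simps)
  then show ?thesis using a by (simp add: zero_less_mult_iff)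
qed

lemma gdet_smooth: "smooth_on U gdet"
  unfolding gdet_def[abs_def] by (intro smooth_intros open_U I.g_smooth)

text \<open>The form \<open>z \<mapsto> \<langle>H, Jz\<rangle>\<close>, half the trace of \<open>C\<close>, with the inverse of the 2 by 2 Gram matrix
  written out.\<close>

definition \<beta> :: "real^2 \<Rightarrow> real^2 \<Rightarrow> real" where
  "\<beta> p z = (gg p e2 e2 * C p e1 e1 z - 2 * gg p e1 e2 * C p e1 e2 z + gg p e1 e1 * C p e2 e2 z) / (2 * gdet p)"

lemma \<beta>_linear: "p \<in> U \<Longrightarrow> linear (\<beta> p)"
  by (rule linearI; simp add: \<beta>_def C_lin add_divide_distrib[symmetric] algebra_simps)

abbreviation H where "H \<equiv> mean_curvature_vector G u"

lemma H_eq: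
  assumes p: "p \<in> U"
  shows "H p = (1 / (2 * gdet p)) *\<^sub>R (gg p e2 e2 *\<^sub>R II p e1 e1 - gg p e1 e2 *\<^sub>R II p e1 e2
     - gg p e1 e2 *\<^sub>R II p e2 e1 + gg p e1 e1 *\<^sub>R II p e2 e2)"
proof -
  have "det (gram gg p) \<noteq> 0" using gdet_pos[OF p] det_gram[OF p] by simp
  from matrix_inv_2[OF this] show ?thesis
    unfolding mean_curvature_vector_def sum_2 det_gram[OF p]
    by (simp add: second_ff_eq[OF p smooth_on_const] gram_def I.g_sym[OF p, of e2 e1] scaleR_right_diff_distrib scaleR_add_right)
qed

lemma H_normal: "p \<in> U \<Longrightarrow> Gu p (H p) (du p z) = 0"
  by (simp add: H_eq Gu_lin II_normal)

lemma H_\<beta>: "p \<in> U \<Longrightarrow> Gu p (H p) (Jc (du p z)) = \<beta> p z"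
  using gdet_pos[of p] by (simp add: H_eq Gu_lin II_C \<beta>_def C_sym12[of p e2 e1] field_simps)

text \<open>The tangent field \<open>- JH\<close>.\<close>

definition T :: "real^2 \<Rightarrow> real^2" where "T p = (THE c. \<forall>z. gg p c z = \<beta> p z)"

lemma T_\<beta>: "p \<in> U \<Longrightarrow> gg p (T p) z = \<beta> p z"
  unfolding T_def using theI'[OF pos_def_riesz[OF I.g_pos_def \<beta>_linear]] by blast

lemma T_smooth: "smooth_on U T"
proof (rule pos_def_solution_smooth[OF open_U I.g_pos_def I.g_smooth])
  show "gg q (T q) i = \<beta> q i" if "q \<in> U" for q i by (rule T_\<beta>[OF that])
  show "smooth_on U (\<lambda>q. \<beta> q i)" for i
    unfolding \<beta>_def using gdet_pos
    by (intro smooth_intros open_U I.g_smooth C_smooth0 gdet_smooth) fastforce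
qed

lemma J_du_T: assumes p: "p \<in> U" shows "Jc (du p (T p)) = H p"
proof -
  have "Jc (du p (T p)) - H p = 0"
  proof (rule zero_if_orthogonal[OF p])
    fix z
    show "Gu p (Jc (du p (T p)) - H p) (du p z) = 0"
      by (simp add: Gu_lin p du_normal H_normal)
    show "Gu p (Jc (du p (T p)) - H p) (Jc (du p z)) = 0"
      using T_\<beta>[OF p, of z] by (simp add: Gu_lin p H_\<beta> Gu_J pullback_eq)
  qed
  then show ?thesis by simp
qed

lemma T_norm: "p \<in> U \<Longrightarrow> gg p (T p) (T p) = Gu p (H p) (H p)"
  by (simp add: J_du_T[symmetric] Gu_J pullback_eq)

end

section \<open>The adapted frame\<close>

text \<open>The last assumption is the Euler-Lagrange equation \<open>div JH = 0\<close> in coordinates.\<close>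

locale cmc_lagrangian_chart = lagrangian_chart \<Omega> G \<epsilon> U u for \<Omega> G \<epsilon> U u +
  fixes c :: real
  assumes c_pos: "c > 0" and cmc: "p \<in> U \<Longrightarrow> Gu p (H p) (H p) = c\<^sup>2"
    and div_T: "p \<in> U \<Longrightarrow> fderiv (\<lambda>q. sqrt (gdet q) * T q $ 1) p e1 + fderiv (\<lambda>q. sqrt (gdet q) * T q $ 2) p e2 = 0"
begin

definition E1 where "E1 p = (1 / c) *\<^sub>R T p"

text \<open>The rotation of \<open>E\<^sub>1\<close> by a right angle in the coordinate orientation.\<close>

definition E2 where
  "E2 p = (1 / sqrt (gdet p)) *\<^sub>R (gg p (E1 p) e1 *\<^sub>R e2 - gg p (E1 p) e2 *\<^sub>R e1)"

lemma E1_smooth: "smooth_on U E1"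
  unfolding E1_def[abs_def] by (intro smooth_intros open_U T_smooth)

lemma E2_smooth: "smooth_on U E2"
proof -
  have "sqrt (gdet p) \<noteq> 0" if "p \<in> U" for p using gdet_pos[OF that] by simp
  then show ?thesis
    unfolding E2_def[abs_def]
    by (intro smooth_on_scaleR smooth_on_divide smooth_on_sqrt smooth_on_diff smooth_on_const open_U
      gg_smooth E1_smooth gdet_smooth gdet_pos)
qed

lemma E11: "p \<in> U \<Longrightarrow> gg p (E1 p) (E1 p) = 1"
  using c_pos by (simp add: E1_def I.g_lin T_norm cmc power2_eq_square)

text \<open>Cramer's rule for the coordinate fields in terms of the frame.\<close>

lemma E_solve:
  assumes p: "p \<in> U"
  shows "e1 = gg p (E1 p) e1 *\<^sub>R E1 p - (sqrt (gdet p) * E1 p $ 2) *\<^sub>R E2 p"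
    and "e2 = gg p (E1 p) e2 *\<^sub>R E1 p + (sqrt (gdet p) * E1 p $ 1) *\<^sub>R E2 p"
proof -
  have "gg p (E1 p) (E1 p) = E1 p $ 1 * gg p (E1 p) e1 + E1 p $ 2 * gg p (E1 p) e2"
    by (subst (3) vec2_expand) (simp add: I.g_lin p)
  then have 1: "E1 p $ 1 * gg p (E1 p) e1 + E1 p $ 2 * gg p (E1 p) e2 = 1" using E11[OF p] by simp
  have s: "sqrt (gdet p) \<noteq> 0" using gdet_pos[OF p] by simp
  have E: "sqrt (gdet p) *\<^sub>R E2 p = gg p (E1 p) e1 *\<^sub>R e2 - gg p (E1 p) e2 *\<^sub>R e1"
    using s by (simp add: E2_def)
  have E': "(sqrt (gdet p) * r) *\<^sub>R E2 p = r *\<^sub>R (gg p (E1 p) e1 *\<^sub>R e2 - gg p (E1 p) e2 *\<^sub>R e1)" for r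
    by (simp add: E[symmetric] mult.commute)
  show "e1 = gg p (E1 p) e1 *\<^sub>R E1 p - (sqrt (gdet p) * E1 p $ 2) *\<^sub>R E2 p"
    unfolding E' using 1 by (simp add: vec_eq_iff forall_2 axis_def algebra_simps)
  show "e2 = gg p (E1 p) e2 *\<^sub>R E1 p + (sqrt (gdet p) * E1 p $ 1) *\<^sub>R E2 p"
    unfolding E' using 1 by (simp add: vec_eq_iff forall_2 axis_def algebra_simps)
qed

lemma E12: "p \<in> U \<Longrightarrow> gg p (E1 p) (E2 p) = 0"
  by (simp add: E2_def I.g_lin)

lemma E22:
  assumes p: "p \<in> U" shows "gg p (E2 p) (E2 p) = 1"
proof -
  let ?x = "E1 p $ 1" and ?y = "E1 p $ 2"
  have a: "gg p (E1 p) z = ?x * gg p e1 z + ?y * gg p e2 z" for z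
    by (subst vec2_expand[of "E1 p"]) (simp add: I.g_lin p)
  have 1: "?x * (?x * gg p e1 e1 + ?y * gg p e1 e2) + ?y * (?x * gg p e1 e2 + ?y * gg p e2 e2) = 1"
    using E11[OF p] unfolding a[of "E1 p"] I.g_sym[OF p, of e1 "E1 p"] I.g_sym[OF p, of e2 "E1 p"] a
    by (simp add: I.g_sym[OF p, of e2 e1])
  have "gg p (E2 p) (E2 p) * gdet p = gdet p *
     (?x * (?x * gg p e1 e1 + ?y * gg p e1 e2) + ?y * (?x * gg p e1 e2 + ?y * gg p e2 e2))"
  proof -
    have "sqrt (gdet p) * sqrt (gdet p) = gdet p" using gdet_pos[OF p] by simp
    then have "gg p (E2 p) (E2 p) * gdet p = gg p (sqrt (gdet p) *\<^sub>R E2 p) (sqrt (gdet p) *\<^sub>R E2 p)"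
      by (simp add: I.g_lin p mult.commute mult.left_commute)
    also have "sqrt (gdet p) *\<^sub>R E2 p = gg p (E1 p) e1 *\<^sub>R e2 - gg p (E1 p) e2 *\<^sub>R e1"
      using gdet_pos[OF p] by (simp add: E2_def)
    finally show ?thesis
      unfolding a by (simp add: I.g_lin p I.g_sym[OF p, of e2 e1] gdet_def algebra_simps)
  qed
  then show ?thesis using gdet_pos[OF p] unfolding 1 by simp
qed

lemmas E_orthonormal = E11 E12 E22

lemma E21: "p \<in> U \<Longrightarrow> gg p (E2 p) (E1 p) = 0"
  using E12 I.g_sym by simp

lemma E_expand:
  assumes p: "p \<in> U"
  shows "v = gg p (E1 p) v *\<^sub>R E1 p + gg p (E2 p) v *\<^sub>R E2 p"
proof -
  define w where "w = v - gg p (E1 p) v *\<^sub>R E1 p - gg p (E2 p) v *\<^sub>R E2 p"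
  have w: "gg p w (E1 p) = 0" "gg p w (E2 p) = 0"
    using p E_orthonormal[OF p] E21[OF p]
    by (simp_all add: w_def I.g_lin I.g_sym[OF p, of v])
  have "gg p w e1 = 0" by (subst E_solve(1)[OF p]) (simp add: I.g_lin p w)
  moreover have "gg p w e2 = 0" by (subst E_solve(2)[OF p]) (simp add: I.g_lin p w)
  ultimately
  have "gg p w w = 0"
    by (subst (2) vec2_expand) (simp add: I.g_lin p)
  then have "w = 0" using I.g_pos_def[OF p] unfolding pos_def_def by (metis less_irrefl)
  then show ?thesis by (simp add: w_def algebra_simps)
qed

definition F1 where "F1 p = du p (E1 p)"
definition F2 where "F2 p = du p (E2 p)"

lemma F_smooth: "smooth_on U F1" "smooth_on U F2"
  unfolding F1_def[abs_def] F2_def[abs_def] by (intro du_smooth E1_smooth E2_smooth)+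

lemma JF_smooth: "smooth_on U (\<lambda>p. Jc (F1 p))" "smooth_on U (\<lambda>p. Jc (F2 p))"
  by (intro smooth_on_Jc open_U F_smooth)+

lemma F_unitary:
  assumes p: "p \<in> U"
  shows "Gu p (F1 p) (F1 p) = 1" "Gu p (F1 p) (F2 p) = 0" "Gu p (F2 p) (F1 p) = 0" "Gu p (F2 p) (F2 p) = 1"
    "Gu p (F1 p) (Jc (F1 p)) = 0" "Gu p (F1 p) (Jc (F2 p)) = 0" "Gu p (F2 p) (Jc (F1 p)) = 0" "Gu p (F2 p) (Jc (F2 p)) = 0"
    "Gu p (Jc (F1 p)) (F1 p) = 0" "Gu p (Jc (F1 p)) (F2 p) = 0" "Gu p (Jc (F2 p)) (F1 p) = 0" "Gu p (Jc (F2 p)) (F2 p) = 0"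
  using E_orthonormal[OF p] E21[OF p] u_lagrangian[OF p] du_normal[OF p]
  by (simp_all add: F1_def F2_def pullback_eq)

lemma du_F: "p \<in> U \<Longrightarrow> du p v = gg p (E1 p) v *\<^sub>R F1 p + gg p (E2 p) v *\<^sub>R F2 p"
  by (subst E_expand[of p v]) (simp_all add: du_lin F1_def F2_def)

lemma frame_eqI:
  assumes p: "p \<in> U"
    and "Gu p x (F1 p) = Gu p y (F1 p)" "Gu p x (F2 p) = Gu p y (F2 p)"
    "Gu p x (Jc (F1 p)) = Gu p y (Jc (F1 p))" "Gu p x (Jc (F2 p)) = Gu p y (Jc (F2 p))"
  shows "x = y"
proof -
  have "x - y = 0"
    by (rule zero_if_orthogonal[OF p]) (use assms in \<open>simp_all add: du_F[OF p] Gu_lin Jc_simps\<close>)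
  then show ?thesis by simp
qed

text \<open>The connection form of the frame.\<close>

definition \<omega> where "\<omega> p v = Gu p (nab v F1 p) (F2 p)"

lemma nab_F_same:
  assumes p: "p \<in> U"
  shows "Gu p (nab v F1 p) (F1 p) = 0" "Gu p (nab v F2 p) (F2 p) = 0" "Gu p (nab v F2 p) (F1 p) = - \<omega> p v"
proof -
  have "Gu p (nab v \<xi> p) (\<eta> p) + Gu p (nab v \<eta> p) (\<xi> p) = 0"
    if "smooth_on U \<xi>" "smooth_on U \<eta>" "\<And>q. q \<in> U \<Longrightarrow> Gu q (\<xi> q) (\<eta> q) = k" for \<xi> \<eta> k
  proof -
    have "fderiv (\<lambda>q. Gu q (\<xi> q) (\<eta> q)) p = fderiv (\<lambda>_. k) p"
      by (rule fderiv_cong_open(1)[OF open_U p]) (rule that(3))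
    then show ?thesis using nab_metric[OF p that(1,2), of v] Gu_sym[OF p, of "\<xi> p" "nab v \<eta> p"] by simp
  qed
  from this[OF F_smooth(1) F_smooth(1) F_unitary(1)] this[OF F_smooth(2) F_smooth(2) F_unitary(4)]
    this[OF F_smooth F_unitary(2)]
  show "Gu p (nab v F1 p) (F1 p) = 0" "Gu p (nab v F2 p) (F2 p) = 0" "Gu p (nab v F2 p) (F1 p) = - \<omega> p v"
    by (simp_all add: \<omega>_def)
qed

lemma nab_F_C:
  assumes p: "p \<in> U"
  shows "Gu p (nab v F1 p) (Jc (du p z)) = C p v (E1 p) z" "Gu p (nab v F2 p) (Jc (du p z)) = C p v (E2 p) z"
  using nab_du_field[OF p E1_smooth, of v] nab_du_field[OF p E2_smooth, of v]
  by (simp_all add: F1_def[abs_def] F2_def[abs_def] Gu_lin p u_lagrangian C_def)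

lemma nab_F:
  assumes p: "p \<in> U"
  shows "nab v F1 p = \<omega> p v *\<^sub>R F2 p + C p v (E1 p) (E1 p) *\<^sub>R Jc (F1 p) + C p v (E1 p) (E2 p) *\<^sub>R Jc (F2 p)"
    and "nab v F2 p = - \<omega> p v *\<^sub>R F1 p + C p v (E1 p) (E2 p) *\<^sub>R Jc (F1 p) + C p v (E2 p) (E2 p) *\<^sub>R Jc (F2 p)"
proof -
  note [simp] = Gu_lin p F_unitary[OF p] Gu_J nab_F_same[OF p] nab_F_C[OF p, of _ "E1 p", folded F1_def]
    nab_F_C[OF p, of _ "E2 p", folded F2_def]
  show "nab v F1 p = \<omega> p v *\<^sub>R F2 p + C p v (E1 p) (E1 p) *\<^sub>R Jc (F1 p) + C p v (E1 p) (E2 p) *\<^sub>R Jc (F2 p)"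
    by (rule frame_eqI[OF p]) (simp_all add: \<omega>_def)
  show "nab v F2 p = - \<omega> p v *\<^sub>R F1 p + C p v (E1 p) (E2 p) *\<^sub>R Jc (F1 p) + C p v (E2 p) (E2 p) *\<^sub>R Jc (F2 p)"
    by (rule frame_eqI[OF p]) (simp_all add: C_sym23[OF p, of v "E2 p" "E1 p"])
qed

text \<open>The trace does not depend on the frame, and \<open>\<langle>H, J du v\<rangle> = c\<theta>\<^sub>1(v)\<close>. The equations \<open>k\<close> express the
  inverse Gram matrix, which occurs in \<open>\<beta>\<close>, by the frame.\<close>

lemma C_trace:
  assumes p: "p \<in> U"
  shows "C p v (E1 p) (E1 p) + C p v (E2 p) (E2 p) = 2 * c * gg p (E1 p) v"
proof -
  let ?x = "E1 p $ 1" and ?y = "E1 p $ 2"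
  let ?a = "gg p (E1 p) e1" and ?b = "gg p (E1 p) e2"
  have a: "gg p (E1 p) z = ?x * gg p e1 z + ?y * gg p e2 z" for z
    by (subst vec2_expand[of "E1 p"]) (simp add: I.g_lin p)
  have 1: "?x * (?x * gg p e1 e1 + ?y * gg p e1 e2) + ?y * (?x * gg p e1 e2 + ?y * gg p e2 e2) = 1"
    using E11[OF p] unfolding a[of "E1 p"] I.g_sym[OF p, of e1 "E1 p"] I.g_sym[OF p, of e2 "E1 p"] a
    by (simp add: I.g_sym[OF p, of e2 e1])
  have C1: "C p v (E1 p) (E1 p) = ?x * ?x * C p v e1 e1 + 2 * ?x * ?y * C p v e1 e2 + ?y * ?y * C p v e2 e2"
    by (subst (1 2) vec2_expand[of "E1 p"]) (simp add: C_lin p C_sym23[OF p, of v e2 e1] algebra_simps)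
  have "gdet p * C p v (E2 p) (E2 p) = C p v (sqrt (gdet p) *\<^sub>R E2 p) (sqrt (gdet p) *\<^sub>R E2 p)"
    using gdet_pos[OF p] by (simp add: C_lin p mult.assoc[symmetric])
  also have "sqrt (gdet p) *\<^sub>R E2 p = ?a *\<^sub>R e2 + (- ?b) *\<^sub>R e1"
    using gdet_pos[OF p] by (simp add: E2_def)
  also have "C p v \<dots> \<dots> = ?a * ?a * C p v e2 e2 - 2 * ?a * ?b * C p v e1 e2 + ?b * ?b * C p v e1 e1"
    by (simp only: C_lin[OF p]) (simp add: C_sym23[OF p, of v e2 e1] algebra_simps)
  finally have C2: "gdet p * C p v (E2 p) (E2 p) = ?a * ?a * C p v e2 e2 - 2 * ?a * ?b * C p v e1 e2 + ?b * ?b * C p v e1 e1" .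
  have k: "gdet p * ?x * ?x + ?b * ?b = gg p e2 e2" "gdet p * ?y * ?y + ?a * ?a = gg p e1 e1"
    "gdet p * ?x * ?y - ?a * ?b = - gg p e1 e2"
  proof -
    have a': "?a = ?x * gg p e1 e1 + ?y * gg p e1 e2" "?b = ?x * gg p e1 e2 + ?y * gg p e2 e2"
      using a by (simp_all add: I.g_sym[OF p, of e2 e1])
    have "gdet p * ?x * ?x + ?b * ?b = gg p e2 e2 * (?x * (?x * gg p e1 e1 + ?y * gg p e1 e2) + ?y * (?x * gg p e1 e2 + ?y * gg p e2 e2))"
      unfolding a' gdet_def by algebra
    then show "gdet p * ?x * ?x + ?b * ?b = gg p e2 e2" unfolding 1 by simp
    have "gdet p * ?y * ?y + ?a * ?a = gg p e1 e1 * (?x * (?x * gg p e1 e1 + ?y * gg p e1 e2) + ?y * (?x * gg p e1 e2 + ?y * gg p e2 e2))"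
      unfolding a' gdet_def by algebra
    then show "gdet p * ?y * ?y + ?a * ?a = gg p e1 e1" unfolding 1 by simp
    have "gdet p * ?x * ?y - ?a * ?b = - gg p e1 e2 * (?x * (?x * gg p e1 e1 + ?y * gg p e1 e2) + ?y * (?x * gg p e1 e2 + ?y * gg p e2 e2))"
      unfolding a' gdet_def by algebra
    then show "gdet p * ?x * ?y - ?a * ?b = - gg p e1 e2" unfolding 1 by simp
  qed
  have "gdet p * (C p v (E1 p) (E1 p) + C p v (E2 p) (E2 p)) =
     (gdet p * ?x * ?x + ?b * ?b) * C p v e1 e1 + 2 * (gdet p * ?x * ?y - ?a * ?b) * C p v e1 e2
     + (gdet p * ?y * ?y + ?a * ?a) * C p v e2 e2"
    unfolding distrib_left C2 C1 by algebra
  also have "\<dots> = gg p e2 e2 * C p e1 e1 v - 2 * gg p e1 e2 * C p e1 e2 v + gg p e1 e1 * C p e2 e2 v"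
    using C_sym12[OF p, of v e1 e1] C_sym12[OF p, of v e1 e2] C_sym12[OF p, of v e2 e2]
      C_sym23[OF p, of e1 v e1] C_sym23[OF p, of e1 v e2] C_sym23[OF p, of e2 v e2]
    unfolding k by simp
  also have "\<dots> = gdet p * (2 * \<beta> p v)" using gdet_pos[OF p] by (simp add: \<beta>_def)
  also have "\<beta> p v = c * gg p (E1 p) v"
    using c_pos T_\<beta>[OF p, of v] by (simp add: E1_def I.g_lin p)
  finally show ?thesis using gdet_pos[OF p] by simp
qed

subsection \<open>Curvature of the ambient space on tangent vectors\<close>

text \<open>Every term of the curvature model in which \<open>J\<close> occurs, be it through the last argument, has a factor
  \<open>\<langle>X, JY\<rangle>\<close> with tangent vectors \<open>X\<close> and \<open>Y\<close>.\<close>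

lemma curvature_tangent:
  assumes p: "p \<in> U"
  shows "Gu p (curvature G (u p) (du p v) (du p w) (du p x)) (Jc (du p y)) = 0"
    and "Gu p (curvature G (u p) (du p v) (du p w) (du p x)) (du p y)
      = \<epsilon> * (gg p w x * gg p v y - gg p v x * gg p w y)"
  by (simp_all add: curvature_constant_holomorphic[OF u_dom[OF p]] curvature_model_def Gu_J p
      u_lagrangian du_normal pullback_eq)

subsection \<open>The frame is parallel\<close>

text \<open>First structure equation: \<open>du\<close> is torsion free, so the exterior derivative of \<open>\<theta>\<^sub>k = \<langle>F\<^sub>k, du\<rangle>\<close> only
  involves the derivative of \<open>F\<^sub>k\<close>.\<close>

lemma d_theta:
  assumes p: "p \<in> U"
  shows "fderiv (\<lambda>q. gg q (E1 q) w) p v - fderiv (\<lambda>q. gg q (E1 q) v) p w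
      = Gu p (nab v F1 p) (du p w) - Gu p (nab w F1 p) (du p v)"
    and "fderiv (\<lambda>q. gg q (E2 q) w) p v - fderiv (\<lambda>q. gg q (E2 q) v) p w
      = Gu p (nab v F2 p) (du p w) - Gu p (nab w F2 p) (du p v)"
proof -
  have "fderiv (\<lambda>q. gg q (E1 q) w) p v = Gu p (nab v F1 p) (du p w) + Gu p (F1 p) (nab v (\<lambda>q. du q w) p)"
    "fderiv (\<lambda>q. gg q (E2 q) w) p v = Gu p (nab v F2 p) (du p w) + Gu p (F2 p) (nab v (\<lambda>q. du q w) p)" for v w
    using nab_metric[OF p F_smooth(1) du_smooth0, of w v] nab_metric[OF p F_smooth(2) du_smooth0, of w v]
    by (simp_all add: F1_def F2_def pullback_eq)
  from this[of w v] this[of v w]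
  show "fderiv (\<lambda>q. gg q (E1 q) w) p v - fderiv (\<lambda>q. gg q (E1 q) v) p w
      = Gu p (nab v F1 p) (du p w) - Gu p (nab w F1 p) (du p v)"
    "fderiv (\<lambda>q. gg q (E2 q) w) p v - fderiv (\<lambda>q. gg q (E2 q) v) p w
      = Gu p (nab v F2 p) (du p w) - Gu p (nab w F2 p) (du p v)"
    using nab_torsion[OF p, of v w] by simp_all
qed

lemma theta_smooth: "smooth_on U (\<lambda>q. gg q (E1 q) w)" "smooth_on U (\<lambda>q. gg q (E2 q) w)"
  by (intro gg_smooth E1_smooth E2_smooth smooth_on_const)+

text \<open>This is \<open>d\<theta>\<^sub>1 = 0\<close> evaluated on the frame: the Codazzi equations for \<open>C(\<cdot>, E\<^sub>1, E\<^sub>1)\<close> and \<open>C(\<cdot>, E\<^sub>2, E\<^sub>2)\<close>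
  are added, whereupon the terms with \<open>\<omega>\<close> cancel.\<close>

lemma JH_closed:
  assumes p: "p \<in> U"
  shows "\<omega> p (E1 p) = 0"
proof -
  let ?v = "E1 p" and ?w = "E2 p"
  have tr: "Gu q (nab w F1 q) (Jc (F1 q)) + Gu q (nab w F2 q) (Jc (F2 q)) = 2 * c * gg q (E1 q) w" if "q \<in> U" for q w
    using C_trace[OF that, of w] nab_F_C[OF that, of w] by (simp add: F1_def F2_def)
  have d: "fderiv (\<lambda>q. Gu q (nab w F1 q) (Jc (F1 q))) p v + fderiv (\<lambda>q. Gu q (nab w F2 q) (Jc (F2 q))) p v
      = 2 * c * fderiv (\<lambda>q. gg q (E1 q) w) p v" for v w
  proof -
    have s: "smooth_on U (\<lambda>q. Gu q (nab w F1 q) (Jc (F1 q)))" "smooth_on U (\<lambda>q. Gu q (nab w F2 q) (Jc (F2 q)))"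
      by (intro Gu_smooth nab_smooth JF_smooth F_smooth)+
    have "fderiv (\<lambda>q. Gu q (nab w F1 q) (Jc (F1 q))) p v + fderiv (\<lambda>q. Gu q (nab w F2 q) (Jc (F2 q))) p v
      = fderiv (\<lambda>q. Gu q (nab w F1 q) (Jc (F1 q)) + Gu q (nab w F2 q) (Jc (F2 q))) p v"
      by (subst fderiv_eqI[OF has_derivative_add[OF smooth_on_has_derivative[OF s(1) p] smooth_on_has_derivative[OF s(2) p]]]) simp
    also have "\<dots> = fderiv (\<lambda>q. 2 * c * gg q (E1 q) w) p v"
      using fderiv_cong_open(1)[OF open_U p tr] by simp
    also have "\<dots> = 2 * c * fderiv (\<lambda>q. gg q (E1 q) w) p v"
      by (subst fderiv_eqI[OF has_derivative_mult_right[OF smooth_on_has_derivative[OF theta_smooth(1) p]]]) simp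
    finally show ?thesis .
  qed
  have "2 * c * (fderiv (\<lambda>q. gg q (E1 q) ?w) p ?v - fderiv (\<lambda>q. gg q (E1 q) ?v) p ?w) =
      Gu p (nab ?w F1 p) (Jc (nab ?v F1 p)) - Gu p (nab ?v F1 p) (Jc (nab ?w F1 p))
    + Gu p (nab ?w F2 p) (Jc (nab ?v F2 p)) - Gu p (nab ?v F2 p) (Jc (nab ?w F2 p))"
    using structure_equation[OF p F_smooth(1) JF_smooth(1), of ?w ?v] d[of ?w ?v]
      structure_equation[OF p F_smooth(2) JF_smooth(2), of ?w ?v] d[of ?v ?w]
      curvature_tangent(1)[OF p, of ?v ?w "E1 p" "E1 p", folded F1_def F2_def]
      curvature_tangent(1)[OF p, of ?v ?w "E2 p" "E2 p", folded F1_def F2_def]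
    by (simp add: nab_J[OF p] F_smooth F1_def[symmetric] F2_def[symmetric] right_diff_distrib)
  also have "\<dots> = 0"
    using p by (simp add: nab_F Gu_lin Jc_simps F_unitary Gu_J)
  finally have "fderiv (\<lambda>q. gg q (E1 q) ?w) p ?v - fderiv (\<lambda>q. gg q (E1 q) ?v) p ?w = 0"
    using c_pos by simp
  then show ?thesis
    using nab_F_same(1)[OF p] unfolding d_theta(1)[OF p] by (simp add: \<omega>_def F1_def F2_def)
qed

lemma \<omega>_linear: "p \<in> U \<Longrightarrow> linear (\<omega> p)"
  unfolding \<omega>_def[abs_def] using nab_linear[OF _ F_smooth(1)]
  by (intro linearI) (simp_all add: linear_add[OF nab_linear[OF _ F_smooth(1)]] linear_scale[OF nab_linear[OF _ F_smooth(1)]] Gu_lin)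

lemma theta2_e: assumes p: "p \<in> U"
  shows "gg p (E2 p) e1 = - (sqrt (gdet p) * T p $ 2) / c" "gg p (E2 p) e2 = (sqrt (gdet p) * T p $ 1) / c"
  by (subst E_solve(1)[OF p] E_solve(2)[OF p]; simp add: I.g_lin p E21 E22; simp add: E1_def)+

text \<open>In coordinates \<open>c\<theta>\<^sub>2 = \<surd>g (T\<^sup>1 dx\<^sup>2 - T\<^sup>2 dx\<^sup>1)\<close>, so the vanishing divergence of \<open>T\<close> says
  that \<open>\<theta>\<^sub>2\<close> is closed. By the structure equation \<open>\<omega>(E\<^sub>2)\<close> vanishes as well as \<open>\<omega>(E\<^sub>1)\<close>.\<close>

lemma \<omega>_zero:
  assumes p: "p \<in> U"
  shows "\<omega> p v = 0"
proof -
  have s: "smooth_on U (\<lambda>q. sqrt (gdet q) * T q $ i)" for i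
    by (intro smooth_intros open_U T_smooth gdet_smooth gdet_pos)
  have "fderiv (\<lambda>q. gg q (E2 q) e2) p e1 = fderiv (\<lambda>q. (1 / c) * (sqrt (gdet q) * T q $ 1)) p e1"
    using fderiv_cong_open(1)[OF open_U p, of "\<lambda>q. gg q (E2 q) e2"] theta2_e(2) by simp
  also have "\<dots> = (1 / c) * fderiv (\<lambda>q. sqrt (gdet q) * T q $ 1) p e1"
    by (subst fderiv_eqI[OF has_derivative_mult_right[OF smooth_on_has_derivative[OF s p]]]) simp
  finally have 1: "fderiv (\<lambda>q. gg q (E2 q) e2) p e1 = (1 / c) * fderiv (\<lambda>q. sqrt (gdet q) * T q $ 1) p e1" .
  have "fderiv (\<lambda>q. gg q (E2 q) e1) p e2 = fderiv (\<lambda>q. (- 1 / c) * (sqrt (gdet q) * T q $ 2)) p e2"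
    using fderiv_cong_open(1)[OF open_U p, of "\<lambda>q. gg q (E2 q) e1"] theta2_e(1) by simp
  also have "\<dots> = (- 1 / c) * fderiv (\<lambda>q. sqrt (gdet q) * T q $ 2) p e2"
    by (subst fderiv_eqI[OF has_derivative_mult_right[OF smooth_on_has_derivative[OF s p]]]) simp
  finally have 2: "fderiv (\<lambda>q. gg q (E2 q) e1) p e2 = (- 1 / c) * fderiv (\<lambda>q. sqrt (gdet q) * T q $ 2) p e2" .
  have "fderiv (\<lambda>q. gg q (E2 q) e2) p e1 - fderiv (\<lambda>q. gg q (E2 q) e1) p e2 = 0"
    unfolding 1 2 using div_T[OF p] by (simp add: add_divide_distrib[symmetric])
  then have "Gu p (nab e1 F2 p) (du p e2) - Gu p (nab e2 F2 p) (du p e1) = 0"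
    unfolding d_theta(2)[OF p] .
  then have A: "\<omega> p e2 * gg p (E1 p) e1 = \<omega> p e1 * gg p (E1 p) e2"
    by (simp add: du_F[OF p] Gu_lin p nab_F_same mult.commute)
  have \<omega>: "\<omega> p v = gg p (E2 p) v * \<omega> p (E2 p)" for v
    by (subst E_expand[OF p, of v]) (simp add: linear_add[OF \<omega>_linear[OF p]] linear_scale[OF \<omega>_linear[OF p]] JH_closed[OF p])
  have "gg p (E2 p) e1 = - (sqrt (gdet p) * E1 p $ 2)" "gg p (E2 p) e2 = sqrt (gdet p) * E1 p $ 1"
    by (subst E_solve(1)[OF p] E_solve(2)[OF p]; simp add: I.g_lin p E21 E22)+
  then have "\<omega> p (E2 p) * sqrt (gdet p) * (E1 p $ 1 * gg p (E1 p) e1 + E1 p $ 2 * gg p (E1 p) e2) = 0"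
    using A unfolding \<omega>[of e1] \<omega>[of e2] by (simp add: algebra_simps)
  moreover have "E1 p $ 1 * gg p (E1 p) e1 + E1 p $ 2 * gg p (E1 p) e2 = gg p (E1 p) (E1 p)"
    by (subst (5) vec2_expand) (simp add: I.g_lin p)
  ultimately have "\<omega> p (E2 p) = 0" using E11[OF p] gdet_pos[OF p] by simp
  then show ?thesis using \<omega>[of v] by simp
qed

end

section \<open>The second fundamental form is parallel\<close>

context cmc_lagrangian_chart
begin

definition C112 where "C112 p = C p (E1 p) (E1 p) (E2 p)"
definition C122 where "C122 p = C p (E1 p) (E2 p) (E2 p)"

lemma C_field_smooth:
  assumes "smooth_on U X" "smooth_on U Y" "smooth_on U Z"
  shows "smooth_on U (\<lambda>p. C p (X p) (Y p) (Z p))"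
proof -
  have 1: "smooth_on U (\<lambda>p. C p v (Y p) (Z p))" for v
    by (rule smooth_on_bilinear_field[where B="\<lambda>p. C p v"]; (intro open_U C_smooth0 assms)?)
      (simp add: bilinear_def C_linear)
  show ?thesis
    by (rule smooth_on_linear_field[where L="\<lambda>p v. C p v (Y p) (Z p)"]; (intro open_U 1 assms)?)
      (simp add: C_linear)
qed

lemma C112_C122_smooth: "smooth_on U C112" "smooth_on U C122"
  unfolding C112_def[abs_def] C122_def[abs_def] by (intro C_field_smooth E1_smooth E2_smooth)+

lemma C_frame:
  assumes p: "p \<in> U"
  shows "C p v (E1 p) (E1 p) = (2 * c - C122 p) * gg p (E1 p) v + C112 p * gg p (E2 p) v"
    and "C p v (E1 p) (E2 p) = C112 p * gg p (E1 p) v + C122 p * gg p (E2 p) v"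
    and "C p v (E2 p) (E1 p) = C112 p * gg p (E1 p) v + C122 p * gg p (E2 p) v"
    and "C p v (E2 p) (E2 p) = C122 p * gg p (E1 p) v - C112 p * gg p (E2 p) v"
proof -
  have 111: "C p (E1 p) (E1 p) (E1 p) = 2 * c - C122 p"
    using C_trace[OF p, of "E1 p"] by (simp add: E11[OF p] C122_def)
  have 211: "C p (E2 p) (E1 p) (E1 p) = C112 p"
    using C_sym12[OF p, of "E2 p" "E1 p" "E1 p"] C_sym23[OF p, of "E1 p" "E2 p" "E1 p"] by (simp add: C112_def)
  have 212: "C p (E2 p) (E1 p) (E2 p) = C122 p"
    using C_sym12[OF p, of "E2 p" "E1 p" "E2 p"] by (simp add: C122_def)
  have 222: "C p (E2 p) (E2 p) (E2 p) = - C112 p"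
    using C_trace[OF p, of "E2 p"] 211 by (simp add: E12[OF p])
  have e: "C p v x y = gg p (E1 p) v * C p (E1 p) x y + gg p (E2 p) v * C p (E2 p) x y" for x y
    by (subst E_expand[OF p, of v]) (simp add: C_lin p)
  show "C p v (E1 p) (E1 p) = (2 * c - C122 p) * gg p (E1 p) v + C112 p * gg p (E2 p) v"
    unfolding e[of "E1 p" "E1 p"] 111 211 by (simp add: algebra_simps)
  show 12: "C p v (E1 p) (E2 p) = C112 p * gg p (E1 p) v + C122 p * gg p (E2 p) v"
    unfolding e[of "E1 p" "E2 p"] 212 by (simp add: C112_def[symmetric] algebra_simps)
  then show "C p v (E2 p) (E1 p) = C112 p * gg p (E1 p) v + C122 p * gg p (E2 p) v"
    by (simp add: C_sym23[OF p, of v "E2 p" "E1 p"])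
  show "C p v (E2 p) (E2 p) = C122 p * gg p (E1 p) v - C112 p * gg p (E2 p) v"
    unfolding e[of "E2 p" "E2 p"] 222 by (simp add: C122_def[symmetric] algebra_simps)
qed

lemma theta_closed:
  assumes p: "p \<in> U"
  shows "fderiv (\<lambda>q. gg q (E1 q) w) p v = fderiv (\<lambda>q. gg q (E1 q) v) p w"
    "fderiv (\<lambda>q. gg q (E2 q) w) p v = fderiv (\<lambda>q. gg q (E2 q) v) p w"
  using d_theta[OF p, of w v] by (simp_all add: nab_F \<omega>_zero p du_F Gu_lin du_normal F_unitary)

lemma fderiv_combination:
  assumes p: "p \<in> U" and s: "smooth_on U f" "smooth_on U g"
  shows "fderiv (\<lambda>q. f q * gg q (E1 q) w + g q * gg q (E2 q) w) p v =
     fderiv f p v * gg p (E1 p) w + fderiv g p v * gg p (E2 p) w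
     + f p * fderiv (\<lambda>q. gg q (E1 q) w) p v + g p * fderiv (\<lambda>q. gg q (E2 q) w) p v"
  by (subst fderiv_eqI[OF has_derivative_add[OF has_derivative_mult has_derivative_mult],
        OF smooth_on_has_derivative[OF s(1) p] smooth_on_has_derivative[OF theta_smooth(1) p]
        smooth_on_has_derivative[OF s(2) p] smooth_on_has_derivative[OF theta_smooth(2) p]]) simp

text \<open>The exterior derivative of \<open>f\<theta>\<^sub>1 + g\<theta>\<^sub>2\<close> on the frame, where \<open>d\<theta>\<^sub>1 = d\<theta>\<^sub>2 = 0\<close>. The arguments \<open>E\<^sub>1(p), E\<^sub>2(p)\<close> are kept
  constant in the derivatives, so no bracket appears.\<close>

lemma wedge_combination:
  assumes p: "p \<in> U" and s: "smooth_on U f" "smooth_on U g"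
    and A: "\<And>q v. q \<in> U \<Longrightarrow> A v q = f q * gg q (E1 q) v + g q * gg q (E2 q) v"
  shows "fderiv (A (E2 p)) p (E1 p) - fderiv (A (E1 p)) p (E2 p) = fderiv g p (E1 p) - fderiv f p (E2 p)"
proof -
  have "fderiv (A w) p v = fderiv (\<lambda>q. f q * gg q (E1 q) w + g q * gg q (E2 q) w) p v" for v w
    using fderiv_cong_open(1)[OF open_U p A] by simp
  then show ?thesis
    using theta_closed[OF p, of "E2 p" "E1 p"]
    by (simp add: fderiv_combination[OF p s] E_orthonormal E21 p)
qed

text \<open>The Cauchy-Riemann equations for \<open>C\<^sub>1\<^sub>2\<^sub>2\<close> and \<open>C\<^sub>1\<^sub>1\<^sub>2\<close>: they say that the forms \<open>C(\<cdot>, E\<^sub>1, E\<^sub>2)\<close> and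
  \<open>C(\<cdot>, E\<^sub>2, E\<^sub>2)\<close> are closed.\<close>

lemma codazzi:
  assumes p: "p \<in> U"
  shows "fderiv C122 p (E1 p) = fderiv C112 p (E2 p)" "fderiv C112 p (E1 p) = - fderiv C122 p (E2 p)"
proof -
  have A12: "Gu q (nab v F1 q) (Jc (F2 q)) = C112 q * gg q (E1 q) v + C122 q * gg q (E2 q) v" if "q \<in> U" for q v
    using nab_F_C(1)[OF that, of v "E2 q"] C_frame(2)[OF that] by (simp add: F2_def)
  have A22: "Gu q (nab v F2 q) (Jc (F2 q)) = C122 q * gg q (E1 q) v + (- C112 q) * gg q (E2 q) v" if "q \<in> U" for q v
    using nab_F_C(2)[OF that, of v "E2 q"] C_frame(4)[OF that] by (simp add: F2_def)
  have ny: "smooth_on U (\<lambda>q. - C112 q)" by (intro smooth_intros open_U C112_C122_smooth)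
  have dny: "fderiv (\<lambda>q. - C112 q) p v = - fderiv C112 p v" for v
    by (subst fderiv_eqI[OF has_derivative_minus[OF smooth_on_has_derivative[OF C112_C122_smooth(1) p]]]) simp
  have R: "Gu p (curvature G (u p) (du p (E1 p)) (du p (E2 p)) (F1 p)) (Jc (F2 p)) = 0"
    "Gu p (curvature G (u p) (du p (E1 p)) (du p (E2 p)) (F2 p)) (Jc (F2 p)) = 0"
    using curvature_tangent(1)[OF p] by (simp_all add: F1_def F2_def)
  have "fderiv C122 p (E1 p) - fderiv C112 p (E2 p) = 0"
    using wedge_combination[OF p C112_C122_smooth A12] structure_equation[OF p F_smooth(1) JF_smooth(2), of "E2 p" "E1 p"] p
    by (simp add: R nab_J F_smooth) (simp add: nab_F \<omega>_zero Gu_lin Jc_simps F_unitary)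
  moreover have "- fderiv C112 p (E1 p) - fderiv C122 p (E2 p) = 0"
    using wedge_combination[OF p C112_C122_smooth(2) ny A22] structure_equation[OF p F_smooth(2) JF_smooth(2), of "E2 p" "E1 p"] p
    by (simp add: R nab_J F_smooth dny) (simp add: nab_F \<omega>_zero Gu_lin Jc_simps F_unitary)
  ultimately show "fderiv C122 p (E1 p) = fderiv C112 p (E2 p)" "fderiv C112 p (E1 p) = - fderiv C122 p (E2 p)" by auto
qed

text \<open>The tangential part of the structure equation, with \<open>d\<omega> = 0\<close>: the sectional curvature of the
  ambient space on the tangent plane is \<open>\<epsilon>\<close> and that of the surface is 0.\<close>

lemma gauss:
  assumes p: "p \<in> U"
  shows "2 * (C112 p)\<^sup>2 + 2 * (C122 p)\<^sup>2 - 2 * c * C122 p = \<epsilon>"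
proof -
  have "fderiv (\<lambda>q. Gu q (nab v F1 q) (F2 q)) p w = 0" for v w
    using fderiv_cong_open(1)[OF open_U p, of "\<lambda>q. Gu q (nab v F1 q) (F2 q)" "\<lambda>_. 0"] \<omega>_zero by (simp add: \<omega>_def)
  then have "Gu p (curvature G (u p) (du p (E1 p)) (du p (E2 p)) (F1 p)) (F2 p)
     + Gu p (nab (E2 p) F1 p) (nab (E1 p) F2 p) - Gu p (nab (E1 p) F1 p) (nab (E2 p) F2 p) = 0"
    using structure_equation[OF p F_smooth, of "E2 p" "E1 p"] by simp
  moreover have "Gu p (curvature G (u p) (du p (E1 p)) (du p (E2 p)) (F1 p)) (F2 p) = - \<epsilon>"
    using curvature_tangent(2)[OF p, of "E1 p" "E2 p" "E1 p" "E2 p"] E_orthonormal[OF p] E21[OF p]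
    by (simp add: F1_def F2_def)
  ultimately show ?thesis
    using p by (simp add: nab_F \<omega>_zero Gu_lin Gu_J F_unitary C_frame E_orthonormal E21 power2_eq_square algebra_simps)
qed

text \<open>Differentiating the equation of the circle and inserting the Cauchy-Riemann equations gives a linear
  system for the derivatives whose determinant is the squared radius, up to a factor. If the radius
  is 0, the two functions are constant anyway.\<close>

lemma C112_C122_constant:
  assumes p: "p \<in> U"
  shows "fderiv C112 p v = 0" "fderiv C122 p v = 0"
proof -
  have dy: "(C112 has_derivative fderiv C112 p) (at p)" and dz: "(C122 has_derivative fderiv C122 p) (at p)"
    by (rule smooth_on_has_derivative[OF C112_C122_smooth(1) p] smooth_on_has_derivative[OF C112_C122_smooth(2) p])+
  have D: "fderiv (\<lambda>q. 2 * (C112 q * C112 q) + 2 * (C122 q * C122 q) - 2 * c * C122 q) p v =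
      4 * C112 p * fderiv C112 p v + (4 * C122 p - 2 * c) * fderiv C122 p v" for v
    by (subst fderiv_eqI[OF has_derivative_diff[OF has_derivative_add[OF
        has_derivative_mult_right[OF has_derivative_mult[OF dy dy]] has_derivative_mult_right[OF has_derivative_mult[OF dz dz]]]
        has_derivative_mult_right[OF dz]]]) (simp add: algebra_simps)
  have "fderiv (\<lambda>q. 2 * (C112 q * C112 q) + 2 * (C122 q * C122 q) - 2 * c * C122 q) p v = 0" for v
    using fderiv_cong_open(1)[OF open_U p, of "\<lambda>q. 2 * (C112 q * C112 q) + 2 * (C122 q * C122 q) - 2 * c * C122 q" "\<lambda>_. \<epsilon>"] gauss
    by (simp add: power2_eq_square)
  then have d: "2 * C112 p * fderiv C112 p v + (2 * C122 p - c) * fderiv C122 p v = 0" for v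
    using D[of v] by (simp add: algebra_simps)
  let ?r = "fderiv C112 p (E1 p)" and ?s = "fderiv C112 p (E2 p)" and ?x = "2 * C112 p" and ?t = "2 * C122 p - c"
  have circ: "(2 * C112 q)\<^sup>2 + (2 * C122 q - c)\<^sup>2 = 2 * \<epsilon> + c\<^sup>2" if "q \<in> U" for q
    using gauss[OF that] by (simp add: power2_eq_square algebra_simps)
  have "fderiv C112 p w = 0 \<and> fderiv C122 p w = 0" if w: "w = E1 p \<or> w = E2 p" for w
  proof (cases "2 * \<epsilon> + c\<^sup>2 = 0")
    case True
    then have "2 * C112 q = 0" "2 * C122 q - c = 0" if "q \<in> U" for q
      using circ[OF that] unfolding True sum_power2_eq_zero_iff by blast+
    then have "C112 q = 0" "C122 q = c / 2" if "q \<in> U" for q using that by force+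
    then have "fderiv C112 p = fderiv (\<lambda>_. 0) p" "fderiv C122 p = fderiv (\<lambda>_. c / 2) p"
      by (intro fderiv_cong_open(1)[OF open_U p]; simp)+
    then show ?thesis by simp
  next
    case False
    have 1: "?x * ?r + ?t * ?s = 0" "?x * ?s - ?t * ?r = 0"
      using d[of "E1 p"] d[of "E2 p"] codazzi[OF p] by auto
    have "(?x\<^sup>2 + ?t\<^sup>2) * ?r = ?x * (?x * ?r + ?t * ?s) - ?t * (?x * ?s - ?t * ?r)"
      "(?x\<^sup>2 + ?t\<^sup>2) * ?s = ?t * (?x * ?r + ?t * ?s) + ?x * (?x * ?s - ?t * ?r)" by algebra+
    then have "?r = 0" "?s = 0" unfolding 1 using False circ[OF p] by auto
    then show ?thesis using w codazzi[OF p] by auto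
  qed
  then have E: "fderiv C112 p (E1 p) = 0" "fderiv C112 p (E2 p) = 0" "fderiv C122 p (E1 p) = 0" "fderiv C122 p (E2 p) = 0" by auto
  note l = smooth_on_linear_fderiv[OF C112_C122_smooth(1) p] smooth_on_linear_fderiv[OF C112_C122_smooth(2) p]
  show "fderiv C112 p v = 0"
    by (subst E_expand[OF p, of v]) (simp add: linear_add[OF l(1)] linear_scale[OF l(1)] E)
  show "fderiv C122 p v = 0"
    by (subst E_expand[OF p, of v]) (simp add: linear_add[OF l(2)] linear_scale[OF l(2)] E)
qed

lemma induced_nabla_smooth:
  assumes "smooth_on U X" "smooth_on U Y"
  shows "smooth_on U (induced_nabla G u X Y)"
  unfolding induced_nabla_def levi_civita_def[abs_def]
  by (intro smooth_on_add open_U smooth_on_fderiv_field assms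
    smooth_on_bilinear_field[where B="christoffel gg", OF open_U I.christoffel_bilinear I.christoffel_smooth])

lemma induced_nabla_tangent:
  assumes p: "p \<in> U" and s: "smooth_on U Y"
  shows "gg p (induced_nabla G u X Y p) z = Gu p (nab (X p) (\<lambda>q. du q (Y q)) p) (du p z)"
  using nab_du_field[OF p s, of "X p"] induced_christoffel[OF p, of "X p" "Y p" z]
  by (simp add: induced_nabla_def levi_civita_def pullback_eq du_lin Gu_lin p)

lemma JF_normal: "p \<in> U \<Longrightarrow> Gu p (Jc (F1 p)) (du p v) = 0" "p \<in> U \<Longrightarrow> Gu p (Jc (F2 p)) (du p v) = 0"
  by (simp_all add: F1_def F2_def du_normal)

text \<open>The frame is parallel, so the components of a covariant derivative are the derivatives of
  the components.\<close>

lemma nabla_components: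
  assumes p: "p \<in> U" and s: "smooth_on U Y"
  shows "gg p (E1 p) (induced_nabla G u X Y p) = fderiv (\<lambda>q. gg q (E1 q) (Y q)) p (X p)"
    and "gg p (E2 p) (induced_nabla G u X Y p) = fderiv (\<lambda>q. gg q (E2 q) (Y q)) p (X p)"
proof -
  have "fderiv (\<lambda>q. gg q (E1 q) (Y q)) p (X p) = Gu p (F1 p) (nab (X p) (\<lambda>q. du q (Y q)) p)"
    using nab_metric[OF p F_smooth(1) du_smooth[OF s], of "X p"]
    by (simp add: F1_def pullback_eq) (simp add: F1_def[symmetric] nab_F \<omega>_zero p Gu_lin JF_normal)
  then show "gg p (E1 p) (induced_nabla G u X Y p) = fderiv (\<lambda>q. gg q (E1 q) (Y q)) p (X p)"
    using induced_nabla_tangent[OF p s, of X "E1 p"] I.g_sym[OF p] Gu_sym[OF p] by (simp add: F1_def)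
  have "fderiv (\<lambda>q. gg q (E2 q) (Y q)) p (X p) = Gu p (F2 p) (nab (X p) (\<lambda>q. du q (Y q)) p)"
    using nab_metric[OF p F_smooth(2) du_smooth[OF s], of "X p"]
    by (simp add: F2_def pullback_eq) (simp add: F2_def[symmetric] nab_F \<omega>_zero p Gu_lin JF_normal)
  then show "gg p (E2 p) (induced_nabla G u X Y p) = fderiv (\<lambda>q. gg q (E2 q) (Y q)) p (X p)"
    using induced_nabla_tangent[OF p s, of X "E2 p"] I.g_sym[OF p] Gu_sym[OF p] by (simp add: F2_def)
qed

text \<open>The components of \<open>h(Y, Z)\<close> with respect to \<open>JF\<^sub>1\<close> and \<open>JF\<^sub>2\<close>.\<close>

definition II1 where "II1 p Y Z = (2 * c - C122 p) * gg p (E1 p) Y * gg p (E1 p) Z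
   + C112 p * (gg p (E1 p) Y * gg p (E2 p) Z + gg p (E2 p) Y * gg p (E1 p) Z) + C122 p * gg p (E2 p) Y * gg p (E2 p) Z"
definition II2 where "II2 p Y Z = C112 p * gg p (E1 p) Y * gg p (E1 p) Z
   + C122 p * (gg p (E1 p) Y * gg p (E2 p) Z + gg p (E2 p) Y * gg p (E1 p) Z) - C112 p * gg p (E2 p) Y * gg p (E2 p) Z"

lemma II_frame:
  assumes p: "p \<in> U"
  shows "II p Y Z = II1 p Y Z *\<^sub>R Jc (F1 p) + II2 p Y Z *\<^sub>R Jc (F2 p)"
proof -
  have "C p Y Z x = gg p (E1 p) Z * C p Y (E1 p) x + gg p (E2 p) Z * C p Y (E2 p) x" for x
    by (subst E_expand[OF p, of Z]) (simp add: C_lin p)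
  then have "C p Y Z (E1 p) = II1 p Y Z" "C p Y Z (E2 p) = II2 p Y Z"
    by (simp_all add: C_frame[OF p] II1_def II2_def algebra_simps)
  then show ?thesis
    using II_normal[OF p, of Y Z "E1 p"] II_normal[OF p, of Y Z "E2 p"] II_C[OF p, of Y Z "E1 p"] II_C[OF p, of Y Z "E2 p"]
    by (intro frame_eqI[OF p]) (simp_all add: F1_def[symmetric] F2_def[symmetric] Gu_lin p F_unitary Gu_J)
qed

lemma II_components_smooth:
  assumes "smooth_on U Y" "smooth_on U Z"
  shows "smooth_on U (\<lambda>q. II1 q (Y q) (Z q))" "smooth_on U (\<lambda>q. II2 q (Y q) (Z q))"
  unfolding II1_def II2_def
  by (intro smooth_on_add smooth_on_diff smooth_on_mult smooth_on_const open_U C112_C122_smooth gg_smooth E1_smooth E2_smooth assms)+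

lemma II_components_derivative:
  assumes p: "p \<in> U" and s: "smooth_on U Y" "smooth_on U Z"
  shows "fderiv (\<lambda>q. II1 q (Y q) (Z q)) p (X p) = II1 p (induced_nabla G u X Y p) (Z p) + II1 p (Y p) (induced_nabla G u X Z p)"
    and "fderiv (\<lambda>q. II2 q (Y q) (Z q)) p (X p) = II2 p (induced_nabla G u X Y p) (Z p) + II2 p (Y p) (induced_nabla G u X Z p)"
proof -
  have y0: "(C112 has_derivative (\<lambda>v. 0)) (at p)" and z0: "(C122 has_derivative (\<lambda>v. 0)) (at p)"
  proof -
    have "fderiv C112 p = (\<lambda>v. 0)" "fderiv C122 p = (\<lambda>v. 0)" using C112_C122_constant[OF p] by auto
    then show "(C112 has_derivative (\<lambda>v. 0)) (at p)" "(C122 has_derivative (\<lambda>v. 0)) (at p)"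
      using smooth_on_has_derivative[OF C112_C122_smooth(1) p] smooth_on_has_derivative[OF C112_C122_smooth(2) p] by simp_all
  qed
  have d: "((\<lambda>q. gg q (E1 q) (Y q)) has_derivative fderiv (\<lambda>q. gg q (E1 q) (Y q)) p) (at p)"
    "((\<lambda>q. gg q (E2 q) (Y q)) has_derivative fderiv (\<lambda>q. gg q (E2 q) (Y q)) p) (at p)" if "smooth_on U Y" for Y
    by (rule smooth_on_has_derivative[OF gg_smooth[OF E1_smooth that] p] smooth_on_has_derivative[OF gg_smooth[OF E2_smooth that] p])+
  note d' = y0 z0 d[OF s(1)] d[OF s(2)]
  have 1: "((\<lambda>q. II1 q (Y q) (Z q)) has_derivative (\<lambda>v.
     (2 * c - C122 p) * (fderiv (\<lambda>q. gg q (E1 q) (Y q)) p v * gg p (E1 p) (Z p) + gg p (E1 p) (Y p) * fderiv (\<lambda>q. gg q (E1 q) (Z q)) p v)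
     + C112 p * (fderiv (\<lambda>q. gg q (E1 q) (Y q)) p v * gg p (E2 p) (Z p) + gg p (E1 p) (Y p) * fderiv (\<lambda>q. gg q (E2 q) (Z q)) p v
          + fderiv (\<lambda>q. gg q (E2 q) (Y q)) p v * gg p (E1 p) (Z p) + gg p (E2 p) (Y p) * fderiv (\<lambda>q. gg q (E1 q) (Z q)) p v)
     + C122 p * (fderiv (\<lambda>q. gg q (E2 q) (Y q)) p v * gg p (E2 p) (Z p) + gg p (E2 p) (Y p) * fderiv (\<lambda>q. gg q (E2 q) (Z q)) p v))) (at p)"
    unfolding II1_def
    by (rule has_derivative_eq_rhs, (rule has_derivative_add has_derivative_diff has_derivative_mult has_derivative_const d')+)
      (simp add: fun_eq_iff algebra_simps)
  have 2: "((\<lambda>q. II2 q (Y q) (Z q)) has_derivative (\<lambda>v.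
     C112 p * (fderiv (\<lambda>q. gg q (E1 q) (Y q)) p v * gg p (E1 p) (Z p) + gg p (E1 p) (Y p) * fderiv (\<lambda>q. gg q (E1 q) (Z q)) p v)
     + C122 p * (fderiv (\<lambda>q. gg q (E1 q) (Y q)) p v * gg p (E2 p) (Z p) + gg p (E1 p) (Y p) * fderiv (\<lambda>q. gg q (E2 q) (Z q)) p v
          + fderiv (\<lambda>q. gg q (E2 q) (Y q)) p v * gg p (E1 p) (Z p) + gg p (E2 p) (Y p) * fderiv (\<lambda>q. gg q (E1 q) (Z q)) p v)
     - C112 p * (fderiv (\<lambda>q. gg q (E2 q) (Y q)) p v * gg p (E2 p) (Z p) + gg p (E2 p) (Y p) * fderiv (\<lambda>q. gg q (E2 q) (Z q)) p v))) (at p)"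
    unfolding II2_def
    by (rule has_derivative_eq_rhs, (rule has_derivative_add has_derivative_diff has_derivative_mult has_derivative_const d')+)
      (simp add: fun_eq_iff algebra_simps)
  show "fderiv (\<lambda>q. II1 q (Y q) (Z q)) p (X p) = II1 p (induced_nabla G u X Y p) (Z p) + II1 p (Y p) (induced_nabla G u X Z p)"
    unfolding fderiv_eqI[OF 1] unfolding II1_def nabla_components[OF p s(1)] nabla_components[OF p s(2)] by (simp add: algebra_simps)
  show "fderiv (\<lambda>q. II2 q (Y q) (Z q)) p (X p) = II2 p (induced_nabla G u X Y p) (Z p) + II2 p (Y p) (induced_nabla G u X Z p)"
    unfolding fderiv_eqI[OF 2] unfolding II2_def nabla_components[OF p s(1)] nabla_components[OF p s(2)] by (simp add: algebra_simps)
qed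

text \<open>Since \<open>\<omega> = 0\<close>, the derivative of \<open>JF\<^sub>k\<close> is tangent to the surface; the normal connection therefore
  differentiates only the components of \<open>h(Y, Z)\<close>.\<close>

theorem second_ff_parallel:
  assumes p: "p \<in> U" and s: "smooth_on U X" "smooth_on U Y" "smooth_on U Z"
  shows "nabla_second_ff G u X Y Z p = 0"
proof -
  let ?f1 = "\<lambda>q. II1 q (Y q) (Z q)" and ?f2 = "\<lambda>q. II2 q (Y q) (Z q)"
  let ?S = "\<lambda>q. ?f1 q *\<^sub>R Jc (F1 q) + ?f2 q *\<^sub>R Jc (F2 q)"
  let ?N = "nabla_second_ff G u X Y Z p"
  have S: "second_ff G u Y Z q = ?S q" if "q \<in> U" for q
    using second_ff_eq[OF that s(3)] II_frame[OF that] by simp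
  have "nab (X p) (second_ff G u Y Z) p = nab (X p) ?S p"
    by (rule nab_cong[OF p S])
  also have "\<dots> = fderiv ?f1 p (X p) *\<^sub>R Jc (F1 p) + ?f1 p *\<^sub>R Jc (nab (X p) F1 p)
     + (fderiv ?f2 p (X p) *\<^sub>R Jc (F2 p) + ?f2 p *\<^sub>R Jc (nab (X p) F2 p))"
    using II_components_smooth[OF s(2,3)] JF_smooth p open_U
    by (simp add: nab_add nab_scale smooth_on_scaleR nab_J F_smooth)
  finally have nS: "nab (X p) (second_ff G u Y Z) p = \<dots>" .
  have amb: "ambient_nabla G u X \<xi> p = nab (X p) \<xi> p" for \<xi>
    by (simp add: ambient_nabla_def nab_def)
  have N: "?N = normal_part G u p (nab (X p) (second_ff G u Y Z) p)
     - II p (induced_nabla G u X Y p) (Z p) - II p (Y p) (induced_nabla G u X Z p)"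
    unfolding nabla_second_ff_def normal_nabla_def amb second_ff_eq[OF p s(3)]
      second_ff_eq[OF p induced_nabla_smooth[OF s(1,3)]] ..
  show ?thesis
  proof (rule frame_eqI[OF p])
    show "Gu p ?N (F1 p) = Gu p 0 (F1 p)" "Gu p ?N (F2 p) = Gu p 0 (F2 p)"
      unfolding N F1_def F2_def by (simp_all add: Gu_lin p normal_part(1) II_normal)
    show "Gu p ?N (Jc (F1 p)) = Gu p 0 (Jc (F1 p))"
      unfolding N F1_def using p
      by (simp add: Gu_lin normal_part(2)) (simp add: F1_def[symmetric] nS II_frame nab_F \<omega>_zero Gu_lin Jc_simps F_unitary Gu_J II_components_derivative s)
    show "Gu p ?N (Jc (F2 p)) = Gu p 0 (Jc (F2 p))"
      unfolding N F2_def using p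
      by (simp add: Gu_lin normal_part(2)) (simp add: F2_def[symmetric] nS II_frame nab_F \<omega>_zero Gu_lin Jc_simps F_unitary Gu_J II_components_derivative s)
  qed
qed

end

section \<open>The fundamental lemma of the calculus of variations\<close>

lemma fderiv_zero_off_support:
  assumes "closed K" "\<And>x. x \<notin> K \<Longrightarrow> h x = 0" "x \<notin> K"
  shows "fderiv h x = (\<lambda>_. 0)"
  using fderiv_cong_open(1)[of "- K" x h "\<lambda>_. 0"] assms by (auto simp: open_Compl)

text \<open>The integral of \<open>h(x + te)\<close> over a box that contains all the translated supports does not depend on
  \<open>t\<close>; differentiate it at \<open>t = 0\<close> under the integral sign.\<close>

lemma integral_fderiv_zero:
  fixes h :: "'a::euclidean_space \<Rightarrow> real"
  assumes s: "smooth_on UNIV h" and z: "\<And>x. x \<notin> cbox a b \<Longrightarrow> h x = 0"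
  shows "integral (cbox a b) (\<lambda>x. fderiv h x e) = 0"
proof -
  define M :: 'a where "M = (\<Sum>i\<in>Basis. \<bar>e \<bullet> i\<bar> *\<^sub>R i)"
  have M: "M \<bullet> i = \<bar>e \<bullet> i\<bar>" if "i \<in> Basis" for i using that by (simp add: M_def)
  let ?a = "a - M" and ?b = "b + M"
  have c: "continuous_on S h" for S using smooth_on_continuous[OF s] continuous_on_subset by blast
  have c': "continuous_on S (\<lambda>x. fderiv h x e)" for S
    using smooth_on_continuous[OF smooth_on_fderiv[OF s, of e]] continuous_on_subset by blast
  have sub: "cbox a b \<subseteq> cbox (?a + t *\<^sub>R e) (?b + t *\<^sub>R e)" if t: "\<bar>t\<bar> \<le> 1" for t
  proof -
    have "\<bar>t * (e \<bullet> i)\<bar> \<le> \<bar>e \<bullet> i\<bar>" for i :: 'a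
      using mult_right_mono[OF t, of "\<bar>e \<bullet> i\<bar>"] by (simp add: abs_mult)
    then have "- \<bar>e \<bullet> i\<bar> \<le> t * (e \<bullet> i) \<and> t * (e \<bullet> i) \<le> \<bar>e \<bullet> i\<bar>" for i :: 'a
      by (metis abs_le_iff minus_le_iff)
    note b = this
    show ?thesis
    proof
      fix x assume x: "x \<in> cbox a b"
      show "x \<in> cbox (?a + t *\<^sub>R e) (?b + t *\<^sub>R e)"
        unfolding mem_box
      proof
        fix i :: 'a assume i: "i \<in> Basis"
        then have "a \<bullet> i \<le> x \<bullet> i" "x \<bullet> i \<le> b \<bullet> i" using x by (auto simp: mem_box)
        then show "(?a + t *\<^sub>R e) \<bullet> i \<le> x \<bullet> i \<and> x \<bullet> i \<le> (?b + t *\<^sub>R e) \<bullet> i"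
          using b[of i] M[OF i] by (simp add: inner_add_left inner_diff_left)
      qed
    qed
  qed
  have const: "integral (cbox ?a ?b) (\<lambda>x. h (x + t *\<^sub>R e)) = integral (cbox a b) h" if t: "\<bar>t\<bar> \<le> 1" for t
  proof -
    have "integral (cbox ?a ?b) (h \<circ> (+) (t *\<^sub>R e)) = integral (cbox (?a + t *\<^sub>R e) (?b + t *\<^sub>R e)) h"
      by (rule integral_shift_cbox_plus)
    also have "\<dots> = integral (cbox a b) h"
      by (rule integral_unique, rule has_integral_on_superset[OF _ z sub[OF t]])
        (auto intro!: integrable_integral integrable_continuous c)
    finally show ?thesis by (simp add: o_def add.commute)
  qed
  have "((\<lambda>t. integral (cbox ?a ?b) (\<lambda>x. h (x + t *\<^sub>R e))) has_field_derivative
      integral (cbox ?a ?b) (\<lambda>x. fderiv h (x + 0 *\<^sub>R e) e)) (at 0 within {-1<..<1})"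
  proof (rule leibniz_rule_field_derivative)
    fix t :: real and x :: 'a
    have "(h has_derivative fderiv h (x + t *\<^sub>R e)) (at (x + t *\<^sub>R e))"
      by (rule smooth_on_has_derivative[OF s]) simp
    then have "((\<lambda>t. h (x + t *\<^sub>R e)) has_derivative (\<lambda>r. fderiv h (x + t *\<^sub>R e) (r *\<^sub>R e))) (at t)"
      by (intro has_derivative_compose[of "\<lambda>t. x + t *\<^sub>R e" "\<lambda>r. r *\<^sub>R e" t UNIV h]) (auto intro!: derivative_eq_intros)
    moreover have "(\<lambda>r. fderiv h (x + t *\<^sub>R e) (r *\<^sub>R e)) = (*) (fderiv h (x + t *\<^sub>R e) e)"
      using smooth_on_linear_fderiv[OF s, of "x + t *\<^sub>R e"] by (auto simp: linear_scale mult.commute)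
    ultimately have "((\<lambda>t. h (x + t *\<^sub>R e)) has_field_derivative fderiv h (x + t *\<^sub>R e) e) (at t)"
      unfolding has_field_derivative_def by simp
    then show "((\<lambda>t. h (x + t *\<^sub>R e)) has_field_derivative fderiv h (x + t *\<^sub>R e) e) (at t within {-1<..<1})"
      by (rule has_field_derivative_at_within)
  next
    show "(\<lambda>x. h (x + t *\<^sub>R e)) integrable_on cbox ?a ?b" for t
      by (intro integrable_continuous continuous_on_compose2[OF c[of UNIV]] continuous_intros) auto
    show "continuous_on ({-1<..<1} \<times> cbox ?a ?b) (\<lambda>(t, x). fderiv h (x + t *\<^sub>R e) e)"
      unfolding split_beta
      by (intro continuous_on_compose2[OF c'[of UNIV]] continuous_intros) auto
  qed auto
  then have 1: "((\<lambda>t. integral (cbox ?a ?b) (\<lambda>x. h (x + t *\<^sub>R e))) has_field_derivative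
      integral (cbox ?a ?b) (\<lambda>x. fderiv h x e)) (at 0)"
    by (subst (asm) at_within_open) auto
  have 2: "((\<lambda>t. integral (cbox ?a ?b) (\<lambda>x. h (x + t *\<^sub>R e))) has_field_derivative 0) (at 0)"
    by (subst DERIV_cong_ev[OF refl _ refl, of _ "\<lambda>_. integral (cbox a b) h"])
      (auto simp: eventually_nhds const intro!: exI[of _ "{-1<..<1}"])
  have "integral (cbox ?a ?b) (\<lambda>x. fderiv h x e) = 0"
    using DERIV_unique[OF 1 2] .
  moreover have "integral (cbox ?a ?b) (\<lambda>x. fderiv h x e) = integral (cbox a b) (\<lambda>x. fderiv h x e)"
  proof (rule integral_unique, rule has_integral_on_superset)
    show "((\<lambda>x. fderiv h x e) has_integral integral (cbox a b) (\<lambda>x. fderiv h x e)) (cbox a b)"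
      by (intro integrable_integral integrable_continuous c')
    show "fderiv h x e = 0" if "x \<notin> cbox a b" for x
      using fderiv_zero_off_support[OF closed_cbox z that] by simp
    show "cbox a b \<subseteq> cbox ?a ?b" using sub[of 0] by simp
  qed
  ultimately show ?thesis by simp
qed

text \<open>For a bump function \<open>\<psi>\<close> at \<open>p\<^sub>0\<close>, integration by parts turns the integral of \<open>d\<psi>(V)\<close> into that of
  \<open>- \<psi> div V\<close>, which is not 0 if \<open>div V\<close> has a sign on the support of \<open>\<psi>\<close>. The fields \<open>\<psi>V\<^sup>i\<close> are extended by 0 beyond \<open>U\<close>.\<close>

lemma divergence_zero:
  fixes V :: "real^2 \<Rightarrow> real^2"
  assumes U: "open U" "cbox a b \<subseteq> U" "cball p0 r \<subseteq> box a b" "r > 0"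
    and V: "smooth_on U V"
    and weak: "\<And>\<psi> :: real^2 \<Rightarrow> real. smooth_on UNIV \<psi> \<Longrightarrow> (\<And>x. x \<notin> ball p0 r \<Longrightarrow> \<psi> x = 0) \<Longrightarrow>
        integral (cbox a b) (\<lambda>p. fderiv \<psi> p (V p)) = 0"
  shows "fderiv (\<lambda>q. V q $ 1) p0 e1 + fderiv (\<lambda>q. V q $ 2) p0 e2 = 0" (is "?D p0 = 0")
proof (rule ccontr)
  assume ne: "?D p0 \<noteq> 0"
  have p0: "p0 \<in> box a b" using U(3,4) by (metis centre_in_cball less_eq_real_def subsetD)
  then have p0U: "p0 \<in> U" using U(2) box_subset_cbox by blast
  have sV: "smooth_on U (\<lambda>q. V q $ i)" for i by (intro smooth_intros U V)
  have sD: "smooth_on U ?D" by (intro smooth_intros U V)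
  then have "isCont ?D p0" using smooth_on_continuous U(1) p0U continuous_on_eq_continuous_at by blast
  then obtain d where d: "d > 0" "\<And>x. dist x p0 < d \<Longrightarrow> dist (?D x) (?D p0) < \<bar>?D p0\<bar>"
    using ne unfolding continuous_at_dist_char by (meson zero_less_abs_iff)
  define r' where "r' = min d r"
  have r': "r' > 0" "r' \<le> r" "r' \<le> d" using d U by (auto simp: r'_def)
  obtain \<psi> :: "real^2 \<Rightarrow> real" where \<psi>: "smooth_on UNIV \<psi>" "\<And>x. \<psi> x \<ge> 0" "\<psi> p0 > 0" "\<And>x. x \<notin> ball p0 r' \<Longrightarrow> \<psi> x = 0"
    using smooth_bump[OF r'(1)] by metis
  have \<psi>0: "\<psi> x = 0" if "x \<notin> cball p0 r" for x
    by (rule \<psi>(4)) (use that r' in auto)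
  have \<psi>S: "smooth_on S \<psi>" for S using smooth_on_subset[OF \<psi>(1)] by blast
  define h where "h i q = (if q \<in> U then \<psi> q * V q $ i else 0)" for i q
  have sh: "smooth_on UNIV (h i)" for i
  proof (rule smooth_on_local)
    fix x :: "real^2"
    show "\<exists>T. open T \<and> x \<in> T \<and> smooth_on T (h i)"
    proof (cases "x \<in> U")
      case True
      have "smooth_on U (\<lambda>q. \<psi> q * V q $ i)" by (intro smooth_intros U \<psi>S V)
      then have "smooth_on U (h i)"
        using smooth_on_cong[OF U(1), of "h i" "\<lambda>q. \<psi> q * V q $ i"] by (simp add: h_def)
      then show ?thesis using True U by blast
    next
      case False
      then have "x \<in> - cball p0 r" using U(2,3) box_subset_cbox by blast
      moreover have "smooth_on (- cball p0 r) (h i)"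
        using smooth_on_cong[of "- cball p0 r" "h i" "\<lambda>_. 0"] \<psi>0
        by (simp add: h_def open_Compl smooth_on_const)
      ultimately show ?thesis by (meson open_Compl closed_cball)
    qed
  qed
  have hz: "h i x = 0" if "x \<notin> cbox a b" for i x
  proof -
    have "x \<notin> cball p0 r" using that U(3) box_subset_cbox[of a b] by blast
    from \<psi>0[OF this] show ?thesis by (simp add: h_def)
  qed
  have sub: "cbox a b \<subseteq> U" by (rule U)
  have dh: "fderiv (h i) p v = fderiv \<psi> p v * V p $ i + \<psi> p * fderiv (\<lambda>q. V q $ i) p v" if p: "p \<in> U" for i p v
  proof -
    have "fderiv (h i) p = fderiv (\<lambda>q. \<psi> q * V q $ i) p"
      by (rule fderiv_cong_open(1)[OF U(1) p]) (simp add: h_def)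
    also have "\<dots> = (\<lambda>v. \<psi> p * fderiv (\<lambda>q. V q $ i) p v + fderiv \<psi> p v * V p $ i)"
      by (rule fderiv_eqI[OF has_derivative_mult[OF smooth_on_has_derivative[OF \<psi>S p] smooth_on_has_derivative[OF sV p]]])
    finally show ?thesis by simp
  qed
  have eq: "fderiv (h 1) p e1 + fderiv (h 2) p e2 = fderiv \<psi> p (V p) + \<psi> p * ?D p" if p: "p \<in> U" for p
  proof -
    have "linear (fderiv \<psi> p)" using smooth_on_linear_fderiv[OF \<psi>(1)] by simp
    then have "fderiv \<psi> p (V p $ 1 *\<^sub>R e1 + V p $ 2 *\<^sub>R e2) = V p $ 1 * fderiv \<psi> p e1 + V p $ 2 * fderiv \<psi> p e2"
      by (simp add: linear_add linear_scale)
    then have "fderiv \<psi> p (V p) = V p $ 1 * fderiv \<psi> p e1 + V p $ 2 * fderiv \<psi> p e2"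
      using vec2_expand[of "V p"] by simp
    then show ?thesis by (simp add: dh[OF p] algebra_simps)
  qed
  have i: "continuous_on (cbox a b) f \<Longrightarrow> f integrable_on cbox a b" for f :: "real^2 \<Rightarrow> real"
    by (rule integrable_continuous)
  have ch: "continuous_on (cbox a b) (\<lambda>p. fderiv (h i) p v)" for i v
    using smooth_on_continuous[OF smooth_on_fderiv[OF sh]] continuous_on_subset by blast
  have c\<psi>: "continuous_on (cbox a b) (\<lambda>p. fderiv \<psi> p (V p))"
    by (rule continuous_on_subset[OF smooth_on_continuous sub]) (intro smooth_intros U \<psi>S V)
  have cD: "continuous_on (cbox a b) (\<lambda>p. \<psi> p * ?D p)"
    by (rule continuous_on_subset[OF smooth_on_continuous sub]) (intro smooth_intros U \<psi>S V)
  have "integral (cbox a b) (\<lambda>p. fderiv (h 1) p e1 + fderiv (h 2) p e2) = 0"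
    by (subst Henstock_Kurzweil_Integration.integral_add[OF i[OF ch] i[OF ch]]) (simp add: integral_fderiv_zero[OF sh hz])
  moreover have "integral (cbox a b) (\<lambda>p. fderiv (h 1) p e1 + fderiv (h 2) p e2) =
      integral (cbox a b) (\<lambda>p. fderiv \<psi> p (V p) + \<psi> p * ?D p)"
    by (rule integral_cong) (use eq sub in blast)
  moreover have "\<dots> = integral (cbox a b) (\<lambda>p. fderiv \<psi> p (V p)) + integral (cbox a b) (\<lambda>p. \<psi> p * ?D p)"
    by (rule Henstock_Kurzweil_Integration.integral_add[OF i[OF c\<psi>] i[OF cD]])
  moreover have "integral (cbox a b) (\<lambda>p. fderiv \<psi> p (V p)) = 0"
    by (rule weak[OF \<psi>(1)], rule \<psi>(4)) (use r' in auto)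
  ultimately have int0: "integral (cbox a b) (\<lambda>p. \<psi> p * ?D p) = 0" by simp
  have nonneg: "0 \<le> sgn (?D p0) * (\<psi> p * ?D p)" for p
  proof (cases "p \<in> ball p0 r'")
    case True
    then have "dist (?D p) (?D p0) < \<bar>?D p0\<bar>" using d(2)[of p] r' by (simp add: dist_commute)
    then have "0 \<le> sgn (?D p0) * ?D p" by (auto simp: sgn_if dist_real_def)
    from mult_nonneg_nonneg[OF \<psi>(2)[of p] this] show ?thesis by (simp only: mult.left_commute)
  qed (simp add: \<psi>(4))
  have "sgn (?D p0) * (\<psi> p0 * ?D p0) = 0"
  proof (rule has_integral_0_cbox_imp_0[where f="\<lambda>p. sgn (?D p0) * (\<psi> p * ?D p)" and a=a and b=b and x=p0])
    show "continuous_on (cbox a b) (\<lambda>p. sgn (?D p0) * (\<psi> p * ?D p))" by (intro continuous_intros cD)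
    show "((\<lambda>p. sgn (?D p0) * (\<psi> p * ?D p)) has_integral 0) (cbox a b)"
      using has_integral_mult_right[OF integrable_integral[OF i[OF cD]], of "sgn (?D p0)"] int0 by simp
  qed (use nonneg p0 box_subset_cbox in auto)
  then show False using ne \<psi>(3) by (simp add: sgn_if split: if_splits)
qed

section \<open>The first variation of area\<close>

context lagrangian_chart
begin

definition var :: "(real^2 \<Rightarrow> complex^2) \<Rightarrow> real \<Rightarrow> real^2 \<Rightarrow> complex^2" where
  "var \<xi> t p = u p + t *\<^sub>R \<xi> p"

definition var_dom :: "(real^2 \<Rightarrow> complex^2) \<Rightarrow> (real \<times> (real^2)) set" where
  "var_dom \<xi> = {z. snd z \<in> U \<and> var \<xi> (fst z) (snd z) \<in> \<Omega>}"

definition var_metric :: "(real^2 \<Rightarrow> complex^2) \<Rightarrow> real^2 \<Rightarrow> real^2 \<Rightarrow> real \<times> (real^2) \<Rightarrow> real" where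
  "var_metric \<xi> v w z = G (var \<xi> (fst z) (snd z)) (du (snd z) v + fst z *\<^sub>R fderiv \<xi> (snd z) v)
     (du (snd z) w + fst z *\<^sub>R fderiv \<xi> (snd z) w)"

lemma smooth_on_snd_compose:
  fixes f :: "real^2 \<Rightarrow> 'c::real_normed_vector"
  assumes "open W" "snd ` W \<subseteq> U" "smooth_on U f"
  shows "smooth_on W (\<lambda>z. f (snd z))"
  by (rule smooth_on_compose[OF assms(1) open_U assms(2,3)]) (intro smooth_intros assms)

lemma var_smooth:
  assumes "open W" "snd ` W \<subseteq> U" "smooth_on U \<xi>"
  shows "smooth_on W (\<lambda>z. var \<xi> (fst z) (snd z))"
  unfolding var_def
  by (intro smooth_intros smooth_on_snd_compose assms u_smooth)

lemma var_dom_open: assumes s: "smooth_on U \<xi>" shows "open (var_dom \<xi>)"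
proof -
  have o: "open (UNIV \<times> U :: (real \<times> (real^2)) set)" using open_U by (intro open_Times) auto
  have "continuous_on (UNIV \<times> U) (\<lambda>z. var \<xi> (fst z) (snd z))"
    by (rule smooth_on_continuous, rule var_smooth[OF o _ s]) auto
  from continuous_open_preimage[OF this o open_dom] show ?thesis
    by (rule back_subst[of "open"]) (auto simp: var_dom_def)
qed

lemma var_dom_0: "p \<in> U \<Longrightarrow> (0, p) \<in> var_dom \<xi>"
  by (simp add: var_dom_def var_def u_dom)

lemma fderiv_var:
  assumes "p \<in> U" "smooth_on U \<xi>"
  shows "fderiv (var \<xi> t) p v = du p v + t *\<^sub>R fderiv \<xi> p v"
proof -
  have "fderiv (var \<xi> t) p = (\<lambda>v. du p v + t *\<^sub>R fderiv \<xi> p v)"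
    unfolding var_def[abs_def]
    by (rule fderiv_eqI) (intro has_derivative_add has_derivative_scaleR_right smooth_on_has_derivative[of U] u_smooth assms)
  then show ?thesis by simp
qed

lemma pullback_var: "p \<in> U \<Longrightarrow> smooth_on U \<xi> \<Longrightarrow> pullback G (var \<xi> t) p v w = var_metric \<xi> v w (t, p)"
  by (simp add: pullback_def var_metric_def fderiv_var)

lemma var_metric_smooth:
  assumes s: "smooth_on U \<xi>"
  shows "smooth_on (var_dom \<xi>) (var_metric \<xi> v w)"
  unfolding var_metric_def[abs_def]
proof (rule smooth_on_bilinear_field[where B="\<lambda>z. G (var \<xi> (fst z) (snd z))"])
  note o = var_dom_open[OF s]
  have sub: "snd ` var_dom \<xi> \<subseteq> U" by (auto simp: var_dom_def)
  show "open (var_dom \<xi>)" by (rule o)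
  show "bilinear (G (var \<xi> (fst q) (snd q)))" if "q \<in> var_dom \<xi>" for q
    using that by (intro g_bilinear) (simp add: var_dom_def)
  show "smooth_on (var_dom \<xi>) (\<lambda>q. G (var \<xi> (fst q) (snd q)) x y)" for x y
    by (rule smooth_on_compose[OF o open_dom _ g_smooth var_smooth[OF o sub s]]) (auto simp: var_dom_def)
  have d: "smooth_on (var_dom \<xi>) (\<lambda>z. du (snd z) v + fst z *\<^sub>R fderiv \<xi> (snd z) v)" for v
    by (intro smooth_on_add smooth_on_scaleR smooth_on_fst smooth_on_ident o
      smooth_on_snd_compose[OF o sub] smooth_on_fderiv u_smooth s)
  show "smooth_on (var_dom \<xi>) (\<lambda>z. du (snd z) v + fst z *\<^sub>R fderiv \<xi> (snd z) v)" by (rule d)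
  show "smooth_on (var_dom \<xi>) (\<lambda>z. du (snd z) w + fst z *\<^sub>R fderiv \<xi> (snd z) w)" by (rule d)
qed

lemma var_metric_0: "var_metric \<xi> v w (0, p) = gg p v w"
  by (simp add: var_metric_def var_def pullback_eq)

lemma fderiv_fst_slice:
  fixes h :: "real \<times> 'b::euclidean_space \<Rightarrow> 'c::real_normed_vector"
  assumes "h differentiable (at (t, p))"
  shows "((\<lambda>t. h (t, p)) has_derivative (\<lambda>r. fderiv h (t, p) (r, 0))) (at t)"
  by (rule has_derivative_compose[of "\<lambda>t. (t, p)" "\<lambda>r. (r, 0)" t UNIV h, OF _ fderiv_works])
    (use assms in \<open>auto intro!: derivative_eq_intros\<close>)

text \<open>Only the parameter \<open>t\<close> moves, so this is a derivative in one real variable; metric compatibility of the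
  ambient connection absorbs the derivative of \<open>G\<close>.\<close>

lemma first_variation_metric:
  assumes p: "p \<in> U" and s: "smooth_on U \<xi>"
  shows "fderiv (var_metric \<xi> v w) (0, p) (1, 0) = Gu p (nab v \<xi> p) (du p w) + Gu p (du p v) (nab w \<xi> p)"
proof -
  define D where "D = {t. var \<xi> t p \<in> \<Omega>}"
  have "continuous_on UNIV (\<lambda>t. var \<xi> t p)" unfolding var_def by (intro continuous_intros)
  from continuous_open_preimage[OF this open_UNIV open_dom] have D: "open D"
    by (rule back_subst[of "open"]) (auto simp: D_def)
  have 0: "0 \<in> D" using u_dom[OF p] by (simp add: D_def var_def)
  have sv: "smooth_on D (\<lambda>t. var \<xi> t p)" unfolding var_def by (intro smooth_intros D)
  have vd: "((\<lambda>t. var \<xi> t p) has_derivative (\<lambda>r. r *\<^sub>R \<xi> p)) (at 0)"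
    unfolding var_def by (auto intro!: derivative_eq_intros)
  have "fderiv (\<lambda>t. G (var \<xi> t p) (du p v + t *\<^sub>R fderiv \<xi> p v) (du p w + t *\<^sub>R fderiv \<xi> p w)) 0 1 =
     fderiv (\<lambda>t. G (var \<xi> t p) (du p v + 0 *\<^sub>R fderiv \<xi> p v) (du p w + 0 *\<^sub>R fderiv \<xi> p w)) 0 1
     + G (var \<xi> 0 p) (fderiv (\<lambda>t. du p v + t *\<^sub>R fderiv \<xi> p v) 0 1) (du p w + 0 *\<^sub>R fderiv \<xi> p w)
     + G (var \<xi> 0 p) (du p v + 0 *\<^sub>R fderiv \<xi> p v) (fderiv (\<lambda>t. du p w + t *\<^sub>R fderiv \<xi> p w) 0 1)"
  proof (rule fderiv_bilinear_field[where B="\<lambda>t. G (var \<xi> t p)", OF D 0])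
    show "bilinear (G (var \<xi> q p))" if "q \<in> D" for q
      using that by (intro g_bilinear) (simp add: D_def)
    show "smooth_on D (\<lambda>q. G (var \<xi> q p) x y)" for x y
      by (rule smooth_on_compose[OF D open_dom _ g_smooth sv]) (auto simp: D_def)
  qed (intro smooth_intros D)+
  moreover have "fderiv (\<lambda>t. du p v + t *\<^sub>R fderiv \<xi> p v) 0 1 = fderiv \<xi> p v" for v
    by (subst fderiv_eqI[of _ "\<lambda>r. r *\<^sub>R fderiv \<xi> p v"]) (auto intro!: derivative_eq_intros)
  moreover have "fderiv (\<lambda>t. G (var \<xi> t p) x y) 0 1 = fderiv (\<lambda>z. G z x y) (u p) (\<xi> p)" for x y
  proof -
    have d: "(\<lambda>z. G z x y) differentiable (at (var \<xi> 0 p))"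
      using smooth_on_differentiable[OF g_smooth u_dom[OF p]] by (simp add: var_def)
    have "fderiv (\<lambda>t. G (var \<xi> t p) x y) 0 = (\<lambda>r. fderiv (\<lambda>z. G z x y) (var \<xi> 0 p) (r *\<^sub>R \<xi> p))"
      by (rule fderiv_eqI) (rule has_derivative_compose[OF vd fderiv_works[OF d]])
    then show ?thesis by (simp add: var_def)
  qed
  moreover have "fderiv (\<lambda>t. var_metric \<xi> v w (t, p)) 0 = (\<lambda>r. fderiv (var_metric \<xi> v w) (0, p) (r, 0))"
    by (intro fderiv_eqI fderiv_fst_slice smooth_on_differentiable[OF var_metric_smooth[OF s] var_dom_0[OF p]])
  ultimately have "fderiv (var_metric \<xi> v w) (0, p) (1, 0) = fderiv (\<lambda>z. G z (du p v) (du p w)) (u p) (\<xi> p)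
     + Gu p (fderiv \<xi> p v) (du p w) + Gu p (du p v) (fderiv \<xi> p w)"
    by (simp add: var_metric_def[abs_def] var_def fun_eq_iff)
  then show ?thesis
    using christoffel_sym[OF u_dom[OF p], of "\<xi> p" "du p v"] christoffel_sym[OF u_dom[OF p], of "\<xi> p" "du p w"]
    by (simp add: christoffel_metric[OF u_dom[OF p]] nab_def Gu_lin[OF p])
qed

lemma first_variation_metric_Hamiltonian:
  assumes p: "p \<in> U" and X: "smooth_on U X"
  shows "fderiv (var_metric (\<lambda>p. Jc (du p (X p))) v w) (0, p) (1, 0) = - 2 * C p v w (X p)"
proof -
  let ?\<xi> = "\<lambda>p. Jc (du p (X p))"
  have s: "smooth_on U ?\<xi>" by (intro smooth_on_Jc open_U du_smooth X)
  have n: "Gu p (nab v ?\<xi> p) (du p w) = - C p v w (X p)" for v w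
  proof -
    have "fderiv (\<lambda>q. Gu q (?\<xi> q) (du q w)) p v = fderiv (\<lambda>q. 0) p v"
      using fderiv_cong_open(1)[OF open_U p, of "\<lambda>q. Gu q (?\<xi> q) (du q w)" "\<lambda>_. 0"] du_normal by simp
    then show ?thesis
      using nab_metric[OF p s du_smooth0, of w v] Gu_sym[OF p, of "?\<xi> p" "nab v (\<lambda>q. du q w) p"] by (simp add: C_def)
  qed
  show ?thesis
    unfolding first_variation_metric[OF p s] Gu_sym[OF p, of "du p v"] n using C_sym12[OF p, of w v] by simp
qed

text \<open>The Gram determinant of the metric induced by the varied immersion.\<close>

definition var_area :: "(real^2 \<Rightarrow> complex^2) \<Rightarrow> real \<times> (real^2) \<Rightarrow> real" where
  "var_area \<xi> z = var_metric \<xi> e1 e1 z * var_metric \<xi> e2 e2 z - var_metric \<xi> e1 e2 z * var_metric \<xi> e1 e2 z"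

lemma det_gram_var:
  assumes "p \<in> U" "smooth_on U \<xi>" "(t, p) \<in> var_dom \<xi>"
  shows "det (gram (pullback G (var \<xi> t)) p) = var_area \<xi> (t, p)"
proof -
  have "var_metric \<xi> e2 e1 (t, p) = var_metric \<xi> e1 e2 (t, p)"
    using assms unfolding var_metric_def by (intro g_sym) (simp add: var_dom_def)
  then show ?thesis using assms by (simp add: det_2 gram_def pullback_var var_area_def)
qed

text \<open>The derivative of the induced metric is \<open>- 2C(\<cdot>, \<cdot>, X)\<close>, whose trace is \<open>- 4\<beta>(X)\<close>.\<close>

lemma first_variation_area_density:
  assumes p: "p \<in> U" and X: "smooth_on U X"
  shows "fderiv (\<lambda>z. sqrt (var_area (\<lambda>p. Jc (du p (X p))) z)) (0, p) (1, 0) = - 2 * sqrt (gdet p) * \<beta> p (X p)"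
proof -
  let ?\<xi> = "\<lambda>p. Jc (du p (X p))"
  have s: "smooth_on U ?\<xi>" by (intro smooth_on_Jc open_U du_smooth X)
  have D: "(var_metric ?\<xi> v w has_derivative fderiv (var_metric ?\<xi> v w) (0, p)) (at (0, p))" for v w
    by (rule smooth_on_has_derivative[OF var_metric_smooth[OF s] var_dom_0[OF p]])
  have a0: "var_area ?\<xi> (0, p) = gdet p" by (simp add: var_area_def gdet_def var_metric_0)
  have "((\<lambda>z. sqrt (var_area ?\<xi> z)) has_derivative (\<lambda>h. (fderiv (var_metric ?\<xi> e1 e1) (0, p) h * gg p e2 e2
      + gg p e1 e1 * fderiv (var_metric ?\<xi> e2 e2) (0, p) h - 2 * gg p e1 e2 * fderiv (var_metric ?\<xi> e1 e2) (0, p) h)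
       / (2 * sqrt (gdet p)))) (at (0, p))"
    using gdet_pos[OF p] a0 unfolding var_area_def
    by (auto intro!: derivative_eq_intros D simp: var_metric_0 field_simps)
  from fderiv_eqI[OF this] have "fderiv (\<lambda>z. sqrt (var_area ?\<xi> z)) (0, p) (1, 0) =
      ((- 2 * C p e1 e1 (X p)) * gg p e2 e2 + gg p e1 e1 * (- 2 * C p e2 e2 (X p)) - 2 * gg p e1 e2 * (- 2 * C p e1 e2 (X p)))
       / (2 * sqrt (gdet p))"
    by (simp only: first_variation_metric_Hamiltonian[OF p X])
  also have "(- 2 * C p e1 e1 (X p)) * gg p e2 e2 + gg p e1 e1 * (- 2 * C p e2 e2 (X p)) - 2 * gg p e1 e2 * (- 2 * C p e1 e2 (X p))
      = - 2 * (2 * gdet p * \<beta> p (X p))"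
    using gdet_pos[OF p] by (simp add: \<beta>_def)
  also have "- 2 * (2 * gdet p * \<beta> p (X p)) / (2 * sqrt (gdet p)) = - 2 * sqrt (gdet p) * \<beta> p (X p)"
    using gdet_pos[OF p] real_sqrt_mult_self[of "gdet p"] by (simp add: field_simps)
  finally show ?thesis .
qed

text \<open>By compactness of the box there is a positive time up to which the varied map stays in the chart and
  remains an immersion on the box, so that the density is smooth and Leibniz' rule applies.\<close>

lemma first_variation_area:
  assumes X: "smooth_on U X" and S: "cbox a b \<subseteq> U"
  obtains \<delta> where "\<delta> > 0"
    "\<And>t p. \<bar>t\<bar> < \<delta> \<Longrightarrow> p \<in> cbox a b \<Longrightarrow> (t, p) \<in> var_dom (\<lambda>p. Jc (du p (X p)))"
    "\<And>t. \<bar>t\<bar> < \<delta> \<Longrightarrow> (\<lambda>p. sqrt (var_area (\<lambda>p. Jc (du p (X p))) (t, p))) integrable_on cbox a b"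
    "((\<lambda>t. integral (cbox a b) (\<lambda>p. sqrt (var_area (\<lambda>p. Jc (du p (X p))) (t, p)))) has_real_derivative
        integral (cbox a b) (\<lambda>p. - 2 * sqrt (gdet p) * gg p (T p) (X p))) (at 0)"
proof -
  let ?\<xi> = "\<lambda>p. Jc (du p (X p))"
  have s: "smooth_on U ?\<xi>" by (intro smooth_on_Jc open_U du_smooth X)
  define W where "W = {z \<in> var_dom ?\<xi>. var_area ?\<xi> z > 0}"
  have sa: "smooth_on (var_dom ?\<xi>) (var_area ?\<xi>)"
    unfolding var_area_def[abs_def] by (intro smooth_intros var_dom_open var_metric_smooth s)
  have W: "open W"
    using continuous_open_preimage[OF smooth_on_continuous[OF sa] var_dom_open[OF s], of "{0<..}"]
    by (rule back_subst[of "open"]) (auto simp: W_def)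
  have "{0} \<times> cbox a b \<subseteq> W"
    using S gdet_pos by (auto simp: W_def var_dom_0 var_area_def var_metric_0 gdet_def subset_iff)
  from Elementary_Topology.tube_lemma[OF compact_cbox W this]
  obtain X0 where X0: "0 \<in> X0" "open X0" "X0 \<times> cbox a b \<subseteq> W" by blast
  then obtain \<delta> where \<delta>: "\<delta> > 0" "ball 0 \<delta> \<subseteq> X0" using open_contains_ball by blast
  have inW: "(t, p) \<in> W" if "\<bar>t\<bar> < \<delta>" "p \<in> cbox a b" for t p
    using that \<delta>(2) X0(3) by (auto simp: subset_iff)
  have ss: "smooth_on W (\<lambda>z. sqrt (var_area ?\<xi> z))"
    using smooth_on_subset[OF sa] W by (intro smooth_intros) (auto simp: W_def)
  have int: "(\<lambda>p. sqrt (var_area ?\<xi> (t, p))) integrable_on cbox a b" if t: "\<bar>t\<bar> < \<delta>" for t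
    by (rule integrable_continuous, rule continuous_on_compose2[OF smooth_on_continuous[OF ss], of _ "\<lambda>p. (t, p)"])
      (use inW[OF t] in \<open>auto intro!: continuous_intros\<close>)
  have "((\<lambda>t. integral (cbox a b) (\<lambda>p. sqrt (var_area ?\<xi> (t, p)))) has_field_derivative
        integral (cbox a b) (\<lambda>p. fderiv (\<lambda>z. sqrt (var_area ?\<xi> z)) (0, p) (1, 0))) (at 0 within {-\<delta><..<\<delta>})"
  proof (rule leibniz_rule_field_derivative)
    fix t p assume t: "t \<in> {-\<delta><..<\<delta>}" and p: "p \<in> cbox a b"
    then have d: "(\<lambda>z. sqrt (var_area ?\<xi> z)) differentiable (at (t, p))"
      by (intro smooth_on_differentiable[OF ss] inW) auto
    have "(\<lambda>r. fderiv (\<lambda>z. sqrt (var_area ?\<xi> z)) (t, p) (r, 0)) = (*) (fderiv (\<lambda>z. sqrt (var_area ?\<xi> z)) (t, p) (1, 0))"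
    proof
      fix r :: real
      show "fderiv (\<lambda>z. sqrt (var_area ?\<xi> z)) (t, p) (r, 0) = fderiv (\<lambda>z. sqrt (var_area ?\<xi> z)) (t, p) (1, 0) * r"
        using linear_scale[OF linear_frechet_derivative[OF d], of r "(1, 0)"] by simp
    qed
    with fderiv_fst_slice[OF d] show "((\<lambda>t. sqrt (var_area ?\<xi> (t, p))) has_field_derivative
        fderiv (\<lambda>z. sqrt (var_area ?\<xi> z)) (t, p) (1, 0)) (at t within {-\<delta><..<\<delta>})"
      unfolding has_field_derivative_def by (simp add: has_derivative_at_withinI)
  next
    show "(\<lambda>p. sqrt (var_area ?\<xi> (t, p))) integrable_on cbox a b" if "t \<in> {-\<delta><..<\<delta>}" for t
      using that by (intro int) auto
    show "continuous_on ({-\<delta><..<\<delta>} \<times> cbox a b) (\<lambda>(t, p). fderiv (\<lambda>z. sqrt (var_area ?\<xi> z)) (t, p) (1, 0))"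
      unfolding split_beta prod.collapse
      by (rule continuous_on_subset[OF smooth_on_continuous[OF smooth_on_fderiv[OF ss]]]) (use inW in auto)
  qed (use \<delta> in auto)
  then have "((\<lambda>t. integral (cbox a b) (\<lambda>p. sqrt (var_area ?\<xi> (t, p)))) has_field_derivative
        integral (cbox a b) (\<lambda>p. fderiv (\<lambda>z. sqrt (var_area ?\<xi> z)) (0, p) (1, 0))) (at 0)"
    using \<delta> by (subst (asm) at_within_open) auto
  moreover have "integral (cbox a b) (\<lambda>p. fderiv (\<lambda>z. sqrt (var_area ?\<xi> z)) (0, p) (1, 0)) =
     integral (cbox a b) (\<lambda>p. - 2 * sqrt (gdet p) * gg p (T p) (X p))"
    using S by (intro integral_cong) (simp add: first_variation_area_density[OF _ X] T_\<beta> subset_iff)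
  ultimately show thesis
    using that[of \<delta>] \<delta>(1) inW int by (auto simp: W_def)
qed

end

section \<open>Localized Hamiltonian variations\<close>

context riemannian_chart
begin

lemma gradient_eq:
  assumes "p \<in> \<Omega>" "f differentiable (at p)"
  shows "g p (gradient g f p) v = fderiv f p v"
  unfolding gradient_def
  using theI'[OF pos_def_riesz[OF g_pos_def[OF assms(1)] linear_frechet_derivative[OF assms(2)]]] by blast

lemma gradient_unique:
  assumes "p \<in> \<Omega>" "\<And>v. g p w v = fderiv f p v"
  shows "gradient g f p = w"
  unfolding gradient_def
  by (rule the_equality) (use assms pos_def_eqI[OF g_pos_def[OF assms(1)]] in auto)

lemma gradient_smooth:
  assumes "smooth_on \<Omega> f"
  shows "smooth_on \<Omega> (gradient g f)"
  by (rule pos_def_solution_smooth[OF open_dom g_pos_def g_smooth smooth_on_fderiv[OF assms]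
      gradient_eq[OF _ smooth_on_differentiable[OF assms]]])

end

lemma
  assumes "is_chart a"
  shows chart_dom_open: "open (chart_dom a)" and chart_img_open: "open (chart_img a)"
    and chart_map_continuous: "continuous_on (chart_dom a) (chart_map a)"
    and chart_inv_continuous: "continuous_on (chart_img a) (chart_inv a)"
    and chart_inv_map: "x \<in> chart_dom a \<Longrightarrow> chart_inv a (chart_map a x) = x"
    and chart_map_inv: "q \<in> chart_img a \<Longrightarrow> chart_map a (chart_inv a q) = q"
    and chart_inv_dom: "q \<in> chart_img a \<Longrightarrow> chart_inv a q \<in> chart_dom a"
  using assms unfolding is_chart_def homeomorphism_def
  by (auto simp: inv_into_f_f f_inv_into_f inv_into_into)

lemma chart_preimage_open:
  assumes "is_chart a" "open Q"
  shows "open {x \<in> chart_dom a. chart_map a x \<in> Q}"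
  using continuous_open_preimage[OF chart_map_continuous[OF assms(1)] chart_dom_open[OF assms(1)] assms(2)]
  by (rule back_subst[of "open"]) auto

lemma chart_image_open:
  assumes a: "is_chart a" and "open V" "V \<subseteq> chart_dom a"
  shows "open (chart_map a ` V)"
proof -
  have "open (chart_img a \<inter> chart_inv a -` V)"
    by (rule continuous_open_preimage[OF chart_inv_continuous[OF a] chart_img_open[OF a] assms(2)])
  also have "chart_img a \<inter> chart_inv a -` V = chart_map a ` V"
    using assms chart_inv_map[OF a] by (auto simp: image_iff subset_iff)
  finally show ?thesis .
qed

lemma loc_dom_open:
  assumes "is_chart a" "is_chart b" "continuous_on UNIV \<psi>"
  shows "open (loc_dom a b \<psi>)"
proof -
  have "open {x \<in> chart_dom a. chart_map a x \<in> \<psi> -` chart_img b}"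
    by (rule chart_preimage_open[OF assms(1)])
      (use continuous_on_open_vimage[of UNIV \<psi>] assms(3) chart_img_open[OF assms(2)] in auto)
  then show ?thesis by (simp add: loc_dom_def)
qed

locale lagrangian_surface =
  fixes \<epsilon> :: real
    and A :: "(real^2, 'm::{t2_space,second_countable_topology}) chart set"
    and B :: "(complex^2, 'n::{t2_space,second_countable_topology}) chart set"
    and G :: "(complex^2, 'n) chart \<Rightarrow> (complex^2) metric"
    and \<phi> :: "'m \<Rightarrow> 'n"
  assumes space_form: "complex_space_form (4 * \<epsilon>) B G"
    and atlas: "smooth_atlas A" and immersion: "lagrangian_immersion A B G \<phi>"
begin

lemma kaehler: "kaehler_manifold B G" "complex_atlas B" "riemannian_manifold B G" "smooth_atlas B"
  using space_form unfolding complex_space_form_def kaehler_manifold_def complex_atlas_def by auto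

lemma charts: "a \<in> A \<Longrightarrow> is_chart a" "b \<in> B \<Longrightarrow> is_chart b"
  using atlas kaehler(4) unfolding smooth_atlas_def by auto

lemma transition_smooth:
  "a \<in> A \<Longrightarrow> a' \<in> A \<Longrightarrow> smooth_on (loc_dom a a' id) (loc_rep a a' id)"
  "b \<in> B \<Longrightarrow> b' \<in> B \<Longrightarrow> smooth_on (loc_dom b b' id) (loc_rep b b' id)"
  using atlas kaehler(4) unfolding smooth_atlas_def by auto

lemma transition_open:
  "a \<in> A \<Longrightarrow> a' \<in> A \<Longrightarrow> open (loc_dom a a' id)" "b \<in> B \<Longrightarrow> b' \<in> B \<Longrightarrow> open (loc_dom b b' id)"
  using charts by (auto intro: loc_dom_open continuous_on_id)

lemma \<phi>_smooth: "smooth_map A B \<phi>" and \<phi>_continuous: "continuous_on UNIV \<phi>"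
  using immersion unfolding lagrangian_immersion_def smooth_map_def by auto

lemma lagrangian_chart:
  assumes a: "a \<in> A" and b: "b \<in> B"
  shows "lagrangian_chart (chart_dom b) (G b) \<epsilon> (loc_dom a b \<phi>) (loc_rep a b \<phi>)"
proof
  show "open (chart_dom b)" by (rule chart_dom_open[OF charts(2)[OF b]])
  show "riemannian_metric_on (chart_dom b) (G b)"
    using kaehler(3) b unfolding riemannian_manifold_def by auto
  fix z v w assume z: "z \<in> chart_dom b"
  show "G b z (Jc v) (Jc w) = G b z v w" "christoffel (G b) z v (Jc w) = Jc (christoffel (G b) z v w)"
    using kaehler(1) b z unfolding kaehler_manifold_def by auto
  show "sectional_curvature (G b) z v (Jc v) = 4 * \<epsilon>" if "v \<noteq> 0"
    using space_form b z that unfolding complex_space_form_def by auto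
next
  show "open (loc_dom a b \<phi>)" by (rule loc_dom_open[OF charts(1)[OF a] charts(2)[OF b] \<phi>_continuous])
  show "smooth_on (loc_dom a b \<phi>) (loc_rep a b \<phi>)"
    using \<phi>_smooth a b unfolding smooth_map_def by auto
  fix p v w assume p: "p \<in> loc_dom a b \<phi>"
  then show "loc_rep a b \<phi> p \<in> chart_dom b"
    using chart_inv_dom[OF charts(2)[OF b]] by (auto simp: loc_dom_def loc_rep_def)
  show "inj (fderiv (loc_rep a b \<phi>) p)"
    "G b (loc_rep a b \<phi> p) (fderiv (loc_rep a b \<phi>) p v) (Jc (fderiv (loc_rep a b \<phi>) p w)) = 0"
    using immersion a b p unfolding lagrangian_immersion_def by auto
qed

end

text \<open>The datum of a localized variation: a function \<open>\<psi>\<close> on the coordinate domain, supported in a compact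
  subset \<open>N\<close> of the domain of the local representation of \<open>\<phi>\<close>.\<close>

locale chart_variation = lagrangian_surface \<epsilon> A B G \<phi>
  for \<epsilon> :: real and A :: "(real^2, 'm::{t2_space,second_countable_topology}) chart set"
    and B :: "(complex^2, 'n::{t2_space,second_countable_topology}) chart set" and G \<phi> +
  fixes a b and N :: "(real^2) set" and \<psi> :: "real^2 \<Rightarrow> real"
  assumes a: "a \<in> A" and b: "b \<in> B" and N: "compact N" "N \<subseteq> loc_dom a b \<phi>"
    and \<psi>: "smooth_on UNIV \<psi>" and \<psi>_zero: "p \<notin> N \<Longrightarrow> \<psi> p = 0"
begin

abbreviation U where "U \<equiv> loc_dom a b \<phi>"
abbreviation u where "u \<equiv> loc_rep a b \<phi>"

sublocale L: lagrangian_chart "chart_dom b" "G b" \<epsilon> U u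
  by (rule lagrangian_chart[OF a b])

lemmas ca = charts(1)[OF a]
lemmas cb = charts(2)[OF b]

definition X where "X = gradient L.gg \<psi>"
definition \<xi> where "\<xi> p = Jc (L.du p (X p))"
text \<open>The function \<open>\<psi>\<close>, transported to the surface and extended by 0.\<close>

definition potential where "potential q = (if q \<in> chart_map a ` U then \<psi> (chart_inv a q) else 0)"
text \<open>The surface moves along straight lines of the ambient chart and stays fixed outside of the support of
  \<open>\<psi>\<close>, since \<open>\<xi>\<close> vanishes there (\<open>F_off\<close>).\<close>

definition F where "F t q = (if q \<in> chart_map a ` U then chart_map b (L.var \<xi> t (chart_inv a q)) else \<phi> q)"

lemma \<psi>_smooth: "smooth_on S \<psi>"
  using smooth_on_subset[OF \<psi>] by blast

lemma X_smooth: "smooth_on U X"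
  unfolding X_def by (rule L.I.gradient_smooth[OF \<psi>_smooth])

lemma \<xi>_smooth: "smooth_on U \<xi>"
  unfolding \<xi>_def[abs_def] by (intro smooth_on_Jc L.open_U L.du_smooth X_smooth)

lemma X_eq: "p \<in> U \<Longrightarrow> L.gg p (X p) v = fderiv \<psi> p v"
  unfolding X_def by (rule L.I.gradient_eq[OF _ smooth_on_differentiable[OF \<psi>]]) auto

lemma \<xi>_zero: assumes "p \<in> U" "p \<notin> N" shows "\<xi> p = 0"
proof -
  have "fderiv \<psi> p = (\<lambda>_. 0)"
    by (rule fderiv_zero_off_support[OF compact_imp_closed[OF N(1)] \<psi>_zero assms(2)])
  then have "X p = 0"
    unfolding X_def by (intro L.I.gradient_unique assms) (simp add: L.I.g_lin assms)
  then show ?thesis by (simp add: \<xi>_def L.du_lin assms Jc_simps)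
qed

lemma U_dom: "U \<subseteq> chart_dom a"
  by (auto simp: loc_dom_def)

abbreviation UM where "UM \<equiv> chart_map a ` U"
abbreviation NM where "NM \<equiv> chart_map a ` N"

lemma UM_open: "open UM"
  by (rule chart_image_open[OF ca L.open_U U_dom])

lemma NM_compact: "compact NM"
  by (rule compact_continuous_image[OF continuous_on_subset[OF chart_map_continuous[OF ca]] N(1)])
    (use N(2) U_dom in auto)

lemma NM_closed: "closed NM" and NM_UM: "NM \<subseteq> UM"
proof -
  show "closed NM" by (rule compact_imp_closed[OF NM_compact])
  show "NM \<subseteq> UM" using N(2) by auto
qed

lemma UM_inv: "q \<in> UM \<Longrightarrow> chart_inv a q \<in> U" "q \<in> UM \<Longrightarrow> chart_map a (chart_inv a q) = q"
  "p \<in> U \<Longrightarrow> chart_inv a (chart_map a p) = p"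
  using chart_inv_map[OF ca] U_dom by auto

lemma u_chart: "p \<in> U \<Longrightarrow> chart_map b (u p) = \<phi> (chart_map a p)"
  using chart_map_inv[OF cb] by (auto simp: loc_dom_def loc_rep_def)

lemma F_off: "q \<notin> NM \<Longrightarrow> F t q = \<phi> q"
proof (cases "q \<in> UM")
  case True
  assume "q \<notin> NM"
  then have "chart_inv a q \<notin> N" using UM_inv(2)[OF True] by (metis imageI)
  then show ?thesis
    using True UM_inv u_chart[OF UM_inv(1)[OF True]] \<xi>_zero[OF UM_inv(1)[OF True]] by (simp add: F_def L.var_def)
qed (simp add: F_def)

lemma potential_off: "q \<notin> NM \<Longrightarrow> potential q = 0"
proof (cases "q \<in> UM")
  case True
  assume "q \<notin> NM"
  then have "chart_inv a q \<notin> N" using UM_inv(2)[OF True] by (metis imageI)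
  then show ?thesis using \<psi>_zero by (simp add: potential_def)
qed (simp add: potential_def)

lemma F_0: "F 0 = \<phi>"
proof
  fix q show "F 0 q = \<phi> q"
    using UM_inv u_chart[OF UM_inv(1)[of q]] by (simp add: F_def L.var_def)
qed

lemma transition_U:
  assumes "a' \<in> A" "p \<in> chart_dom a'" "chart_map a' p \<in> UM"
  shows "p \<in> loc_dom a' a id" "loc_rep a' a id p \<in> U" "chart_map a (loc_rep a' a id p) = chart_map a' p"
    "loc_rep a' a id p = chart_inv a (chart_map a' p)"
proof -
  show r: "loc_rep a' a id p = chart_inv a (chart_map a' p)" by (simp add: loc_rep_def)
  show "loc_rep a' a id p \<in> U" unfolding r by (rule UM_inv(1)[OF assms(3)])
  show "chart_map a (loc_rep a' a id p) = chart_map a' p" unfolding r by (rule UM_inv(2)[OF assms(3)])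
  have "UM \<subseteq> chart_img a" using U_dom by (rule image_mono)
  then show "p \<in> loc_dom a' a id" using assms(2,3) by (auto simp: loc_dom_def)
qed

lemma potential_smooth: "smooth_fun A potential"
  unfolding smooth_fun_def
proof
  fix a' assume a': "a' \<in> A"
  note ca' = charts(1)[OF a']
  show "smooth_on (chart_dom a') (potential \<circ> chart_map a')"
  proof (rule smooth_on_local)
    fix x assume x: "x \<in> chart_dom a'"
    let ?O1 = "{x \<in> chart_dom a'. chart_map a' x \<in> UM}" and ?O2 = "{x \<in> chart_dom a'. chart_map a' x \<in> - NM}"
    have o1: "open ?O1" by (rule chart_preimage_open[OF ca' UM_open])
    have o2: "open ?O2" by (rule chart_preimage_open[OF ca']) (use NM_closed in auto)
    have "smooth_on ?O1 (\<lambda>x. \<psi> (loc_rep a' a id x))"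
      by (rule smooth_on_compose[OF o1 open_UNIV _ \<psi> smooth_on_subset[OF transition_smooth(1)[OF a' a]]])
        (use transition_U(1)[OF a'] in auto)
    then have "smooth_on ?O1 (potential \<circ> chart_map a')"
      using smooth_on_cong[OF o1, of "potential \<circ> chart_map a'" "\<lambda>x. \<psi> (loc_rep a' a id x)"] transition_U(4)[OF a']
      by (auto simp: potential_def)
    moreover have "smooth_on ?O2 (potential \<circ> chart_map a')"
      using smooth_on_cong[OF o2, of "potential \<circ> chart_map a'" "\<lambda>_. 0"] potential_off by (auto simp: smooth_on_const)
    moreover have "x \<in> ?O1 \<or> x \<in> ?O2" using x NM_UM by auto
    ultimately show "\<exists>T. open T \<and> x \<in> T \<and> smooth_on T (potential \<circ> chart_map a')"
      using exI[of "\<lambda>T. open T \<and> x \<in> T \<and> smooth_on T (potential \<circ> chart_map a')" ?O1]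
        exI[of "\<lambda>T. open T \<and> x \<in> T \<and> smooth_on T (potential \<circ> chart_map a')" ?O2] o1 o2 by argo
  qed
qed

lemma potential_support: "compact (closure {q. potential q \<noteq> 0})"
proof -
  have "{q. potential q \<noteq> 0} \<subseteq> NM" using potential_off by auto
  then have "closure {q. potential q \<noteq> 0} \<subseteq> NM" using NM_closed by (simp add: closure_minimal)
  then show ?thesis
    using compact_Int_closed[OF NM_compact closed_closure, of "{q. potential q \<noteq> 0}"] by (simp add: Int_absorb1)
qed

context
  fixes \<delta> :: real
  assumes \<delta>: "\<delta> > 0" and var_dom: "\<And>t p. \<bar>t\<bar> < \<delta> \<Longrightarrow> p \<in> N \<Longrightarrow> L.var \<xi> t p \<in> chart_dom b"
begin

lemma var_in_dom: "\<bar>t\<bar> < \<delta> \<Longrightarrow> p \<in> U \<Longrightarrow> L.var \<xi> t p \<in> chart_dom b"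
  using var_dom \<xi>_zero[of p] L.u_dom[of p] by (cases "p \<in> N") (auto simp: L.var_def)

lemma F_continuous: "continuous_on ({-\<delta><..<\<delta>} \<times> UNIV) (\<lambda>(t, q). F t q)"
proof -
  let ?I = "{-\<delta><..<\<delta>}"
  have "continuous_on (?I \<times> UM) (\<lambda>z. chart_map b (L.var \<xi> (fst z) (chart_inv a (snd z))))"
  proof (rule continuous_on_compose2[OF chart_map_continuous[OF cb]])
    have i: "continuous_on (?I \<times> UM) (\<lambda>z. chart_inv a (snd z))"
      by (rule continuous_on_compose2[OF chart_inv_continuous[OF ca]])
        (use U_dom in \<open>auto intro!: continuous_intros\<close>)
    show "continuous_on (?I \<times> UM) (\<lambda>z. L.var \<xi> (fst z) (chart_inv a (snd z)))"
      unfolding L.var_def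
      by (intro continuous_on_add continuous_on_scaleR continuous_on_fst continuous_on_id
        continuous_on_compose2[OF smooth_on_continuous[OF L.u_smooth] i]
        continuous_on_compose2[OF smooth_on_continuous[OF \<xi>_smooth] i]) (use UM_inv in auto)
    show "(\<lambda>z. L.var \<xi> (fst z) (chart_inv a (snd z))) ` (?I \<times> UM) \<subseteq> chart_dom b"
      using var_in_dom UM_inv by fastforce
  qed
  then have 1: "continuous_on (?I \<times> UM) (\<lambda>(t, q). F t q)"
    by (rule continuous_on_eq) (auto simp: F_def)
  have "continuous_on (?I \<times> (- NM)) (\<lambda>z. \<phi> (snd z))"
    by (intro continuous_on_compose2[OF \<phi>_continuous] continuous_intros) auto
  then have 2: "continuous_on (?I \<times> (- NM)) (\<lambda>(t, q). F t q)"
    by (rule continuous_on_eq) (auto simp: F_off)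
  have "continuous_on ((?I \<times> UM) \<union> (?I \<times> (- NM))) (\<lambda>(t, q). F t q)"
    by (rule continuous_on_open_Un[OF _ _ 1 2]) (use UM_open NM_closed in \<open>auto intro!: open_Times\<close>)
  moreover have "(?I \<times> UM) \<union> (?I \<times> (- NM)) = ?I \<times> UNIV" using NM_UM by auto
  ultimately show ?thesis by simp
qed

text \<open>Near a point of the support the local representation in another pair of charts is composed of the
  straight-line variation and transition maps; away from the support it does not depend on \<open>t\<close>.\<close>

lemma F_smooth:
  assumes a': "a' \<in> A" and b': "b' \<in> B"
  shows "smooth_on {(t, p). \<bar>t\<bar> < \<delta> \<and> p \<in> loc_dom a' b' (F t)} (\<lambda>(t, p). loc_rep a' b' (F t) p)"
    (is "smooth_on ?D ?f")
proof -
  note ca' = charts(1)[OF a'] and cb' = charts(2)[OF b']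
  let ?I = "{-\<delta><..<\<delta>}"
  have oI: "open (?I \<times> chart_dom a')" by (intro open_Times chart_dom_open[OF ca']) auto
  have "continuous_on (?I \<times> chart_dom a') (\<lambda>z. case (fst z, chart_map a' (snd z)) of (t, q) \<Rightarrow> F t q)"
    by (rule continuous_on_compose2[OF F_continuous])
      (auto intro!: continuous_intros continuous_on_compose2[OF chart_map_continuous[OF ca']])
  from continuous_open_preimage[OF this oI chart_img_open[OF cb']] have D: "open ?D"
    by (rule back_subst[of "open"]) (auto simp: loc_dom_def)
  define O1 where "O1 = ?D \<inter> UNIV \<times> {p \<in> chart_dom a'. chart_map a' p \<in> UM}"
  define O2 where "O2 = ?D \<inter> UNIV \<times> {p \<in> chart_dom a'. chart_map a' p \<in> - NM}"
  have o1: "open O1" unfolding O1_def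
    by (intro open_Int D open_Times open_UNIV chart_preimage_open[OF ca' UM_open])
  have o2: "open O2" unfolding O2_def
    by (intro open_Int D open_Times open_UNIV chart_preimage_open[OF ca'] open_Compl NM_closed)
  let ?\<tau> = "loc_rep a' a id"
  have t: "snd z \<in> loc_dom a' a id" "?\<tau> (snd z) \<in> U" "?\<tau> (snd z) = chart_inv a (chart_map a' (snd z))"
      "\<bar>fst z\<bar> < \<delta>" "F (fst z) (chart_map a' (snd z)) \<in> chart_img b'" "chart_map a' (snd z) \<in> UM" if "z \<in> O1" for z
    using that transition_U[OF a', of "snd z"] by (auto simp: O1_def loc_dom_def)
  have s\<tau>: "smooth_on O1 (\<lambda>z. ?\<tau> (snd z))"
    by (rule smooth_on_compose[OF o1 transition_open(1)[OF a' a] _ transition_smooth(1)[OF a' a]])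
      (use t o1 in \<open>auto intro!: smooth_intros\<close>)
  have "smooth_on O1 (\<lambda>z. u (?\<tau> (snd z)))" "smooth_on O1 (\<lambda>z. \<xi> (?\<tau> (snd z)))"
    by (rule smooth_on_compose[OF o1 L.open_U _ L.u_smooth s\<tau>] smooth_on_compose[OF o1 L.open_U _ \<xi>_smooth s\<tau>];
      use t in auto)+
  then have sv: "smooth_on O1 (\<lambda>z. L.var \<xi> (fst z) (?\<tau> (snd z)))"
    unfolding L.var_def by (intro smooth_on_add smooth_on_scaleR smooth_on_fst smooth_on_ident o1)
  have Ft: "F (fst z) (chart_map a' (snd z)) = chart_map b (L.var \<xi> (fst z) (?\<tau> (snd z)))" if "z \<in> O1" for z
    using t[OF that] by (simp add: F_def)
  have im: "(\<lambda>z. L.var \<xi> (fst z) (?\<tau> (snd z))) ` O1 \<subseteq> loc_dom b b' id"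
  proof
    fix y assume "y \<in> (\<lambda>z. L.var \<xi> (fst z) (?\<tau> (snd z))) ` O1"
    then obtain z where z: "z \<in> O1" "y = L.var \<xi> (fst z) (?\<tau> (snd z))" by auto
    then show "y \<in> loc_dom b b' id"
      using t(5)[OF z(1)] Ft[OF z(1)] var_in_dom[OF t(4,2)[OF z(1)]] by (simp add: loc_dom_def)
  qed
  have "smooth_on O1 (\<lambda>z. loc_rep b b' id (L.var \<xi> (fst z) (?\<tau> (snd z))))"
    by (rule smooth_on_compose[OF o1 transition_open(2)[OF b b'] im transition_smooth(2)[OF b b'] sv])
  moreover have "?f z = loc_rep b b' id (L.var \<xi> (fst z) (?\<tau> (snd z)))" if "z \<in> O1" for z
    using Ft[OF that] by (simp add: split_beta loc_rep_def)
  ultimately have s1: "smooth_on O1 ?f" by (subst smooth_on_cong[OF o1])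
  have off: "F (fst z) (chart_map a' (snd z)) = \<phi> (chart_map a' (snd z))" if "z \<in> O2" for z
    using that F_off by (auto simp: O2_def)
  have sub: "snd ` O2 \<subseteq> loc_dom a' b' \<phi>"
    using off by (fastforce simp: O2_def loc_dom_def)
  have "smooth_on O2 (\<lambda>z. loc_rep a' b' \<phi> (snd z))"
    by (rule smooth_on_compose[OF o2 loc_dom_open[OF ca' cb' \<phi>_continuous] sub])
      (use \<phi>_smooth a' b' o2 in \<open>auto simp: smooth_map_def intro!: smooth_intros\<close>)
  moreover have "?f z = loc_rep a' b' \<phi> (snd z)" if "z \<in> O2" for z
    using off[OF that] by (simp add: split_beta loc_rep_def)
  ultimately have s2: "smooth_on O2 ?f" by (subst smooth_on_cong[OF o2])
  show ?thesis
  proof (rule smooth_on_local)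
    fix z assume "z \<in> ?D"
    then have "z \<in> O1 \<or> z \<in> O2" using NM_UM by (auto simp: O1_def O2_def loc_dom_def)
    then show "\<exists>T. open T \<and> z \<in> T \<and> smooth_on T ?f"
    proof
      assume "z \<in> O1" then show ?thesis using o1 s1 by (intro exI[of _ O1]) simp
    next
      assume "z \<in> O2" then show ?thesis using o2 s2 by (intro exI[of _ O2]) simp
    qed
  qed
qed

text \<open>The field \<open>J\<nabla>f\<close> is expressed in the charts \<open>a, b\<close>. In other charts it has the same form, because the
  transition maps of the ambient manifold are holomorphic isometries.\<close>

lemma variation_field:
  assumes a': "a' \<in> A" and b': "b' \<in> B" and p: "p \<in> loc_dom a' b' \<phi>"
  shows "((\<lambda>t. loc_rep a' b' (F t) p) has_vector_derivative
     Jc (fderiv (loc_rep a' b' \<phi>) p (gradient (pullback (G b') (loc_rep a' b' \<phi>)) (potential \<circ> chart_map a') p))) (at 0)"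
proof -
  note ca' = charts(1)[OF a'] and cb' = charts(2)[OF b']
  interpret L': lagrangian_chart "chart_dom b'" "G b'" \<epsilon> "loc_dom a' b' \<phi>" "loc_rep a' b' \<phi>"
    by (rule lagrangian_chart[OF a' b'])
  let ?q = "chart_map a' p"
  have pd: "p \<in> chart_dom a'" and qb': "\<phi> ?q \<in> chart_img b'" using p by (auto simp: loc_dom_def)
  show ?thesis
  proof (cases "?q \<in> NM")
    case False
    let ?O2 = "{x \<in> chart_dom a'. chart_map a' x \<in> - NM}"
    have o2: "open ?O2" by (rule chart_preimage_open[OF ca']) (use NM_closed in auto)
    have "fderiv (potential \<circ> chart_map a') p = fderiv (\<lambda>_. 0) p"
      by (rule fderiv_cong_open(1)[OF o2]) (use pd False potential_off in auto)
    then have "gradient L'.gg (potential \<circ> chart_map a') p = 0"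
      by (intro L'.I.gradient_unique p) (simp add: L'.I.g_lin p)
    moreover have "(\<lambda>t. loc_rep a' b' (F t) p) = (\<lambda>t. loc_rep a' b' \<phi> p)"
      using F_off[OF False] by (auto simp: loc_rep_def)
    ultimately show ?thesis by (simp add: L'.du_lin p Jc_simps)
  next
    case True
    then have q: "?q \<in> UM" using NM_UM by auto
    define \<tau> where "\<tau> = loc_rep a' a id"
    define \<sigma> where "\<sigma> = loc_rep a a' id"
    define \<theta> where "\<theta> = loc_rep b b' id"
    define x where "x = \<tau> p"
    have xU: "x \<in> U" and xq: "chart_map a x = ?q" and pl: "p \<in> loc_dom a' a id"
      using transition_U[OF a' pd q] by (simp_all add: x_def \<tau>_def)
    have xs: "x \<in> loc_dom a a' id" using xU xq pd U_dom by (auto simp: loc_dom_def)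
    have \<sigma>x: "\<sigma> x = p" using xq chart_inv_map[OF ca' pd] by (simp add: \<sigma>_def loc_rep_def)
    have ux: "chart_map b (u x) = \<phi> ?q" using u_chart[OF xU] xq by simp
    have uxb: "u x \<in> loc_dom b b' id" using L.u_dom[OF xU] ux qb' by (simp add: loc_dom_def)
    have d\<tau>: "\<tau> differentiable (at p)" unfolding \<tau>_def
      by (rule smooth_on_differentiable[OF transition_smooth(1)[OF a' a] pl])
    have d\<sigma>: "\<sigma> differentiable (at x)" unfolding \<sigma>_def
      by (rule smooth_on_differentiable[OF transition_smooth(1)[OF a a'] xs])
    have d\<theta>: "\<theta> differentiable (at (u x))" unfolding \<theta>_def
      by (rule smooth_on_differentiable[OF transition_smooth(2)[OF b b'] uxb])
    have du: "u differentiable (at x)" by (rule smooth_on_differentiable[OF L.u_smooth xU])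
    have d\<psi>: "\<psi> differentiable (at x)" by (rule smooth_on_differentiable[OF \<psi>]) simp
    let ?O1 = "{p \<in> chart_dom a'. chart_map a' p \<in> UM}"
    have o1: "open ?O1" by (rule chart_preimage_open[OF ca' UM_open])
    have p1: "p \<in> ?O1" using pd q by simp
    have "loc_rep a' b' \<phi> y = \<theta> (u (\<tau> y))" if "y \<in> ?O1" for y
      using that transition_U[OF a', of y] u_chart[of "\<tau> y"] by (simp add: loc_rep_def[of _ _ \<phi> y] \<theta>_def \<tau>_def) (simp add: loc_rep_def)
    then have "fderiv (loc_rep a' b' \<phi>) p = fderiv (\<lambda>y. \<theta> (u (\<tau> y))) p"
      by (rule fderiv_cong_open(1)[OF o1 p1])
    moreover have "((\<lambda>y. \<theta> (u (\<tau> y))) has_derivative (\<lambda>v. fderiv \<theta> (u x) (L.du x (fderiv \<tau> p v)))) (at p)"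
      using has_derivative_compose[OF has_derivative_compose[OF fderiv_works[OF d\<tau>] fderiv_works[OF du[unfolded x_def]]]
        fderiv_works[OF d\<theta>[unfolded x_def]]] by (simp add: x_def)
    ultimately have du': "L'.du p v = fderiv \<theta> (u x) (L.du x (fderiv \<tau> p v))" for v
      using fderiv_eqI by metis
    have "(potential \<circ> chart_map a') y = \<psi> (\<tau> y)" if "y \<in> ?O1" for y
      using that transition_U(4)[OF a', of y] by (simp add: potential_def \<tau>_def)
    then have "fderiv (potential \<circ> chart_map a') p = fderiv (\<lambda>y. \<psi> (\<tau> y)) p"
      by (rule fderiv_cong_open(1)[OF o1 p1])
    then have df: "fderiv (potential \<circ> chart_map a') p v = fderiv \<psi> x (fderiv \<tau> p v)" for v
      using fderiv_compose[OF d\<tau>, of \<psi> v] d\<psi> by (simp add: x_def)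
    have \<tau>\<sigma>: "fderiv \<tau> p (fderiv \<sigma> x w) = w" for w
    proof -
      have "\<tau> (\<sigma> y) = y" if "y \<in> loc_dom a a' id" for y
        using that chart_inv_map[OF ca] chart_map_inv[OF ca'] by (auto simp: \<tau>_def \<sigma>_def loc_rep_def loc_dom_def)
      then have "fderiv (\<lambda>y. \<tau> (\<sigma> y)) x = fderiv (\<lambda>y. y) x"
        by (rule fderiv_cong_open(1)[OF transition_open(1)[OF a a'] xs])
      then show ?thesis using fderiv_compose[OF d\<sigma>, of \<tau> w] d\<tau> \<sigma>x by simp
    qed
    have iso: "G b' (loc_rep a' b' \<phi> p) (fderiv \<theta> (u x) v) (fderiv \<theta> (u x) w) = G b (u x) v w" for v w
    proof -
      have "loc_rep a' b' \<phi> p = \<theta> (u x)" using ux by (simp add: loc_rep_def[of _ _ \<phi>] \<theta>_def) (simp add: loc_rep_def)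
      then show ?thesis using kaehler(3) b b' uxb unfolding riemannian_manifold_def \<theta>_def by auto
    qed
    have hol: "fderiv \<theta> (u x) (Jc v) = Jc (fderiv \<theta> (u x) v)" for v
      using kaehler(2) b b' uxb unfolding complex_atlas_def \<theta>_def by auto
    have "gradient L'.gg (potential \<circ> chart_map a') p = fderiv \<sigma> x (X x)"
    proof (rule L'.I.gradient_unique[OF p])
      fix v
      have "L'.gg p (fderiv \<sigma> x (X x)) v = L.gg x (X x) (fderiv \<tau> p v)"
        by (simp add: L'.pullback_eq L.pullback_eq du' iso \<tau>\<sigma>)
      then show "L'.gg p (fderiv \<sigma> x (X x)) v = fderiv (potential \<circ> chart_map a') p v"
        by (simp add: X_eq[OF xU] df)
    qed
    then have R: "Jc (L'.du p (gradient L'.gg (potential \<circ> chart_map a') p)) = fderiv \<theta> (u x) (\<xi> x)"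
      by (simp add: du' \<tau>\<sigma> hol \<xi>_def)
    have "(\<lambda>t. loc_rep a' b' (F t) p) = (\<lambda>t. \<theta> (L.var \<xi> t x))"
      using q transition_U(4)[OF a' pd q] by (auto simp: loc_rep_def[of a' b'] F_def \<theta>_def x_def \<tau>_def) (simp_all add: loc_rep_def)
    moreover have "((\<lambda>t. \<theta> (L.var \<xi> t x)) has_derivative (\<lambda>r. fderiv \<theta> (u x) (r *\<^sub>R \<xi> x))) (at 0)"
    proof -
      have "((\<lambda>t. L.var \<xi> t x) has_derivative (\<lambda>r. r *\<^sub>R \<xi> x)) (at 0)"
        unfolding L.var_def by (auto intro!: derivative_eq_intros)
      moreover have "\<theta> differentiable (at (L.var \<xi> 0 x))" using d\<theta> by (simp add: L.var_def)
      ultimately have "((\<lambda>t. \<theta> (L.var \<xi> t x)) has_derivative (\<lambda>r. fderiv \<theta> (L.var \<xi> 0 x) (r *\<^sub>R \<xi> x))) (at 0)"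
        by (rule has_derivative_compose[OF _ fderiv_works])
      then show ?thesis by (simp add: L.var_def)
    qed
    ultimately show ?thesis
      unfolding R has_vector_derivative_def
      using linear_scale[OF linear_frechet_derivative[OF d\<theta>]] by simp
  qed
qed

lemma F_variation:
  assumes "compact K" "NM \<subseteq> K"
  shows "hamiltonian_variation A B G \<phi> potential \<delta> K F"
  unfolding hamiltonian_variation_def
proof (intro conjI allI ballI impI)
  show "0 < \<delta>" "compact K" "F 0 = \<phi>" using \<delta> assms F_0 by auto
  show "F t q = \<phi> q" if "q \<notin> K" for t q using F_off that assms by auto
  show "continuous_on ({-\<delta><..<\<delta>} \<times> UNIV) (\<lambda>(t, q). F t q)" by (rule F_continuous)
qed (simp_all add: F_smooth variation_field)

lemma F_area:
  assumes t: "\<bar>t\<bar> < \<delta>" and S: "cbox lo hi \<subseteq> U"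
    and dom: "\<And>p. p \<in> cbox lo hi \<Longrightarrow> (t, p) \<in> L.var_dom \<xi>"
    and int: "(\<lambda>p. sqrt (L.var_area \<xi> (t, p))) integrable_on cbox lo hi"
  shows "has_area A B G (F t) (chart_map a ` cbox lo hi) (integral (cbox lo hi) (\<lambda>p. sqrt (L.var_area \<xi> (t, p))))"
proof -
  have rep: "loc_rep a b (F t) p = L.var \<xi> t p" if "p \<in> U" for p
    using that UM_inv(3)[OF that] chart_inv_map[OF cb var_in_dom[OF t that]] by (simp add: loc_rep_def F_def)
  have sub: "cbox lo hi \<subseteq> loc_dom a b (F t)"
    using S U_dom UM_inv(3) var_in_dom[OF t] by (auto simp: loc_dom_def F_def)
  have "det (gram (pullback (G b) (loc_rep a b (F t))) p) = L.var_area \<xi> (t, p)" if p: "p \<in> cbox lo hi" for p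
  proof -
    have pU: "p \<in> U" using p S by auto
    have "fderiv (loc_rep a b (F t)) p = fderiv (L.var \<xi> t) p"
      by (rule fderiv_cong_open(1)[OF L.open_U pU rep])
    then have "gram (pullback (G b) (loc_rep a b (F t))) p = gram (pullback (G b) (L.var \<xi> t)) p"
      by (simp add: gram_def pullback_def rep[OF pU])
    then show ?thesis using L.det_gram_var[OF pU \<xi>_smooth dom[OF p]] by simp
  qed
  then have "((\<lambda>p. sqrt (det (gram (pullback (G b) (loc_rep a b (F t))) p))) has_integral
     integral (cbox lo hi) (\<lambda>p. sqrt (L.var_area \<xi> (t, p)))) (cbox lo hi)"
    by (intro has_integral_eq[OF _ integrable_integral[OF int]]) simp
  then show ?thesis
    unfolding has_area_def
    using a b sub
    by (intro exI[of _ "1::nat"] exI[of _ "\<lambda>_. a"] exI[of _ "\<lambda>_. b"] exI[of _ "\<lambda>_. cbox lo hi"]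
        exI[of _ "\<lambda>_. integral (cbox lo hi) (\<lambda>p. sqrt (L.var_area \<xi> (t, p)))"])
      (auto simp: disjoint_family_on_def lessThan_Suc)
qed

end

text \<open>The weak form of \<open>div JH = 0\<close>: the first variation of area along \<open>J\<nabla>\<psi>\<close>.\<close>

lemma stationary_weak:
  assumes stat: "hamiltonian_stationary A B G \<phi>"
    and S: "cbox lo hi \<subseteq> U" "N \<subseteq> cbox lo hi"
  shows "integral (cbox lo hi) (\<lambda>p. fderiv \<psi> p (sqrt (L.gdet p) *\<^sub>R L.T p)) = 0"
proof -
  obtain \<delta> where \<delta>: "\<delta> > 0" and dom: "\<And>t p. \<bar>t\<bar> < \<delta> \<Longrightarrow> p \<in> cbox lo hi \<Longrightarrow> (t, p) \<in> L.var_dom \<xi>"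
    and int: "\<And>t. \<bar>t\<bar> < \<delta> \<Longrightarrow> (\<lambda>p. sqrt (L.var_area \<xi> (t, p))) integrable_on cbox lo hi"
    and D: "((\<lambda>t. integral (cbox lo hi) (\<lambda>p. sqrt (L.var_area \<xi> (t, p)))) has_real_derivative
        integral (cbox lo hi) (\<lambda>p. - 2 * sqrt (L.gdet p) * L.gg p (L.T p) (X p))) (at 0)"
    using L.first_variation_area[OF X_smooth S(1), folded \<xi>_def[abs_def]] by blast
  have vd: "L.var \<xi> t p \<in> chart_dom b" if "\<bar>t\<bar> < \<delta>" "p \<in> N" for t p
    using dom[OF that(1)] S(2) that(2) by (auto simp: L.var_dom_def)
  let ?K = "chart_map a ` cbox lo hi"
  have K: "compact ?K"
    by (rule compact_continuous_image[OF continuous_on_subset[OF chart_map_continuous[OF ca]] compact_cbox])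
      (use S(1) U_dom in auto)
  have hv: "hamiltonian_variation A B G \<phi> potential \<delta> ?K F"
    by (rule F_variation[OF \<delta> vd K]) (use S(2) in auto)
  have ar: "has_area A B G (F t) ?K (integral (cbox lo hi) (\<lambda>p. sqrt (L.var_area \<xi> (t, p))))" if "\<bar>t\<bar> < \<delta>" for t
    by (rule F_area[OF \<delta> vd that S(1) dom[OF that] int[OF that]])
  have "((\<lambda>t. integral (cbox lo hi) (\<lambda>p. sqrt (L.var_area \<xi> (t, p)))) has_real_derivative 0) (at 0)"
    by (rule stat[unfolded hamiltonian_stationary_def, rule_format, where f=potential and \<delta>=\<delta> and K="?K" and F=F])
      (intro conjI allI impI potential_smooth potential_support hv ar)
  from DERIV_unique[OF D this]
  have "integral (cbox lo hi) (\<lambda>p. - 2 * sqrt (L.gdet p) * L.gg p (L.T p) (X p)) = 0" .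
  moreover have "integral (cbox lo hi) (\<lambda>p. - 2 * sqrt (L.gdet p) * L.gg p (L.T p) (X p)) =
     integral (cbox lo hi) (\<lambda>p. - 2 * fderiv \<psi> p (sqrt (L.gdet p) *\<^sub>R L.T p))"
  proof (rule integral_cong)
    fix p assume "p \<in> cbox lo hi"
    then have p: "p \<in> U" using S by auto
    have "L.gg p (L.T p) (X p) = fderiv \<psi> p (L.T p)" using X_eq[OF p, of "L.T p"] L.I.g_sym[OF p, of "L.T p" "X p"] by simp
    then show "- 2 * sqrt (L.gdet p) * L.gg p (L.T p) (X p) = - 2 * fderiv \<psi> p (sqrt (L.gdet p) *\<^sub>R L.T p)"
      using linear_scale[OF smooth_on_linear_fderiv[OF \<psi>, of p]] by simp
  qed
  ultimately show ?thesis by simp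
qed

end

context lagrangian_surface
begin

text \<open>The Euler-Lagrange equation \<open>div JH = 0\<close>: bump functions on a box around \<open>p\<^sub>0\<close> that lies in the coordinate
  domain suffice to pass from the weak to the pointwise form.\<close>

lemma stationary_divergence:
  assumes stat: "hamiltonian_stationary A B G \<phi>" and a: "a \<in> A" and b: "b \<in> B" and p0: "p0 \<in> loc_dom a b \<phi>"
  defines "gdet \<equiv> lagrangian_chart.gdet (G b) (loc_rep a b \<phi>)" and "T \<equiv> lagrangian_chart.T (G b) (loc_rep a b \<phi>)"
  shows "fderiv (\<lambda>q. sqrt (gdet q) * T q $ 1) p0 e1 + fderiv (\<lambda>q. sqrt (gdet q) * T q $ 2) p0 e2 = 0"
proof -
  let ?U = "loc_dom a b \<phi>"
  interpret L: lagrangian_chart "chart_dom b" "G b" \<epsilon> ?U "loc_rep a b \<phi>"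
    by (rule lagrangian_chart[OF a b])
  obtain lo hi where box: "p0 \<in> box lo hi" "cbox lo hi \<subseteq> ?U"
    using open_contains_cbox[OF L.open_U p0] by metis
  obtain r where r: "r > 0" "cball p0 r \<subseteq> box lo hi"
    using open_contains_cball[THEN iffD1, OF open_box] box(1) by blast
  have V: "smooth_on ?U (\<lambda>p. sqrt (L.gdet p) *\<^sub>R L.T p)"
    by (intro smooth_intros L.open_U L.T_smooth L.gdet_smooth L.gdet_pos)
  have "fderiv (\<lambda>q. (sqrt (L.gdet q) *\<^sub>R L.T q) $ 1) p0 e1 + fderiv (\<lambda>q. (sqrt (L.gdet q) *\<^sub>R L.T q) $ 2) p0 e2 = 0"
  proof (rule divergence_zero[OF L.open_U box(2) r(2,1) V])
    fix \<psi> :: "real^2 \<Rightarrow> real" assume \<psi>: "smooth_on UNIV \<psi>" "\<And>x. x \<notin> ball p0 r \<Longrightarrow> \<psi> x = 0"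
    have sub: "cball p0 r \<subseteq> cbox lo hi" using r(2) box_subset_cbox by blast
    interpret chart_variation \<epsilon> A B G \<phi> a b "cball p0 r" \<psi>
      by unfold_locales (use a b \<psi> sub box(2) in auto)
    show "integral (cbox lo hi) (\<lambda>p. fderiv \<psi> p (sqrt (L.gdet p) *\<^sub>R L.T p)) = 0"
      by (rule stationary_weak[OF stat box(2) sub])
  qed
  then show ?thesis by (simp add: gdet_def T_def)
qed

end

section \<open>Hamiltonian stationary surfaces of constant mean curvature\<close>

theorem proposition3p1:
  fixes \<epsilon> c :: real
    and A :: "(real^2, 'm::{t2_space,second_countable_topology}) chart set"
    and B :: "(complex^2, 'n::{t2_space,second_countable_topology}) chart set"
    and G :: "(complex^2, 'n) chart \<Rightarrow> (complex^2) metric"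
    and \<phi> :: "'m \<Rightarrow> 'n"
  assumes "\<epsilon> \<in> {-1, 0, 1}"
    and "complex_space_form (4 * \<epsilon>) B G"
    and "smooth_atlas A"
    and "lagrangian_immersion A B G \<phi>"
    and "hamiltonian_stationary A B G \<phi>"
    and "constant_mean_curvature A B G \<phi> c" and "c \<noteq> 0"
  shows "parallel_second_ff A B G \<phi>"
proof -
  interpret S: lagrangian_surface \<epsilon> A B G \<phi>
    by unfold_locales (fact assms)+
  show ?thesis
    unfolding parallel_second_ff_def
  proof (intro ballI allI impI, elim conjE)
    fix a b p and X Y Z :: "real^2 \<Rightarrow> real^2"
    assume a: "a \<in> A" and b: "b \<in> B" and p: "p \<in> loc_dom a b \<phi>"
      and s: "smooth_on (loc_dom a b \<phi>) X" "smooth_on (loc_dom a b \<phi>) Y" "smooth_on (loc_dom a b \<phi>) Z"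
    interpret L: lagrangian_chart "chart_dom b" "G b" \<epsilon> "loc_dom a b \<phi>" "loc_rep a b \<phi>"
      by (rule S.lagrangian_chart[OF a b])
    have mc: "mean_curvature (G b) (loc_rep a b \<phi>) q = c" if "q \<in> loc_dom a b \<phi>" for q
      using assms(6) a b that unfolding constant_mean_curvature_def by blast
    have nonneg: "L.Gu q (L.H q) (L.H q) \<ge> 0" if "q \<in> loc_dom a b \<phi>" for q
      using L.g_pos_def[OF L.u_dom[OF that]] L.Gu_lin(9)[OF that, of 0] unfolding pos_def_def
      by (metis less_eq_real_def)
    have "c \<ge> 0" using mc[OF p] nonneg[OF p] by (auto simp: mean_curvature_def)
    interpret C: cmc_lagrangian_chart "chart_dom b" "G b" \<epsilon> "loc_dom a b \<phi>" "loc_rep a b \<phi>" c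
    proof
      show "c > 0" using \<open>c \<ge> 0\<close> assms(7) by simp
      show "L.Gu q (L.H q) (L.H q) = c\<^sup>2" if "q \<in> loc_dom a b \<phi>" for q
        using mc[OF that] nonneg[OF that] unfolding mean_curvature_def by (metis real_sqrt_pow2)
      show "fderiv (\<lambda>q. sqrt (L.gdet q) * L.T q $ 1) q e1 + fderiv (\<lambda>q. sqrt (L.gdet q) * L.T q $ 2) q e2 = 0"
        if "q \<in> loc_dom a b \<phi>" for q
        by (rule S.stationary_divergence[OF assms(5) a b that])
    qed
    show "nabla_second_ff (G b) (loc_rep a b \<phi>) X Y Z p = 0"
      by (rule C.second_ff_parallel[OF p s])
  qed
qed

end
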